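(* Let $L$ be a nontrivial (finite or countable) group and let $\Lambda$ be a countably infinite group. Let $\mu$ be a probability measure of finite entropy on $L\wr\Lambda$ whose support generates $L\wr\Lambda$ (as a group) and is concentrated on $$\{(\delta^{s},o): s\in L\}\cup\{(\mathbf{ID},x): x\in\Lambda\}.$$ If the projection $\mu_{\rm base}$ of $\mu$ on $\Lambda$ has support that does not generate $\Lambda$ as a semigroup, then the Poisson boundary of $(L\wr\Lambda,\mu)$ is $L^\Lambda$ endowed with the law of the limiting lamp configuration $\Phi_\infty$.
   Context: Restricted wreath product. For groups $L$ (identity $\mathrm{id}$) and $\Lambda$ (identity $o$), $L\wr\Lambda$ is the set of pairs $(\Phi,x)$ with $x\in\Lambda$ and $\Phi:\Lambda\to L$ with $\Phi(z)=\mathrm{id}$ for all but finitely many $z$, with product $(\Phi,x)(\Psi,y)=(\Phi\cdot(x\Psi),xy)$, where $(x\Psi)(z):=\Psi(x^{-1}z)$ and $\cdot$ is the pointwise product. $\mathbf{ID}$ is the function identically equal to $\mathrm{id}$; for $s\in L$, $\delta^s$ is the function equal to $s$ at $o$ and to $\mathrm{id}$ elsewhere. The projection of $\mu$ on $\Lambda$ is its push-forward under $(\Phi,x)\mapsto x$. Entropy of $\mu$: $H(\mu)=-\sum_g\mu(g)\log\mu(g)$. Random walk. For a probability measure $\mu$ on a countable group $\Gamma$, the $\mu$-walk is the Markov chain with transition probabilities $p(x,y)=\mu(x^{-1}y)$; $\mathbf P$ denotes the law on $\Gamma^{\mathbb N}$ ($\mathbb N\ni 0$) of the trajectory started at the identity.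 $\mathcal I$ is the $\sigma$-field of shift-invariant measurable subsets of $\Gamma^{\mathbb N}$; $\Gamma$ acts on $\Gamma^{\mathbb N}$ by diagonal left multiplication. Two $\sigma$-fields are equal mod $\mathbf P$ if their $\mathbf P$-completions are equal. Poisson boundary. A Poisson boundary of $(\Gamma,\mu)$ is a quadruple $(\Theta,\mathcal F,\nu,b)$ where $(\Theta,\mathcal F,\nu)$ is a probability space on which $\Gamma$ acts measurably, $\mathcal F$ is countably generated and separates points, and $b:(\Gamma^{\mathbb N},\mathcal I)\to(\Theta,\mathcal F)$ is a measurable map that is $\Gamma$-equivariant (for each $\gamma\in\Gamma$, $b(\gamma\omega)=\gamma b(\omega)$ for $\mathbf P$-a.e. $\omega$), pushes $\mathbf P$ forward to $\nu$, and satisfies $b^{-1}\mathcal F=\mathcal I$ mod $\mathbf P$. It is unique up to isomorphism. Meaning of the conclusion. Write the $\mu$-walk on $L\wr\Lambda$ started at the identity as $(\Phi_n,X_n)$, $n\ge0$. Let $\Phi_\infty:=\lim_n\Phi_n\in L^\Lambda$ be the pointwise limit (each coordinate eventually constant), which exists almost surely under the present hypotheses. "The Poisson boundary is $L^\Lambda$ endowed with the law of $\Phi_\infty$" means that $(L^\Lambda,\mathcal F,\nu,b)$ is a Poisson boundary of $(L\wr\Lambda,\mu)$, where $\mathcal F$ is the product $\sigma$-field, $\nu$ is the law of $\Phi_\infty$, $L\wr\Lambda$ acts on $L^\Lambda$ by $(\Phi,x)\cdot\phi=\Phi\cdot(x\phi)$ with $(x\phi)(z)=\phi(x^{-1}z)$,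 and $b$ sends a trajectory to its limiting lamp configuration if it exists and to $\mathbf{ID}$ otherwise. *)

theory Defs
  imports
    "HOL-Probability.Probability"
    "HOL-Algebra.Group_Action"
    "HOL-Algebra.Generated_Groups"
begin

section \<open>Restricted wreath products\<close>

text \<open>
  The set \<open>L\<^sup>\<Lambda>\<close> is represented by the functions from the carrier of \<open>\<Lambda>\<close> to the carrier of \<open>L\<close>
  that are extensional (arbitrary but fixed outside of the carrier of \<open>\<Lambda>\<close>).
\<close>

definition configs :: "('a, 'c) monoid_scheme \<Rightarrow> ('b, 'd) monoid_scheme \<Rightarrow> ('b \<Rightarrow> 'a) set" where
  "configs L \<Lambda> = carrier \<Lambda> \<rightarrow>\<^sub>E carrier L"

definition config_one :: "('a, 'c) monoid_scheme \<Rightarrow> ('b, 'd) monoid_scheme \<Rightarrow> 'b \<Rightarrow> 'a" where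
  "config_one L \<Lambda> = (\<lambda>z\<in>carrier \<Lambda>. \<one>\<^bsub>L\<^esub>)"

definition config_mult ::
  "('a, 'c) monoid_scheme \<Rightarrow> ('b, 'd) monoid_scheme \<Rightarrow> ('b \<Rightarrow> 'a) \<Rightarrow> ('b \<Rightarrow> 'a) \<Rightarrow> 'b \<Rightarrow> 'a" where
  "config_mult L \<Lambda> \<Phi> \<Psi> = (\<lambda>z\<in>carrier \<Lambda>. \<Phi> z \<otimes>\<^bsub>L\<^esub> \<Psi> z)"

definition config_translate :: "('b, 'd) monoid_scheme \<Rightarrow> 'b \<Rightarrow> ('b \<Rightarrow> 'a) \<Rightarrow> 'b \<Rightarrow> 'a" where
  "config_translate \<Lambda> x \<Psi> = (\<lambda>z\<in>carrier \<Lambda>. \<Psi> (inv\<^bsub>\<Lambda>\<^esub> x \<otimes>\<^bsub>\<Lambda>\<^esub> z))"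

definition config_delta ::
  "('a, 'c) monoid_scheme \<Rightarrow> ('b, 'd) monoid_scheme \<Rightarrow> 'a \<Rightarrow> 'b \<Rightarrow> 'a" where
  "config_delta L \<Lambda> s = (\<lambda>z\<in>carrier \<Lambda>. if z = \<one>\<^bsub>\<Lambda>\<^esub> then s else \<one>\<^bsub>L\<^esub>)"

definition wreath ::
  "('a, 'c) monoid_scheme \<Rightarrow> ('b, 'd) monoid_scheme \<Rightarrow> (('b \<Rightarrow> 'a) \<times> 'b) monoid" where
  "wreath L \<Lambda> =
    \<lparr>carrier = {\<Phi> \<in> configs L \<Lambda>. finite {z \<in> carrier \<Lambda>. \<Phi> z \<noteq> \<one>\<^bsub>L\<^esub>}} \<times> carrier \<Lambda>,
     mult = (\<lambda>(\<Phi>, x) (\<Psi>, y).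
       (config_mult L \<Lambda> \<Phi> (config_translate \<Lambda> x \<Psi>), x \<otimes>\<^bsub>\<Lambda>\<^esub> y)),
     one = (config_one L \<Lambda>, \<one>\<^bsub>\<Lambda>\<^esub>)\<rparr>"

text \<open>
  The action of the wreath product on \<open>L\<^sup>\<Lambda>\<close>. It is made extensional in the configuration because
  \<^locale>\<open>group_action\<close> asks for this.
\<close>

definition config_action ::
  "('a, 'c) monoid_scheme \<Rightarrow> ('b, 'd) monoid_scheme \<Rightarrow> ('b \<Rightarrow> 'a) \<times> 'b \<Rightarrow> ('b \<Rightarrow> 'a) \<Rightarrow> 'b \<Rightarrow> 'a" where
  "config_action L \<Lambda> =
    (\<lambda>(\<Phi>, x). \<lambda>\<phi>\<in>configs L \<Lambda>. config_mult L \<Lambda> \<Phi> (config_translate \<Lambda> x \<phi>))"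

inductive_set semigroup_generate :: "('a, 'c) monoid_scheme \<Rightarrow> 'a set \<Rightarrow> 'a set"
  for G (structure) and S where
    incl: "s \<in> S \<Longrightarrow> s \<in> semigroup_generate G S"
  | mult: "g \<in> semigroup_generate G S \<Longrightarrow> h \<in> semigroup_generate G S \<Longrightarrow>
      g \<otimes> h \<in> semigroup_generate G S"


section \<open>Random walks\<close>

text \<open>
  A probability measure on a countable group is a \<^typ>\<open>'a pmf\<close> whose support lies in the carrier.
  In the entropy, every summand is nonnegative, and it is \<open>0\<close> where \<open>pmf \<mu> g = 0\<close>.
\<close>

definition pmf_entropy :: "'a pmf \<Rightarrow> ennreal" where
  "pmf_entropy \<mu> = (\<Sum>\<^sub>\<infinity>g. ennreal (- (pmf \<mu> g * ln (pmf \<mu> g))))"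

definition trajectories :: "('a, 'c) monoid_scheme \<Rightarrow> (nat \<Rightarrow> 'a) measure" where
  "trajectories G = PiM UNIV (\<lambda>_. count_space (carrier G))"

primrec walk_position :: "('a, 'c) monoid_scheme \<Rightarrow> (nat \<Rightarrow> 'a) \<Rightarrow> nat \<Rightarrow> 'a" where
  "walk_position G \<xi> 0 = \<one>\<^bsub>G\<^esub>"
| "walk_position G \<xi> (Suc n) = walk_position G \<xi> n \<otimes>\<^bsub>G\<^esub> \<xi> n"

text \<open>
  The law of the \<open>\<mu>\<close>-walk started at the identity, realised with independent increments of law \<open>\<mu>\<close>.
  The increments are restricted to the carrier to make \<^const>\<open>walk_position\<close> take its values there.
  The lemma \<open>walk_law_cylinder\<close> below shows that this is the law of the Markov chain
  with transition probabilities \<open>p(x, y) = \<mu> (x\<^sup>-\<^sup>1 y)\<close>.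
\<close>

definition walk_law :: "('a, 'c) monoid_scheme \<Rightarrow> 'a pmf \<Rightarrow> (nat \<Rightarrow> 'a) measure" where
  "walk_law G \<mu> =
    distr (PiM UNIV (\<lambda>_. restrict_space (measure_pmf \<mu>) (carrier G))) (trajectories G)
      (walk_position G)"

lemma space_trajectories: "space (trajectories G) = {\<omega>. \<forall>n. \<omega> n \<in> carrier G}"
  by (auto simp: trajectories_def space_PiM PiE_def Pi_def)

lemma sets_walk_law [simp]: "sets (walk_law G \<mu>) = sets (trajectories G)"
  and space_walk_law [simp]: "space (walk_law G \<mu>) = space (trajectories G)"
  by (simp_all add: walk_law_def)

lemma prob_space_increment:
  assumes "set_pmf \<mu> \<subseteq> carrier G"
  shows "prob_space (restrict_space (measure_pmf \<mu>) (carrier G))"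
proof (rule prob_spaceI)
  have "emeasure (measure_pmf \<mu>) (carrier G) = 1"
    using assms by (auto intro!: measure_pmf.emeasure_eq_1_AE simp: AE_measure_pmf_iff)
  then show "emeasure (restrict_space (measure_pmf \<mu>) (carrier G))
      (space (restrict_space (measure_pmf \<mu>) (carrier G))) = 1"
    by (simp add: emeasure_restrict_space space_restrict_space)
qed

lemma walk_position_closed:
  assumes "group G" "\<And>n. \<xi> n \<in> carrier G"
  shows "walk_position G \<xi> n \<in> carrier G"
proof -
  interpret group G by fact
  show ?thesis using assms(2) by (induction n) auto
qed

lemma walk_position_measurable:
  assumes "group G" "countable (carrier G)"
  shows "walk_position G \<in>
    measurable (PiM UNIV (\<lambda>_. restrict_space (measure_pmf \<mu>) (carrier G))) (trajectories G)"
proof -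
  interpret group G by fact
  let ?M = "PiM UNIV (\<lambda>_::nat. restrict_space (measure_pmf \<mu>) (carrier G))"
  let ?C = "count_space (carrier G)"
  have c: "(\<lambda>\<xi>. \<xi> n) \<in> measurable ?M ?C" for n
    by (rule measurable_compose[OF measurable_component_singleton[of n]])
       (auto simp: measurable_def space_restrict_space sets_restrict_space)
  have "(\<lambda>\<xi>. walk_position G \<xi> n) \<in> measurable ?M ?C" for n
  proof (induction n)
    case (Suc n)
    have "(\<lambda>\<xi>. (walk_position G \<xi> n, \<xi> n)) \<in> measurable ?M (?C \<Otimes>\<^sub>M ?C)"
      using Suc c by (rule measurable_Pair)
    moreover have "(\<lambda>(x, y). x \<otimes>\<^bsub>G\<^esub> y) \<in> measurable (?C \<Otimes>\<^sub>M ?C) ?C"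
      using assms(2) by (auto simp: pair_measure_countable)
    ultimately show ?case
      using measurable_compose by fastforce
  qed auto
  then show ?thesis
    unfolding trajectories_def by (intro measurable_PiM_single') (auto simp: measurable_space space_PiM PiE_def Pi_def space_restrict_space assms walk_position_closed)
qed

lemma prob_space_walk_law:
  assumes "group G" "countable (carrier G)" "set_pmf \<mu> \<subseteq> carrier G"
  shows "prob_space (walk_law G \<mu>)"
proof -
  interpret product_prob_space "\<lambda>_::nat. restrict_space (measure_pmf \<mu>) (carrier G)" UNIV
    using prob_space_increment[OF assms(3)]
    by (auto simp: product_prob_space_def product_sigma_finite_def product_prob_space_axioms_def
        intro: prob_space_imp_sigma_finite)
  show ?thesis
    unfolding walk_law_def by (rule prob_space_distr[OF walk_position_measurable[OF assms(1,2)]])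
qed

lemma walk_law_cylinder:
  assumes "group G" "countable (carrier G)" "set_pmf \<mu> \<subseteq> carrier G"
    and x: "\<And>i. i \<le> n \<Longrightarrow> x i \<in> carrier G"
  shows "measure (walk_law G \<mu>) {\<omega> \<in> space (walk_law G \<mu>). \<forall>i\<le>n. \<omega> i = x i} =
    (if x 0 = \<one>\<^bsub>G\<^esub> then \<Prod>i<n. pmf \<mu> (inv\<^bsub>G\<^esub> (x i) \<otimes>\<^bsub>G\<^esub> x (Suc i)) else 0)"
proof -
  interpret group G by fact
  let ?N = "restrict_space (measure_pmf \<mu>) (carrier G)"
  let ?M = "PiM UNIV (\<lambda>_::nat. ?N)"
  interpret product_prob_space "\<lambda>_::nat. ?N" UNIV
    using prob_space_increment[OF assms(3)]
    by (auto simp: product_prob_space_def product_sigma_finite_def product_prob_space_axioms_def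
        intro: prob_space_imp_sigma_finite)
  let ?s = "\<lambda>i. inv\<^bsub>G\<^esub> (x i) \<otimes>\<^bsub>G\<^esub> x (Suc i)"
  let ?A = "{\<omega> \<in> space (walk_law G \<mu>). \<forall>i\<le>n. \<omega> i = x i}"
  have sp: "\<xi> i \<in> carrier G" if "\<xi> \<in> space ?M" for \<xi> i
    using that by (auto simp: space_PiM PiE_def Pi_def space_restrict_space)
  have A: "?A \<in> sets (trajectories G)"
  proof -
    have "?A = {\<omega> \<in> space (trajectories G). \<forall>i\<in>{..n}. \<omega> i \<in> {x i}}" by auto
    also have "\<dots> \<in> sets (trajectories G)"
    proof (rule sets.sets_Collect_finite_All)
      fix i assume "i \<in> {..n}"
      have "(\<lambda>\<omega>. \<omega> i) \<in> measurable (trajectories G) (count_space (carrier G))"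
        unfolding trajectories_def by (rule measurable_component_singleton) simp
      from measurable_sets[OF this, of "{x i}"] x[of i] \<open>i \<in> {..n}\<close>
      show "{\<omega> \<in> space (trajectories G). \<omega> i \<in> {x i}} \<in> sets (trajectories G)"
        by (simp add: vimage_def Int_def conj_commute)
    qed simp
    finally show ?thesis .
  qed
  have iff: "(\<forall>i\<le>n. walk_position G \<xi> i = x i) \<longleftrightarrow> x 0 = \<one>\<^bsub>G\<^esub> \<and> (\<forall>i<n. \<xi> i = ?s i)"
    if \<xi>: "\<xi> \<in> space ?M" for \<xi>
    using x
  proof (induction n)
    case (Suc n)
    then have IH: "(\<forall>i\<le>n. walk_position G \<xi> i = x i) \<longleftrightarrow> x 0 = \<one>\<^bsub>G\<^esub> \<and> (\<forall>i<n. \<xi> i = ?s i)"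
      by simp
    have c: "x n \<in> carrier G" "x (Suc n) \<in> carrier G" "\<xi> n \<in> carrier G"
      using Suc.prems sp[OF \<xi>] by auto
    have "x n \<otimes>\<^bsub>G\<^esub> \<xi> n = x (Suc n) \<longleftrightarrow> \<xi> n = ?s n"
    proof
      assume "x n \<otimes>\<^bsub>G\<^esub> \<xi> n = x (Suc n)"
      from this[symmetric] show "\<xi> n = ?s n"
        using c by (simp add: m_assoc[symmetric])
    qed (use c in \<open>simp add: m_assoc[symmetric]\<close>)
    then show ?case
      using IH by (auto simp: le_Suc_eq less_Suc_eq)
  qed auto
  have "measure (walk_law G \<mu>) S = measure ?M (walk_position G -` S \<inter> space ?M)"
    if "S \<in> sets (trajectories G)" for S
    unfolding walk_law_def by (rule measure_distr[OF walk_position_measurable[OF assms(1,2)] that])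
  then have "measure (walk_law G \<mu>) ?A = measure ?M (walk_position G -` ?A \<inter> space ?M)"
    using A by blast
  also have "walk_position G -` ?A \<inter> space ?M =
      {\<xi> \<in> space ?M. \<forall>i\<le>n. walk_position G \<xi> i = x i}"
    using sp walk_position_closed[OF assms(1)] by (auto simp: space_trajectories)
  also have "\<dots> = {\<xi> \<in> space ?M. x 0 = \<one>\<^bsub>G\<^esub> \<and> (\<forall>i<n. \<xi> i = ?s i)}"
    using iff by blast
  also have "measure ?M \<dots> = (if x 0 = \<one>\<^bsub>G\<^esub> then \<Prod>i<n. pmf \<mu> (?s i) else 0)"
  proof (cases "x 0 = \<one>\<^bsub>G\<^esub>")
    case True
    have s: "?s i \<in> carrier G" if "i < n" for i
      using x[of i] x[of "Suc i"] that by auto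
    have "{\<xi> \<in> space ?M. x 0 = \<one>\<^bsub>G\<^esub> \<and> (\<forall>i<n. \<xi> i = ?s i)} =
        {\<xi> \<in> space ?M. \<forall>i\<in>{..<n}. \<xi> i \<in> {?s i}}"
      using True by auto
    also have "emeasure ?M \<dots> = (\<Prod>i<n. emeasure ?N {?s i})"
      using s by (intro emeasure_PiM_Collect) (auto simp: sets_restrict_space)
    also have "\<dots> = (\<Prod>i<n. ennreal (pmf \<mu> (?s i)))"
      using s by (intro prod.cong) (auto simp: emeasure_restrict_space emeasure_pmf_single)
    also have "\<dots> = ennreal (\<Prod>i<n. pmf \<mu> (?s i))"
      by (simp add: prod_ennreal)
    finally show ?thesis using True by (simp add: measure_def prod_nonneg)
  qed auto
  finally show ?thesis .
qed


section \<open>Poisson boundaries\<close>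

definition invariant_algebra :: "('a, 'c) monoid_scheme \<Rightarrow> (nat \<Rightarrow> 'a) measure" where
  "invariant_algebra G = sigma (space (trajectories G))
    {A \<in> sets (trajectories G). (\<lambda>\<omega> n. \<omega> (Suc n)) -` A \<inter> space (trajectories G) = A}"

text \<open>
  The \<open>P\<close>-completion of a sub-\<open>\<sigma>\<close>-field \<open>\<A>\<close> is generated by \<open>\<A>\<close> and all the \<open>P\<close>-negligible sets, not
  just by those which are contained in a \<open>P\<close>-null member of \<open>\<A>\<close>.
\<close>

definition completion_in :: "'a measure \<Rightarrow> 'a set set \<Rightarrow> 'a set set" where
  "completion_in P \<A> = sigma_sets (space P) (\<A> \<union> null_sets (completion P))"

definition eq_mod :: "'a measure \<Rightarrow> 'a set set \<Rightarrow> 'a set set \<Rightarrow> bool" where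
  "eq_mod P \<A> \<B> \<longleftrightarrow> completion_in P \<A> = completion_in P \<B>"

definition countably_generated :: "'a measure \<Rightarrow> bool" where
  "countably_generated M \<longleftrightarrow>
    (\<exists>\<C>. countable \<C> \<and> \<C> \<subseteq> Pow (space M) \<and> sets M = sigma_sets (space M) \<C>)"

definition separates_points :: "'a measure \<Rightarrow> bool" where
  "separates_points M \<longleftrightarrow>
    (\<forall>x\<in>space M. \<forall>y\<in>space M. x \<noteq> y \<longrightarrow> (\<exists>A\<in>sets M. x \<in> A \<and> y \<notin> A))"

text \<open>
  The measure space \<open>\<Theta>\<close> comprises the set, the \<open>\<sigma>\<close>-field and the measure of the boundary. Since
  the group is countable, an action is measurable as soon as each element acts measurably.
\<close>

definition poisson_boundary ::
  "('a, 'c) monoid_scheme \<Rightarrow> 'a pmf \<Rightarrow> 't measure \<Rightarrow> ('a \<Rightarrow> 't \<Rightarrow> 't) \<Rightarrow> ((nat \<Rightarrow> 'a) \<Rightarrow> 't) \<Rightarrow> bool" where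
  "poisson_boundary G \<mu> \<Theta> act b \<longleftrightarrow>
    prob_space \<Theta> \<and> countably_generated \<Theta> \<and> separates_points \<Theta> \<and>
    group_action G (space \<Theta>) act \<and> (\<forall>g\<in>carrier G. act g \<in> measurable \<Theta> \<Theta>) \<and>
    b \<in> measurable (invariant_algebra G) \<Theta> \<and>
    (\<forall>g\<in>carrier G. AE \<omega> in walk_law G \<mu>. b (\<lambda>n. g \<otimes>\<^bsub>G\<^esub> \<omega> n) = act g (b \<omega>)) \<and>
    distr (walk_law G \<mu>) \<Theta> b = \<Theta> \<and>
    eq_mod (walk_law G \<mu>) (sets (vimage_algebra (space (trajectories G)) b \<Theta>))
      (sets (invariant_algebra G))"


section \<open>The limiting lamp configuration\<close>

definition lamps_stabilize :: "('b, 'd) monoid_scheme \<Rightarrow> (nat \<Rightarrow> ('b \<Rightarrow> 'a) \<times> 'b) \<Rightarrow> bool" where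
  "lamps_stabilize \<Lambda> \<omega> \<longleftrightarrow>
    (\<forall>z\<in>carrier \<Lambda>. \<exists>l. \<forall>\<^sub>F n in sequentially. fst (\<omega> n) z = l)"

definition limit_config ::
  "('a, 'c) monoid_scheme \<Rightarrow> ('b, 'd) monoid_scheme \<Rightarrow> (nat \<Rightarrow> ('b \<Rightarrow> 'a) \<times> 'b) \<Rightarrow> 'b \<Rightarrow> 'a" where
  "limit_config L \<Lambda> \<omega> =
    (if lamps_stabilize \<Lambda> \<omega>
     then \<lambda>z\<in>carrier \<Lambda>. THE l. \<forall>\<^sub>F n in sequentially. fst (\<omega> n) z = l
     else config_one L \<Lambda>)"

definition config_algebra ::
  "('a, 'c) monoid_scheme \<Rightarrow> ('b, 'd) monoid_scheme \<Rightarrow> ('b \<Rightarrow> 'a) measure" where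
  "config_algebra L \<Lambda> = PiM (carrier \<Lambda>) (\<lambda>_. count_space (carrier L))"

definition limit_law ::
  "('a, 'c) monoid_scheme \<Rightarrow> ('b, 'd) monoid_scheme \<Rightarrow> (('b \<Rightarrow> 'a) \<times> 'b) pmf \<Rightarrow> ('b \<Rightarrow> 'a) measure" where
  "limit_law L \<Lambda> \<mu> = distr (walk_law (wreath L \<Lambda>) \<mu>) (config_algebra L \<Lambda>) (limit_config L \<Lambda>)"

end

theory Submission
  imports Defs
begin

text \<open>
  Let \<open>S\<close> be the semigroup generated by the support of the base projection, \<open>U\<close> its group of units
  and \<open>T = S - U\<close>. Since \<open>S \<noteq> \<Lambda>\<close>, some steps lie in \<open>T\<close>, and after such a step the walker never
  returns to the sites visited before it. Hence the trajectory splits into excursions in cosets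
  \<open>X\<^sub>m U\<close>, entered at the times \<open>m\<close> that follow a step in \<open>T\<close>, and at such a time the lamp
  configuration is the restriction of \<open>\<Phi>\<^sub>\<infinity>\<close> to the sites \<open>y\<close> with \<open>y\<^sup>-\<^sup>1 X\<^sub>m \<in> T\<close>. So every site \<open>z\<close> that
  is lit in \<open>\<Phi>\<^sub>\<infinity>\<close> determines, through \<open>\<Phi>\<^sub>\<infinity>\<close> alone, a group element \<open>(\<Phi>\<^sub>m, X\<^sub>m u)\<close> with \<open>u \<in> U\<close>, and
  since the excursions are i.i.d., \<open>u\<close> ranges over a finite set with probability close to \<open>1\<close>.

  For an invariant event \<open>E\<close> let \<open>h g\<close> be the probability that the walk started at \<open>g\<close> is in \<open>E\<close>.
  Along the trajectory \<open>h\<close> tends to the indicator of \<open>E\<close>, and by the Harnack inequality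
  \<open>\<mu> s * h (g s) \<le> h g\<close>, applied to \<open>E\<close> and to its complement, it does so at \<open>(\<Phi>\<^sub>m, X\<^sub>m u)\<close> as well.
  Therefore \<open>E\<close> is approximated by events that depend on \<open>\<Phi>\<^sub>\<infinity>\<close> only.
\<close>

section \<open>Random walks on countable groups\<close>

text \<open>The obstacle is that the past does not reveal whether the coset just entered will be
  lit: \<open>selected\<close> looks at the whole final configuration, so the independence of past
  and excursion cannot be applied at the selected entry itself. \<open>first_entry\<close> keeps
  what is visible at the time of entry. It may hold at many times, but at most one of them has a lit
  coset; this bounds their expected number, and so the probability that any of them has lit sites
  outside a given finite set. The final configuration carries no clock. The number of lit lamps
  replaces time: it grows along entries, can be read off a candidate and is at most the elapsed
  time. The convergence of h is used quantitatively. The indicator of E is replaced by that of an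
  event decided by N increments, and a maximal inequality controls the distance of h from it at all
  times after N. Taking N also as the threshold for the number of lit lamps places the selected
  entry in this range.\<close>

definition shift_seq :: "nat \<Rightarrow> (nat \<Rightarrow> 'a) \<Rightarrow> nat \<Rightarrow> 'a" where
  "shift_seq n \<xi> = (\<lambda>i. \<xi> (i + n))"

lemma shift_seq_apply [simp]: "shift_seq n \<xi> i = \<xi> (i + n)"
  by (simp add: shift_seq_def)

lemma shift_seq_comb_seq [simp]: "shift_seq n (comb_seq n \<xi> \<eta>) = \<eta>"
  by (auto simp: comb_seq_def)

lemma shift_seq_shift_seq [simp]: "shift_seq m (shift_seq n \<xi>) = shift_seq (m + n) \<xi>"
  by (auto simp: add.assoc)

lemma walk_position_cong:
  "(\<And>i. i < n \<Longrightarrow> \<xi> i = \<eta> i) \<Longrightarrow> walk_position G \<xi> n = walk_position G \<eta> n"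
  by (induction n) auto

text \<open>These events generate \<open>invariant_algebra G\<close>. Membership of a trajectory and
  of its shift can be compared directly for them, which is how invariance enters below.\<close>

definition invariant_sets :: "('a, 'c) monoid_scheme \<Rightarrow> (nat \<Rightarrow> 'a) set set" where
  "invariant_sets G =
    {A \<in> sets (trajectories G). (\<lambda>\<omega> n. \<omega> (Suc n)) -` A \<inter> space (trajectories G) = A}"

lemma invariant_sets_shift:
  assumes "E \<in> invariant_sets G" "\<omega> \<in> space (trajectories G)"
  shows "(\<lambda>m. \<omega> (m + n)) \<in> E \<longleftrightarrow> \<omega> \<in> E"
proof (induction n)
  case (Suc n)
  have "(\<lambda>m. \<omega> (m + n)) \<in> space (trajectories G)"
    using assms(2) by (simp add: space_trajectories)
  then have "(\<lambda>m. \<omega> (Suc m + n)) \<in> E \<longleftrightarrow> (\<lambda>m. \<omega> (m + n)) \<in> E"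
    using assms(1) unfolding invariant_sets_def by fastforce
  then show ?case using Suc by simp
qed auto

lemma invariant_sets_compl:
  assumes "E \<in> invariant_sets G"
  shows "space (trajectories G) - E \<in> invariant_sets G"
proof -
  have "\<omega> \<in> space (trajectories G) \<Longrightarrow> (\<lambda>n. \<omega> (Suc n)) \<in> E \<longleftrightarrow> \<omega> \<in> E"
    "\<omega> \<in> space (trajectories G) \<Longrightarrow> (\<lambda>n. \<omega> (Suc n)) \<in> space (trajectories G)" for \<omega>
    using invariant_sets_shift[OF assms, of \<omega> 1] by (auto simp: space_trajectories)
  then show ?thesis
    using assms by (auto simp: invariant_sets_def)
qed

locale group_walk = group G for G :: "('a, 'c) monoid_scheme" (structure) +
  fixes \<mu> :: "'a pmf"
  assumes countable_carrier: "countable (carrier G)"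
    and support: "set_pmf \<mu> \<subseteq> carrier G"
begin

abbreviation increments :: "(nat \<Rightarrow> 'a) measure" where
  "increments \<equiv> PiM UNIV (\<lambda>_. restrict_space (measure_pmf \<mu>) (carrier G))"

abbreviation prob :: "(nat \<Rightarrow> 'a) set \<Rightarrow> real" where
  "prob \<equiv> measure increments"

abbreviation walk :: "(nat \<Rightarrow> 'a) \<Rightarrow> nat \<Rightarrow> 'a" where
  "walk \<equiv> walk_position G"

sublocale step: prob_space "restrict_space (measure_pmf \<mu>) (carrier G)"
  by (rule prob_space_increment[OF support])

sublocale seq: sequence_space "restrict_space (measure_pmf \<mu>) (carrier G)"
  by unfold_locales

lemma space_increments: "space increments = {\<xi>. \<forall>n. \<xi> n \<in> carrier G}"
  by (auto simp: space_PiM space_restrict_space PiE_def Pi_def)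

lemma comb_seq_space:
  "\<xi> \<in> space increments \<Longrightarrow> \<eta> \<in> space increments \<Longrightarrow> comb_seq n \<xi> \<eta> \<in> space increments"
  by (auto simp: space_increments comb_seq_def)

lemma shift_space: "\<xi> \<in> space increments \<Longrightarrow> shift_seq n \<xi> \<in> space increments"
  by (auto simp: space_increments)

lemma coordinate_sets: "{\<xi> \<in> space increments. \<xi> i \<in> X} \<in> sets increments"
proof -
  have "(\<lambda>\<xi>. \<xi> i) -` (X \<inter> carrier G) \<inter> space increments \<in> sets increments"
    by (rule measurable_sets[OF measurable_component_singleton]) (auto simp: sets_restrict_space)
  also have "(\<lambda>\<xi>. \<xi> i) -` (X \<inter> carrier G) \<inter> space increments = {\<xi> \<in> space increments. \<xi> i \<in> X}"
    by (auto simp: space_increments)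
  finally show ?thesis .
qed

section \<open>Events decided by finitely many increments, and the Markov property\<close>

definition determined :: "nat \<Rightarrow> (nat \<Rightarrow> 'a) set \<Rightarrow> bool" where
  "determined n A \<longleftrightarrow> A \<subseteq> space increments \<and>
    (\<forall>\<xi>\<in>A. \<forall>\<eta>\<in>space increments. (\<forall>i<n. \<xi> i = \<eta> i) \<longrightarrow> \<eta> \<in> A)"

lemma determinedI:
  assumes "A \<subseteq> space increments"
    and "\<And>\<xi> \<eta>. \<xi> \<in> A \<Longrightarrow> \<eta> \<in> space increments \<Longrightarrow> (\<And>i. i < n \<Longrightarrow> \<xi> i = \<eta> i) \<Longrightarrow> \<eta> \<in> A"
  shows "determined n A"
  using assms unfolding determined_def by blast

lemma determinedD:
  assumes "determined n A" "\<xi> \<in> space increments" "\<eta> \<in> space increments"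
    and "\<And>i. i < n \<Longrightarrow> \<xi> i = \<eta> i"
  shows "\<xi> \<in> A \<longleftrightarrow> \<eta> \<in> A"
  using assms unfolding determined_def by metis

lemma determined_mono: "determined m A \<Longrightarrow> m \<le> n \<Longrightarrow> determined n A"
  unfolding determined_def by (meson order_less_le_trans)

text \<open>Such a set is a union of cylinders, one for each word of length \<open>n\<close>, and a
  countable group has only countably many words.\<close>

lemma determined_sets:
  assumes "determined n A"
  shows "A \<in> sets increments"
proof -
  let ?w = "\<lambda>\<xi>. map \<xi> [0..<n]"
  let ?c = "\<lambda>w. {\<xi> \<in> space increments. \<forall>i\<in>{..<n}. \<xi> i \<in> {w ! i}}"
  have "?w ` A \<subseteq> lists (carrier G)"
    using assms unfolding determined_def space_increments by fastforce
  then have "countable (?w ` A)"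
    using countable_carrier countable_lists countable_subset by blast
  moreover have "?c w \<in> sets increments" for w
    by (intro sets.sets_Collect_finite_All coordinate_sets) simp
  moreover have "A = (\<Union>w\<in>?w ` A. ?c w)"
    using assms unfolding determined_def by auto
  ultimately show ?thesis
    using sets.countable_UN'[of "?w ` A" ?c increments] by (simp only: image_subset_iff) simp
qed

lemma determined_Compl: "determined n A \<Longrightarrow> determined n (space increments - A)"
  by (rule determinedI) (auto dest: determinedD)

lemma determined_Int: "determined n A \<Longrightarrow> determined n B \<Longrightarrow> determined n (A \<inter> B)"
  by (rule determinedI) (auto simp: determined_def)

lemma determined_UN:
  assumes "\<And>i. i \<in> I \<Longrightarrow> determined n (A i)"
  shows "determined n (\<Union>i\<in>I. A i)"
  using assms unfolding determined_def by blast

text \<open>The inner measure is the conditional probability of \<open>X\<close> given the first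
  \<open>n\<close> increments. The formula is Fubini for the first \<open>n\<close> terms of one
  sequence glued to an independent copy, which has the same law again.\<close>

lemma emeasure_comb_seq:
  assumes "X \<in> sets increments"
  shows "emeasure increments X =
    (\<integral>\<^sup>+\<xi>. emeasure increments {\<eta> \<in> space increments. comb_seq n \<xi> \<eta> \<in> X} \<partial>increments)"
proof -
  let ?P = "increments \<Otimes>\<^sub>M increments" and ?f = "\<lambda>(\<xi>, \<eta>). comb_seq n \<xi> \<eta>"
  have f: "?f \<in> measurable ?P increments"
    by (rule measurable_comb_seq)
  have "emeasure increments X = emeasure (distr ?P increments ?f) X"
    by (simp add: seq.PiM_comb_seq)
  also have "\<dots> = emeasure ?P (?f -` X \<inter> space ?P)"
    using f assms by (rule emeasure_distr)
  also have "\<dots> = (\<integral>\<^sup>+\<xi>. emeasure increments (Pair \<xi> -` (?f -` X \<inter> space ?P)) \<partial>increments)"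
    by (rule seq.P.emeasure_pair_measure_alt) (use f assms in measurable)
  also have "\<dots> = (\<integral>\<^sup>+\<xi>. emeasure increments {\<eta> \<in> space increments. comb_seq n \<xi> \<eta> \<in> X} \<partial>increments)"
    by (intro nn_integral_cong arg_cong[where f="emeasure increments"])
       (auto simp: space_pair_measure)
  finally show ?thesis .
qed

text \<open>Gluing keeps the first \<open>n\<close> terms, so membership in \<open>A\<close>
  survives, and on \<open>A\<close> the conditional probability of \<open>A \<inter> X\<close> is
  that of \<open>X\<close>. A lower bound is enough, since complements supply the upper one.\<close>

lemma prob_determined_Int_ge:
  assumes A: "determined n A" and X: "X \<in> sets increments" and "0 \<le> \<delta>"
    and le: "\<And>\<xi>. \<xi> \<in> A \<Longrightarrow> \<delta> \<le> prob {\<eta> \<in> space increments. comb_seq n \<xi> \<eta> \<in> X}"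
  shows "\<delta> * prob A \<le> prob (A \<inter> X)"
proof -
  have As: "A \<in> sets increments" using A by (rule determined_sets)
  have "ennreal (\<delta> * prob A) = (\<integral>\<^sup>+\<xi>. ennreal \<delta> * indicator A \<xi> \<partial>increments)"
    using \<open>0 \<le> \<delta>\<close> As by (simp add: nn_integral_cmult_indicator ennreal_mult'' seq.P.emeasure_eq_measure)
  also have "\<dots> \<le> (\<integral>\<^sup>+\<xi>. emeasure increments {\<eta> \<in> space increments. comb_seq n \<xi> \<eta> \<in> A \<inter> X} \<partial>increments)"
  proof (intro nn_integral_mono)
    fix \<xi> assume \<xi>: "\<xi> \<in> space increments"
    show "ennreal \<delta> * indicator A \<xi> \<le> emeasure increments {\<eta> \<in> space increments. comb_seq n \<xi> \<eta> \<in> A \<inter> X}"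
    proof (cases "\<xi> \<in> A")
      case True
      then have "{\<eta> \<in> space increments. comb_seq n \<xi> \<eta> \<in> A \<inter> X} =
          {\<eta> \<in> space increments. comb_seq n \<xi> \<eta> \<in> X}"
        using determinedD[OF A \<xi>] comb_seq_space[OF \<xi>] by (auto simp: comb_seq_def)
      then show ?thesis
        using le[OF True] True by (simp add: seq.P.emeasure_eq_measure)
    qed auto
  qed
  also have "\<dots> = emeasure increments (A \<inter> X)"
    using As X by (intro emeasure_comb_seq[symmetric]) auto
  finally show ?thesis
    by (simp add: seq.P.emeasure_eq_measure)
qed

lemma shift_measurable: "shift_seq n \<in> measurable increments increments"
  unfolding shift_seq_def
  by (intro measurable_PiM_single' measurable_component_singleton)
     (auto simp: space_PiM PiE_def Pi_def)

lemma shift_sets: "B \<in> sets increments \<Longrightarrow> {\<xi> \<in> space increments. shift_seq n \<xi> \<in> B} \<in> sets increments"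
  using measurable_sets[OF shift_measurable] by (simp add: vimage_def Int_def conj_commute)

text \<open>The lower bounds for \<open>B\<close> and for its complement add up to
  \<open>prob A\<close>, so neither can be strict.\<close>

lemma prob_past_future:
  assumes A: "determined n A" and B: "B \<in> sets increments"
  shows "prob (A \<inter> {\<xi> \<in> space increments. shift_seq n \<xi> \<in> B}) = prob A * prob B"
proof -
  let ?B = "\<lambda>B. {\<xi> \<in> space increments. shift_seq n \<xi> \<in> B}"
  have As: "A \<in> sets increments" using A by (rule determined_sets)
  have ge: "prob C * prob A \<le> prob (A \<inter> ?B C)" if C: "C \<in> sets increments" for C
  proof (rule prob_determined_Int_ge[OF A shift_sets[OF C]])
    fix \<xi> assume "\<xi> \<in> A"
    then have "\<xi> \<in> space increments" using A by (auto simp: determined_def)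
    then have "{\<eta> \<in> space increments. comb_seq n \<xi> \<eta> \<in> ?B C} = C"
      using sets.sets_into_space[OF C] by (auto simp: comb_seq_space)
    then show "prob C \<le> prob {\<eta> \<in> space increments. comb_seq n \<xi> \<eta> \<in> ?B C}"
      by simp
  qed simp
  have arith: "x = a * b" if "a = x + y" "b * a \<le> x" "(1 - b) * a \<le> y" for a b x y :: real
  proof -
    have "a - b * a \<le> y" using that(3) by (simp add: left_diff_distrib)
    with that(1,2) have "x = b * a" by linarith
    then show ?thesis by simp
  qed
  have "prob A = prob ((A \<inter> ?B B) \<union> (A \<inter> ?B (space increments - B)))"
    using A by (intro arg_cong[where f=prob]) (auto simp: determined_def dest: shift_space)
  also have "\<dots> = prob (A \<inter> ?B B) + prob (A \<inter> ?B (space increments - B))"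
    using As B by (intro seq.P.finite_measure_Union sets.Int shift_sets sets.compl_sets) auto
  finally have "prob A = prob (A \<inter> ?B B) + prob (A \<inter> ?B (space increments - B))" .
  moreover have "prob (space increments - B) = 1 - prob B"
    using B by (rule seq.P.prob_compl)
  ultimately show ?thesis
    using ge[OF B] ge[OF sets.compl_sets[OF B]] by (intro arith) simp_all
qed

lemma prob_shift:
  "B \<in> sets increments \<Longrightarrow> prob {\<xi> \<in> space increments. shift_seq n \<xi> \<in> B} = prob B"
  using prob_past_future[of n "space increments" B] seq.P.prob_space
  by (auto simp: determined_def Int_absorb1 Collect_mono_iff Int_def)

text \<open>The set of exceptions to \<open>Q\<close> need not be measurable, so a null set covering
  it is pulled back along the measure-preserving shifts.\<close>

lemma AE_shift:
  assumes "AE \<xi> in increments. Q \<xi>"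
  shows "AE \<xi> in increments. \<forall>n. Q (shift_seq n \<xi>)"
proof -
  obtain N where N: "{\<xi> \<in> space increments. \<not> Q \<xi>} \<subseteq> N" "N \<in> sets increments" "prob N = 0"
    using assms by (auto elim!: AE_E simp: seq.P.emeasure_eq_measure)
  have "AE \<xi> in increments. Q (shift_seq n \<xi>)" for n
  proof (rule AE_I)
    show "{\<xi> \<in> space increments. \<not> Q (shift_seq n \<xi>)} \<subseteq> {\<xi> \<in> space increments. shift_seq n \<xi> \<in> N}"
      using N(1) by (auto dest: shift_space[of _ n])
    show "emeasure increments {\<xi> \<in> space increments. shift_seq n \<xi> \<in> N} = 0"
      using prob_shift[OF N(2)] N(3) by (simp add: seq.P.emeasure_eq_measure)
  qed (rule shift_sets[OF N(2)])
  then show ?thesis by (simp add: AE_all_countable)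
qed

lemma AE_in_support: "AE \<xi> in increments. \<forall>n. \<xi> n \<in> set_pmf \<mu>"
proof -
  have "AE \<xi> in increments. \<xi> n \<in> set_pmf \<mu>" for n
    by (rule AE_PiM_component)
       (auto simp: AE_restrict_space_iff AE_measure_pmf_iff step.prob_space_axioms intro!: AE_pmfI)
  then show ?thesis by (simp add: AE_all_countable)
qed

lemma prob_word:
  assumes "\<And>i. i < n \<Longrightarrow> w i \<in> carrier G"
  shows "prob {\<xi> \<in> space increments. \<forall>i<n. \<xi> i = w i} = (\<Prod>i<n. pmf \<mu> (w i))"
proof -
  have "{\<xi> \<in> space increments. \<forall>i<n. \<xi> i = w i} =
      {\<xi> \<in> space increments. \<forall>i\<in>{..<n}. \<xi> i \<in> {w i}}"
    by auto
  also have "emeasure increments \<dots> =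
      (\<Prod>i<n. emeasure (restrict_space (measure_pmf \<mu>) (carrier G)) {w i})"
    using assms by (intro seq.emeasure_PiM_Collect) (auto simp: sets_restrict_space)
  also have "\<dots> = (\<Prod>i<n. ennreal (pmf \<mu> (w i)))"
    using assms by (intro prod.cong) (auto simp: emeasure_restrict_space emeasure_pmf_single)
  also have "\<dots> = ennreal (\<Prod>i<n. pmf \<mu> (w i))"
    by (simp add: prod_ennreal)
  finally show ?thesis by (simp add: measure_def prod_nonneg)
qed

lemma determined_word: "determined n {\<xi> \<in> space increments. \<forall>i<n. \<xi> i = w i}"
  by (rule determinedI) auto

lemma prob_word_pos:
  assumes "\<And>i. i < n \<Longrightarrow> w i \<in> set_pmf \<mu>"
  shows "prob {\<xi> \<in> space increments. \<forall>i<n. \<xi> i = w i} > 0"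
  using assms support by (subst prob_word) (auto intro!: prod_pos simp: pmf_positive)

text \<open>
  The event that a word occurs in none of the consecutive disjoint blocks is the intersection of
  the event that it does not occur in the first block with a shift of the same event, so that its
  probability \<open>q\<close> satisfies \<open>q = (1 - p) q\<close>.
\<close>

lemma AE_word_frequently:
  assumes w: "\<And>i. i < n \<Longrightarrow> w i \<in> set_pmf \<mu>"
  shows "AE \<xi> in increments. \<forall>N. \<exists>m\<ge>N. \<forall>i<n. \<xi> (i + m) = w i"
proof -
  define A where "A = {\<xi> \<in> space increments. \<forall>i<n. \<xi> i = w i}"
  define Q where "Q = {\<xi> \<in> space increments. \<forall>j. shift_seq (j * n) \<xi> \<notin> A}"
  have A: "determined n A" unfolding A_def by (rule determined_word)
  have Qs: "Q \<in> sets increments"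
  proof -
    have "Q = space increments - (\<Union>j. {\<xi> \<in> space increments. shift_seq (j * n) \<xi> \<in> A})"
      by (auto simp: Q_def)
    then show ?thesis
      using shift_sets[OF determined_sets[OF A]] by auto
  qed
  have "Q = (space increments - A) \<inter> {\<xi> \<in> space increments. shift_seq n \<xi> \<in> Q}"
    (is "_ = ?R")
  proof (rule Set.set_eqI)
    fix \<xi>
    have "(\<forall>j. shift_seq (j * n) \<xi> \<notin> A) \<longleftrightarrow> shift_seq (0 * n) \<xi> \<notin> A \<and> (\<forall>j. shift_seq (Suc j * n) \<xi> \<notin> A)"
      by (metis not0_implies_Suc)
    moreover have "shift_seq (0 * n) \<xi> = \<xi>" by (simp add: shift_seq_def)
    moreover have "shift_seq (Suc j * n) \<xi> = shift_seq (j * n) (shift_seq n \<xi>)" for j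
      by (simp add: add.commute)
    ultimately show "\<xi> \<in> Q \<longleftrightarrow> \<xi> \<in> ?R"
      using shift_space[of \<xi> n] by (auto simp: Q_def)
  qed
  then have "prob Q = (1 - prob A) * prob Q"
    using prob_past_future[OF determined_Compl[OF A] Qs] seq.P.prob_compl[OF determined_sets[OF A]] by simp
  moreover have "prob A > 0" unfolding A_def using w by (rule prob_word_pos)
  ultimately have "prob Q = 0" by (simp add: algebra_simps)
  then have "AE \<xi> in increments. \<xi> \<notin> Q"
    using Qs by (intro AE_not_in null_setsI) (auto simp: seq.P.emeasure_eq_measure)
  \<comment> \<open>Up to here the word occurs at least once. Applied to the sequence shifted by
    every \<open>N\<close>, this gives infinitely many occurrences.\<close>
  from AE_space AE_shift[OF this] show ?thesis
  proof (eventually_elim, intro allI)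
    fix \<xi> N assume "\<xi> \<in> space increments" and "\<forall>n. shift_seq n \<xi> \<notin> Q"
    then obtain j where "shift_seq (j * n) (shift_seq N \<xi>) \<in> A"
      by (auto simp: Q_def dest: shift_space[of _ N])
    then have "\<forall>i<n. \<xi> (i + (j * n + N)) = w i" by (simp add: A_def)
    then show "\<exists>m\<ge>N. \<forall>i<n. \<xi> (i + m) = w i" using le_add2 by blast
  qed
qed

lemma walk_closed: "\<xi> \<in> space increments \<Longrightarrow> walk \<xi> n \<in> carrier G"
  by (rule walk_position_closed) (auto simp: space_increments is_group)

lemma walk_trajectory: "\<xi> \<in> space increments \<Longrightarrow> walk \<xi> \<in> space (trajectories G)"
  by (simp add: space_trajectories walk_closed)

lemma walk_add:
  assumes "\<xi> \<in> space increments"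
  shows "walk \<xi> (m + n) = walk \<xi> n \<otimes> walk (shift_seq n \<xi>) m"
proof (induction m)
  case (Suc m)
  have "\<xi> (m + n) \<in> carrier G" using assms by (auto simp: space_increments)
  moreover have "walk (shift_seq n \<xi>) m \<in> carrier G"
    using assms by (intro walk_closed shift_space)
  ultimately show ?case
    using Suc assms walk_closed by (simp add: m_assoc shift_seq_def)
qed (use assms walk_closed in simp)

lemma walk_measurable: "walk \<in> measurable increments (trajectories G)"
  by (rule walk_position_measurable) (auto simp: is_group countable_carrier)

lemma translate_measurable:
  assumes "g \<in> carrier G"
  shows "(\<lambda>\<omega> n. g \<otimes> \<omega> n) \<in> measurable (trajectories G) (trajectories G)"
proof -
  have "(\<lambda>\<omega>. g \<otimes> \<omega> n) \<in> measurable (trajectories G) (count_space (carrier G))" for n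
    by (rule measurable_compose[of "\<lambda>\<omega>. \<omega> n" _ "count_space (carrier G)"])
       (use assms in \<open>auto simp: trajectories_def intro: measurable_component_singleton\<close>)
  then have "(\<lambda>\<omega> n. g \<otimes> \<omega> n) \<in> measurable (trajectories G) (PiM UNIV (\<lambda>_. count_space (carrier G)))"
    by (intro measurable_PiM_single') (use assms in \<open>auto simp: space_trajectories\<close>)
  then show ?thesis by (simp add: trajectories_def)
qed

section \<open>Hitting probabilities of invariant events\<close>

definition hit_event :: "(nat \<Rightarrow> 'a) set \<Rightarrow> 'a \<Rightarrow> (nat \<Rightarrow> 'a) set" where
  "hit_event E g = {\<xi> \<in> space increments. (\<lambda>n. g \<otimes> walk \<xi> n) \<in> E}"

text \<open>For invariant \<open>E\<close> this is the bounded harmonic function h of the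
  overview.\<close>

definition hit :: "(nat \<Rightarrow> 'a) set \<Rightarrow> 'a \<Rightarrow> real" where
  "hit E g = prob (hit_event E g)"

lemma hit_event_sets:
  assumes "E \<in> sets (trajectories G)" "g \<in> carrier G"
  shows "hit_event E g \<in> sets increments"
  using measurable_sets[OF measurable_compose[OF walk_measurable translate_measurable[OF assms(2)]] assms(1)]
  by (simp add: hit_event_def vimage_def Int_def conj_commute)

lemma hit_event_one: "hit_event E \<one> = {\<xi> \<in> space increments. walk \<xi> \<in> E}"
  unfolding hit_event_def by (intro Collect_cong conj_cong refl) (simp add: walk_closed)

text \<open>Invariance allows dropping the first \<open>n\<close> positions, and what remains is a
  walk started at the position reached at time \<open>n\<close>.\<close>

lemma hit_event_comb_seq:
  assumes E: "E \<in> invariant_sets G" and g: "g \<in> carrier G"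
    and \<xi>: "\<xi> \<in> space increments" and \<eta>: "\<eta> \<in> space increments"
  shows "comb_seq n \<xi> \<eta> \<in> hit_event E g \<longleftrightarrow> \<eta> \<in> hit_event E (g \<otimes> walk \<xi> n)"
proof -
  let ?\<zeta> = "comb_seq n \<xi> \<eta>"
  have \<zeta>: "?\<zeta> \<in> space increments" using \<xi> \<eta> by (rule comb_seq_space)
  have "walk ?\<zeta> n = walk \<xi> n"
    by (rule walk_position_cong) (simp add: comb_seq_def)
  then have *: "g \<otimes> walk ?\<zeta> (m + n) = (g \<otimes> walk \<xi> n) \<otimes> walk \<eta> m" for m
    using \<zeta> \<xi> \<eta> g walk_closed by (simp add: walk_add m_assoc)
  have "(\<lambda>m. g \<otimes> walk ?\<zeta> m) \<in> space (trajectories G)"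
    using \<zeta> g by (simp add: space_trajectories walk_closed)
  from invariant_sets_shift[OF E this, of n] show ?thesis
    using \<zeta> \<eta> by (simp add: hit_event_def *)
qed

text \<open>\<open>hit E (g \<otimes> walk \<xi> n)\<close> is the conditional probability of
  \<open>hit_event E g\<close> given the first \<open>n\<close> increments.\<close>

lemma hit_lower_bound:
  assumes E: "E \<in> invariant_sets G" and g: "g \<in> carrier G" and A: "determined n A" and "0 \<le> \<delta>"
    and le: "\<And>\<xi>. \<xi> \<in> A \<Longrightarrow> \<delta> \<le> hit E (g \<otimes> walk \<xi> n)"
  shows "\<delta> * prob A \<le> prob (A \<inter> hit_event E g)"
proof (rule prob_determined_Int_ge[OF A _ \<open>0 \<le> \<delta>\<close>])
  show "hit_event E g \<in> sets increments"
    using E g by (intro hit_event_sets) (auto simp: invariant_sets_def)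
  fix \<xi> assume "\<xi> \<in> A"
  then have \<xi>: "\<xi> \<in> space increments" using A by (auto simp: determined_def)
  have "{\<eta> \<in> space increments. comb_seq n \<xi> \<eta> \<in> hit_event E g} = hit_event E (g \<otimes> walk \<xi> n)"
    using hit_event_comb_seq[OF E g \<xi>] by (auto simp: hit_event_def)
  then show "\<delta> \<le> prob {\<eta> \<in> space increments. comb_seq n \<xi> \<eta> \<in> hit_event E g}"
    using le[OF \<open>\<xi> \<in> A\<close>] by (simp add: hit_def)
qed

lemma hit_event_compl:
  assumes "g \<in> carrier G"
  shows "hit_event (space (trajectories G) - E) g = space increments - hit_event E g"
  using assms walk_closed by (auto simp: hit_event_def space_trajectories)

lemma hit_compl:
  assumes "E \<in> invariant_sets G" "g \<in> carrier G"
  shows "hit (space (trajectories G) - E) g = 1 - hit E g"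
  using assms seq.P.prob_compl[OF hit_event_sets[of E g]]
  by (simp add: hit_def hit_event_compl invariant_sets_def)

text \<open>The Harnack inequality: only those continuations are counted whose first increment is
  \<open>s\<close>.\<close>

lemma hit_step:
  assumes E: "E \<in> invariant_sets G" and g: "g \<in> carrier G" and s: "s \<in> set_pmf \<mu>"
  shows "pmf \<mu> s * hit E (g \<otimes> s) \<le> hit E g"
proof -
  let ?A = "{\<xi> \<in> space increments. \<forall>i<1. \<xi> i = s}"
  have sG: "s \<in> carrier G" using s support by auto
  have "hit E (g \<otimes> s) * prob ?A \<le> prob (?A \<inter> hit_event E g)"
    by (rule hit_lower_bound[OF E g determined_word[of 1 "\<lambda>_. s"]]) (use sG in \<open>auto simp: hit_def\<close>)
  also have "prob (?A \<inter> hit_event E g) \<le> hit E g"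
    unfolding hit_def using E g
    by (intro seq.P.finite_measure_mono hit_event_sets) (auto simp: invariant_sets_def)
  finally show ?thesis
    using prob_word[of 1 "\<lambda>_. s"] sG by (simp add: mult.commute)
qed

text \<open>The distance of \<open>hit E\<close> from 0 is the hitting probability of
  \<open>E\<close>, that from 1 the hitting probability of the complement. So one inequality covers
  both events; \<open>b\<close> will be the value of an indicator.\<close>

lemma hit_step_dist:
  assumes E: "E \<in> invariant_sets G" and g: "g \<in> carrier G" and s: "s \<in> set_pmf \<mu>"
    and b: "b \<in> {0, 1}"
  shows "pmf \<mu> s * \<bar>hit E (g \<otimes> s) - b\<bar> \<le> \<bar>hit E g - b\<bar>"
proof -
  have "g \<otimes> s \<in> carrier G" using g s support by auto
  then have *: "pmf \<mu> s * hit E (g \<otimes> s) \<le> hit E g"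
    "pmf \<mu> s * (1 - hit E (g \<otimes> s)) \<le> 1 - hit E g"
    using hit_step[OF E g s] hit_step[OF invariant_sets_compl[OF E] g s] hit_compl[OF E] g by auto
  have bounds: "0 \<le> hit E x" "hit E x \<le> 1" for x
    by (simp_all add: hit_def)
  show ?thesis
  proof (cases "b = 0")
    case True
    then show ?thesis using *(1) bounds by simp
  next
    case False
    then have "\<bar>hit E x - b\<bar> = 1 - hit E x" for x using b bounds[of x] by simp
    then show ?thesis using *(2) by simp
  qed
qed

text \<open>
  The event \<open>T j\<close> that the distance first reaches \<open>\<delta>\<close> at time \<open>j\<close> depends on the first \<open>j\<close>
  increments, and given these the conditional probability of \<open>D\<close> is the distance, hence at least \<open>\<delta>\<close>.
\<close>

lemma hit_maximal:
  assumes E: "E \<in> invariant_sets G" and A: "determined N A" and "0 < \<delta>"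
  defines "D \<equiv> (hit_event E \<one> - A) \<union> (A - hit_event E \<one>)"
  shows "\<delta> * prob {\<xi> \<in> space increments. \<exists>n\<ge>N. \<delta> \<le> \<bar>hit E (walk \<xi> n) - indicator A \<xi>\<bar>} \<le> prob D"
proof -
  let ?H = "hit_event E \<one>"
  let ?far = "\<lambda>\<xi> n. \<delta> \<le> \<bar>hit E (walk \<xi> n) - indicator A \<xi>\<bar>"
  define T where "T j = {\<xi> \<in> space increments. N \<le> j \<and> ?far \<xi> j \<and> (\<forall>i<j. N \<le> i \<longrightarrow> \<not> ?far \<xi> i)}" for j
  have H: "?H \<in> sets increments"
    using E by (intro hit_event_sets) (auto simp: invariant_sets_def)
  have As: "A \<in> sets increments" using A by (rule determined_sets)
  have D: "D \<in> sets increments" using H As by (auto simp: D_def)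
  have T: "determined j (T j)" for j
  proof (cases "N \<le> j")
    case True
    show ?thesis
    proof (rule determinedI)
      fix \<xi> \<eta> assume \<xi>: "\<xi> \<in> T j" and \<eta>: "\<eta> \<in> space increments" and eq: "\<And>i. i < j \<Longrightarrow> \<xi> i = \<eta> i"
      have "walk \<xi> i = walk \<eta> i" if "i \<le> j" for i
        by (rule walk_position_cong) (use eq that in auto)
      moreover have "indicator A \<xi> = (indicator A \<eta> :: real)"
        using determinedD[OF determined_mono[OF A True], of \<xi> \<eta>] \<xi> \<eta> eq
        by (auto simp: T_def indicator_def)
      ultimately show "\<eta> \<in> T j"
        using \<xi> \<eta> by (simp add: T_def)
    qed (auto simp: T_def)
  qed (auto simp: T_def determined_def)
  have Ts: "T j \<in> sets increments" for j by (rule determined_sets[OF T])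
  have le: "\<delta> * prob (T j) \<le> prob (T j \<inter> D)" for j
  proof (cases "N \<le> j")
    case True
    note Aj = determined_mono[OF A True]
    have w: "walk \<xi> j \<in> carrier G" if "\<xi> \<in> T j" for \<xi>
      using that by (auto simp: T_def intro: walk_closed)
    \<comment> \<open>On \<open>A\<close> the distance is the hitting probability of the complement,
      and being in \<open>D\<close> means missing \<open>E\<close>. Off \<open>A\<close> the
      distance is \<open>hit E\<close>, and being in \<open>D\<close> means hitting
      \<open>E\<close>.\<close>
    have "\<delta> * prob (T j \<inter> A) \<le> prob (T j \<inter> A \<inter> hit_event (space (trajectories G) - E) \<one>)"
    proof (rule hit_lower_bound[OF invariant_sets_compl[OF E] one_closed determined_Int[OF T Aj]])
      fix \<xi> assume \<xi>: "\<xi> \<in> T j \<inter> A"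
      then have "\<delta> \<le> \<bar>hit E (walk \<xi> j) - 1\<bar>" by (auto simp: T_def)
      also have "\<dots> = 1 - hit E (walk \<xi> j)" by (simp add: hit_def)
      finally show "\<delta> \<le> hit (space (trajectories G) - E) (\<one> \<otimes> walk \<xi> j)"
        using \<xi> w by (simp add: hit_compl[OF E])
    qed (use \<open>0 < \<delta>\<close> in simp)
    moreover have "\<delta> * prob (T j \<inter> (space increments - A)) \<le> prob (T j \<inter> (space increments - A) \<inter> ?H)"
    proof (rule hit_lower_bound[OF E one_closed determined_Int[OF T determined_Compl[OF Aj]]])
      fix \<xi> assume \<xi>: "\<xi> \<in> T j \<inter> (space increments - A)"
      then have "\<delta> \<le> \<bar>hit E (walk \<xi> j)\<bar>" by (auto simp: T_def)
      then show "\<delta> \<le> hit E (\<one> \<otimes> walk \<xi> j)"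
        using \<xi> w by (simp add: hit_def)
    qed (use \<open>0 < \<delta>\<close> in simp)
    moreover have "prob (T j) = prob (T j \<inter> A) + prob (T j \<inter> (space increments - A))"
    proof -
      have "prob (T j) = prob ((T j \<inter> A) \<union> (T j \<inter> (space increments - A)))"
        by (intro arg_cong[where f=prob]) (auto simp: T_def)
      also have "\<dots> = prob (T j \<inter> A) + prob (T j \<inter> (space increments - A))"
        using Ts As by (intro seq.P.finite_measure_Union) auto
      finally show ?thesis .
    qed
    moreover have "prob (T j \<inter> D) =
        prob (T j \<inter> A \<inter> hit_event (space (trajectories G) - E) \<one>) + prob (T j \<inter> (space increments - A) \<inter> ?H)"
    proof -
      have "prob (T j \<inter> D) = prob
          ((T j \<inter> A \<inter> hit_event (space (trajectories G) - E) \<one>) \<union> (T j \<inter> (space increments - A) \<inter> ?H))"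
        by (intro arg_cong[where f=prob]) (auto simp: T_def D_def hit_event_compl)
      also have "\<dots> = prob (T j \<inter> A \<inter> hit_event (space (trajectories G) - E) \<one>) +
          prob (T j \<inter> (space increments - A) \<inter> ?H)"
        using Ts As H by (intro seq.P.finite_measure_Union) (auto simp: hit_event_compl)
      finally show ?thesis .
    qed
    ultimately show ?thesis
      by (simp add: distrib_left)
  qed (simp add: T_def)
  have disj: "disjoint_family T"
    unfolding disjoint_family_on_def T_def by (auto simp: neq_iff)
  have "(\<lambda>j. prob (T j)) sums prob (\<Union>j. T j)"
    using Ts disj by (intro seq.P.finite_measure_UNION) auto
  then have "(\<lambda>j. \<delta> * prob (T j)) sums (\<delta> * prob (\<Union>j. T j))"
    by (rule sums_mult)
  moreover have "(\<lambda>j. prob (T j \<inter> D)) sums prob (\<Union>j. T j \<inter> D)"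
    using Ts D disj by (intro seq.P.finite_measure_UNION) (auto simp: disjoint_family_on_def)
  ultimately have "\<delta> * prob (\<Union>j. T j) \<le> prob (\<Union>j. T j \<inter> D)"
    by (rule sums_le[OF le])
  moreover have "prob (\<Union>j. T j \<inter> D) \<le> prob D"
    by (rule seq.P.finite_measure_mono[OF _ D]) blast
  moreover have "(\<Union>j. T j) = {\<xi> \<in> space increments. \<exists>n\<ge>N. ?far \<xi> n}"
  proof (rule Set.set_eqI)
    fix \<xi>
    have "\<exists>j. \<xi> \<in> T j" if \<xi>: "\<xi> \<in> space increments" and ex: "\<exists>n. N \<le> n \<and> ?far \<xi> n"
    proof -
      define P where "P n \<longleftrightarrow> N \<le> n \<and> ?far \<xi> n" for n
      have "\<exists>n. P n" using ex by (simp add: P_def)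
      then have "P (LEAST n. P n)" "\<forall>i<LEAST n. P n. \<not> P i"
        by (auto intro: LeastI_ex dest: not_less_Least)
      then have "\<xi> \<in> T (LEAST n. P n)"
        using \<xi> by (auto simp: T_def P_def)
      then show ?thesis ..
    qed
    then show "\<xi> \<in> (\<Union>j. T j) \<longleftrightarrow> \<xi> \<in> {\<xi> \<in> space increments. \<exists>n\<ge>N. ?far \<xi> n}"
      unfolding T_def by blast
  qed
  ultimately show ?thesis by simp
qed

text \<open>The sets that can be approximated in measure by events of finitely many increments form
  a \<sigma>-field containing all coordinate events.\<close>

lemma approx_determined:
  assumes "X \<in> sets increments" "0 < \<epsilon>"
  shows "\<exists>n A. determined n A \<and> prob ((X - A) \<union> (A - X)) < \<epsilon>"
proof -
  let ?M = "restrict_space (measure_pmf \<mu>) (carrier G)"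
  let ?S = "\<Pi>\<^sub>E i\<in>(UNIV::nat set). space ?M"
  let ?C = "{{f \<in> ?S. f i \<in> Y} | i Y. i \<in> (UNIV::nat set) \<and> Y \<in> sets ?M}"
  have sets: "sets increments = sigma_sets ?S ?C"
    by (rule sets_PiM_single)
  have S: "?S = space increments" by (simp add: space_PiM)
  have "X \<in> sigma_sets ?S ?C" using assms(1) by (simp add: sets)
  then have "\<forall>\<epsilon>>0. \<exists>n A. determined n A \<and> prob ((X - A) \<union> (A - X)) < \<epsilon>"
  proof induction
    case (Basic X)
    then obtain i Y where "X = {f \<in> ?S. f i \<in> Y}" by blast
    then have "X = {\<xi> \<in> space increments. \<xi> i \<in> Y}" by (simp only: S)
    then have "determined (Suc i) X" by (auto simp: determined_def)
    then show ?case by (intro allI impI exI[of _ "Suc i"] exI[of _ X]) auto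
  next
    case Empty
    show ?case by (intro allI impI exI[of _ 0] exI[of _ "{}"]) (auto simp: determined_def)
  next
    case (Compl X)
    show ?case
    proof (intro allI impI)
      fix \<epsilon> :: real assume "\<epsilon> > 0"
      with Compl obtain n A where A: "determined n A" "prob ((X - A) \<union> (A - X)) < \<epsilon>" by blast
      have "X \<in> sets increments" using Compl by (simp add: sets)
      then have "X \<subseteq> space increments" by (rule sets.sets_into_space)
      then have "((?S - X) - (space increments - A)) \<union> ((space increments - A) - (?S - X)) = (X - A) \<union> (A - X)"
        using A(1) unfolding S by (auto simp: determined_def)
      then show "\<exists>n A. determined n A \<and> prob (((?S - X) - A) \<union> (A - (?S - X))) < \<epsilon>"
        using A determined_Compl by metis
    qed
  next
    case (Union X)
    have X: "X i \<in> sets increments" for i using Union by (simp add: sets)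
    show ?case
    proof (intro allI impI)
      fix \<epsilon> :: real assume \<epsilon>: "\<epsilon> > 0"
      let ?Y = "\<lambda>m. \<Union>i<m. X i"
      have "(\<lambda>m. prob (?Y m)) \<longlonglongrightarrow> prob (\<Union>m. ?Y m)"
        using X by (intro seq.P.finite_Lim_measure_incseq) (auto simp: incseq_def intro: less_le_trans)
      moreover have "(\<Union>m. ?Y m) = (\<Union>i. X i)" by auto
      ultimately have "eventually (\<lambda>m. dist (prob (?Y m)) (prob (\<Union>i. X i)) < \<epsilon> / 2) sequentially"
        using \<epsilon> by (intro tendstoD) auto
      then obtain m where m: "dist (prob (?Y m)) (prob (\<Union>i. X i)) < \<epsilon> / 2"
        by (auto simp: eventually_sequentially)
      have Ym: "prob ((\<Union>i. X i) - ?Y m) < \<epsilon> / 2"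
      proof -
        have "prob ((\<Union>i. X i) - ?Y m) = prob (\<Union>i. X i) - prob (?Y m)"
          using X by (intro seq.P.finite_measure_Diff) auto
        then show ?thesis using m unfolding dist_real_def by linarith
      qed
      \<comment> \<open>Half of the error is spent on truncating the union, the other half is shared
        by the \<open>m\<close> sets kept; \<open>m + 1\<close> avoids a division by 0.\<close>
      define \<epsilon>' where "\<epsilon>' = \<epsilon> / (2 * (m + 1))"
      have "\<epsilon>' > 0" using \<epsilon> by (simp add: \<epsilon>'_def)
      with Union have "\<forall>i. \<exists>n A. determined n A \<and> prob ((X i - A) \<union> (A - X i)) < \<epsilon>'" by blast
      then obtain n A where A: "\<And>i. determined (n i) (A i)"
        and d: "\<And>i. prob ((X i - A i) \<union> (A i - X i)) < \<epsilon>'"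
        by metis
      let ?n = "\<Sum>i<m. n i" and ?A = "\<Union>i<m. A i"
      have "determined ?n ?A"
        by (intro determined_UN determined_mono[OF A]) (auto intro: member_le_sum)
      moreover have "prob (((\<Union>i. X i) - ?A) \<union> (?A - (\<Union>i. X i))) < \<epsilon>"
      proof -
        let ?d = "\<lambda>i. (X i - A i) \<union> (A i - X i)"
        note As = determined_sets[OF A]
        have "prob (((\<Union>i. X i) - ?A) \<union> (?A - (\<Union>i. X i))) \<le> prob (((\<Union>i. X i) - ?Y m) \<union> (\<Union>i<m. ?d i))"
          using X As by (intro seq.P.finite_measure_mono) auto
        also have "\<dots> \<le> prob ((\<Union>i. X i) - ?Y m) + prob (\<Union>i<m. ?d i)"
          using X As by (intro measure_Un_le) auto
        also have "prob (\<Union>i<m. ?d i) \<le> (\<Sum>i<m. prob (?d i))"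
          using X As by (intro seq.P.finite_measure_subadditive_finite) auto
        also have "\<dots> \<le> (\<Sum>i<m. \<epsilon>')"
          using d by (intro sum_mono) (simp add: less_imp_le)
        also have "\<dots> \<le> \<epsilon> / 2"
          using \<epsilon> by (simp add: \<epsilon>'_def field_simps)
        finally show ?thesis using Ym by simp
      qed
      ultimately show "\<exists>n A. determined n A \<and> prob (((\<Union>i. X i) - A) \<union> (A - (\<Union>i. X i))) < \<epsilon>"
        by blast
    qed
  qed
  then show ?thesis using assms(2) by blast
qed

end

section \<open>Wreath products and limit configurations\<close>

lemma the_eventually_const:
  assumes "\<forall>\<^sub>F n in sequentially. f n = l"
  shows "(THE l. \<forall>\<^sub>F n in sequentially. f n = l) = l"
proof (rule the_equality[of "\<lambda>l. \<forall>\<^sub>F n in sequentially. f n = l", OF assms])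
  fix k assume "\<forall>\<^sub>F n in sequentially. f n = k"
  with assms have "\<forall>\<^sub>F n in sequentially. k = l" by eventually_elim simp
  then show "k = l" by simp
qed

lemma limit_config_eqI:
  assumes "lamps_stabilize \<Lambda> \<omega>" "z \<in> carrier \<Lambda>" "\<forall>\<^sub>F n in sequentially. fst (\<omega> n) z = l"
  shows "limit_config L \<Lambda> \<omega> z = l"
  using assms by (simp add: limit_config_def the_eventually_const)

lemma eventually_limit_config:
  assumes "lamps_stabilize \<Lambda> \<omega>" "z \<in> carrier \<Lambda>"
  shows "\<forall>\<^sub>F n in sequentially. fst (\<omega> n) z = limit_config L \<Lambda> \<omega> z"
proof -
  obtain l where "\<forall>\<^sub>F n in sequentially. fst (\<omega> n) z = l"
    using assms by (auto simp: lamps_stabilize_def)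
  moreover from this have "limit_config L \<Lambda> \<omega> z = l" by (rule limit_config_eqI[OF assms])
  ultimately show ?thesis by simp
qed

lemma lamps_stabilize_Suc: "lamps_stabilize \<Lambda> (\<lambda>n. \<omega> (Suc n)) \<longleftrightarrow> lamps_stabilize \<Lambda> \<omega>"
  by (simp only: lamps_stabilize_def eventually_sequentially_Suc[of "\<lambda>n. fst (\<omega> n) z = l" for z l])

lemma limit_config_Suc: "limit_config L \<Lambda> (\<lambda>n. \<omega> (Suc n)) = limit_config L \<Lambda> \<omega>"
  by (simp only: limit_config_def lamps_stabilize_Suc
    eventually_sequentially_Suc[of "\<lambda>n. fst (\<omega> n) z = l" for z l])

locale wreath_groups = L: group L + \<Lambda>: group \<Lambda>
  for L :: "('a, 'c) monoid_scheme" and \<Lambda> :: "('b, 'd) monoid_scheme" +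
  assumes countable_L: "countable (carrier L)" and countable_\<Lambda>: "countable (carrier \<Lambda>)"
begin

abbreviation G :: "(('b \<Rightarrow> 'a) \<times> 'b) monoid" where "G \<equiv> wreath L \<Lambda>"

definition supp :: "('b \<Rightarrow> 'a) \<Rightarrow> 'b set" where
  "supp \<Phi> = {z \<in> carrier \<Lambda>. \<Phi> z \<noteq> \<one>\<^bsub>L\<^esub>}"

lemma carrier_G: "carrier G = {(\<Phi>, x). \<Phi> \<in> configs L \<Lambda> \<and> finite (supp \<Phi>) \<and> x \<in> carrier \<Lambda>}"
  by (auto simp: wreath_def supp_def)

lemma snd_carrier: "g \<in> carrier G \<Longrightarrow> snd g \<in> carrier \<Lambda>"
  and fst_configs: "g \<in> carrier G \<Longrightarrow> fst g \<in> configs L \<Lambda>"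
  and finite_supp: "g \<in> carrier G \<Longrightarrow> finite (supp (fst g))"
  by (auto simp: carrier_G)

lemma configs_apply: "\<Phi> \<in> configs L \<Lambda> \<Longrightarrow> z \<in> carrier \<Lambda> \<Longrightarrow> \<Phi> z \<in> carrier L"
  by (auto simp: configs_def)

lemma configs_eqI:
  "\<Phi> \<in> configs L \<Lambda> \<Longrightarrow> \<Psi> \<in> configs L \<Lambda> \<Longrightarrow> (\<And>z. z \<in> carrier \<Lambda> \<Longrightarrow> \<Phi> z = \<Psi> z) \<Longrightarrow> \<Phi> = \<Psi>"
  unfolding configs_def by (rule PiE_ext)

lemma fst_mult: "z \<in> carrier \<Lambda> \<Longrightarrow>
    fst (g \<otimes>\<^bsub>G\<^esub> h) z = fst g z \<otimes>\<^bsub>L\<^esub> fst h (inv\<^bsub>\<Lambda>\<^esub> snd g \<otimes>\<^bsub>\<Lambda>\<^esub> z)"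
  by (auto simp: wreath_def config_mult_def config_translate_def split: prod.split)

lemma snd_mult: "snd (g \<otimes>\<^bsub>G\<^esub> h) = snd g \<otimes>\<^bsub>\<Lambda>\<^esub> snd h"
  by (auto simp: wreath_def split: prod.split)

lemma one_G: "\<one>\<^bsub>G\<^esub> = (config_one L \<Lambda>, \<one>\<^bsub>\<Lambda>\<^esub>)"
  by (simp add: wreath_def)

text \<open>This is \<open>config_action\<close> without the restriction to
  \<open>configs L \<Lambda>\<close>. The lamp part of a product is this action on the lamp part of
  the right factor, so associativity of the group follows from the law of the action.\<close>

definition act :: "('b \<Rightarrow> 'a) \<times> 'b \<Rightarrow> ('b \<Rightarrow> 'a) \<Rightarrow> 'b \<Rightarrow> 'a" where
  "act g \<phi> = config_mult L \<Lambda> (fst g) (config_translate \<Lambda> (snd g) \<phi>)"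

lemma act_apply: "z \<in> carrier \<Lambda> \<Longrightarrow> act g \<phi> z = fst g z \<otimes>\<^bsub>L\<^esub> \<phi> (inv\<^bsub>\<Lambda>\<^esub> snd g \<otimes>\<^bsub>\<Lambda>\<^esub> z)"
  by (auto simp: act_def config_mult_def config_translate_def)

lemma mult_eq_act: "g \<otimes>\<^bsub>G\<^esub> h = (act g (fst h), snd g \<otimes>\<^bsub>\<Lambda>\<^esub> snd h)"
  by (auto simp: wreath_def act_def split: prod.split)

lemma act_configs:
  "fst g \<in> configs L \<Lambda> \<Longrightarrow> snd g \<in> carrier \<Lambda> \<Longrightarrow> \<phi> \<in> configs L \<Lambda> \<Longrightarrow> act g \<phi> \<in> configs L \<Lambda>"
  using configs_apply[of "fst g"] configs_apply[of \<phi>]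
  by (auto simp: act_def config_mult_def config_translate_def configs_def[where L=L] intro!: L.m_closed)

lemma act_mult:
  assumes "g \<in> carrier G" "h \<in> carrier G" "\<phi> \<in> configs L \<Lambda>"
  shows "act (g \<otimes>\<^bsub>G\<^esub> h) \<phi> = act g (act h \<phi>)"
proof (rule configs_eqI)
  note [simp] = snd_carrier[OF assms(1)] snd_carrier[OF assms(2)]
    fst_configs[OF assms(1)] fst_configs[OF assms(2)]
  show "act g (act h \<phi>) \<in> configs L \<Lambda>"
    using assms by (intro act_configs) auto
  show "act (g \<otimes>\<^bsub>G\<^esub> h) \<phi> \<in> configs L \<Lambda>"
    using assms by (intro act_configs) (auto simp: mult_eq_act intro: act_configs)
  fix z assume "z \<in> carrier \<Lambda>"
  then show "act (g \<otimes>\<^bsub>G\<^esub> h) \<phi> z = act g (act h \<phi>) z"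
    using assms
    by (simp add: act_apply fst_mult snd_mult configs_apply L.m_assoc \<Lambda>.inv_mult_group \<Lambda>.m_assoc)
qed

lemma act_one:
  assumes "\<phi> \<in> configs L \<Lambda>"
  shows "act \<one>\<^bsub>G\<^esub> \<phi> = \<phi>"
proof (rule configs_eqI)
  show "act \<one>\<^bsub>G\<^esub> \<phi> \<in> configs L \<Lambda>"
    using assms by (intro act_configs) (auto simp: one_G config_one_def configs_def)
  fix z assume "z \<in> carrier \<Lambda>"
  then show "act \<one>\<^bsub>G\<^esub> \<phi> z = \<phi> z"
    using assms by (simp add: act_apply one_G config_one_def configs_apply)
qed (use assms in simp)

lemma group_G: "group G"
proof (rule groupI)
  fix g h assume g: "g \<in> carrier G" and h: "h \<in> carrier G"
  note c = snd_carrier[OF g] snd_carrier[OF h] fst_configs[OF g] fst_configs[OF h]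
  have "supp (act g (fst h)) \<subseteq> supp (fst g) \<union> (\<lambda>z. snd g \<otimes>\<^bsub>\<Lambda>\<^esub> z) ` supp (fst h)"
  proof
    fix z assume z: "z \<in> supp (act g (fst h))"
    then have "z = snd g \<otimes>\<^bsub>\<Lambda>\<^esub> (inv\<^bsub>\<Lambda>\<^esub> snd g \<otimes>\<^bsub>\<Lambda>\<^esub> z)"
      using c by (simp add: supp_def flip: \<Lambda>.m_assoc)
    moreover have "z \<in> supp (fst g) \<or> inv\<^bsub>\<Lambda>\<^esub> snd g \<otimes>\<^bsub>\<Lambda>\<^esub> z \<in> supp (fst h)"
      using z c by (auto simp: supp_def act_apply)
    ultimately show "z \<in> supp (fst g) \<union> (\<lambda>z. snd g \<otimes>\<^bsub>\<Lambda>\<^esub> z) ` supp (fst h)"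
      by blast
  qed
  then have "finite (supp (act g (fst h)))"
    by (rule finite_subset) (use finite_supp[OF g] finite_supp[OF h] in simp)
  then show "g \<otimes>\<^bsub>G\<^esub> h \<in> carrier G"
    using c act_configs by (simp add: mult_eq_act carrier_G)
  show "\<one>\<^bsub>G\<^esub> \<otimes>\<^bsub>G\<^esub> g = g"
    using c act_one by (simp add: mult_eq_act) (simp add: one_G)
  fix k assume k: "k \<in> carrier G"
  show "g \<otimes>\<^bsub>G\<^esub> h \<otimes>\<^bsub>G\<^esub> k = g \<otimes>\<^bsub>G\<^esub> (h \<otimes>\<^bsub>G\<^esub> k)"
    using act_mult[OF g h fst_configs[OF k]] c snd_carrier[OF k]
    by (simp add: mult_eq_act[of _ k] mult_eq_act[of g "(_, _)"] snd_mult \<Lambda>.m_assoc)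
next
  show "\<one>\<^bsub>G\<^esub> \<in> carrier G"
    by (auto simp: one_G carrier_G config_one_def configs_def supp_def)
next
  fix g assume g: "g \<in> carrier G"
  note c = snd_carrier[OF g] fst_configs[OF g]
  \<comment> \<open>The inverse of a pair consists of the pointwise inverse configuration translated
    by the inverse of the position, hence read at \<open>snd g\<close> times \<open>z\<close>, and
    of the inverse position.\<close>
  define h where "h = ((\<lambda>z\<in>carrier \<Lambda>. inv\<^bsub>L\<^esub> fst g (snd g \<otimes>\<^bsub>\<Lambda>\<^esub> z)), inv\<^bsub>\<Lambda>\<^esub> snd g)"
  have "supp (fst h) \<subseteq> (\<lambda>z. inv\<^bsub>\<Lambda>\<^esub> snd g \<otimes>\<^bsub>\<Lambda>\<^esub> z) ` supp (fst g)"
  proof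
    fix z assume z: "z \<in> supp (fst h)"
    then have "z = inv\<^bsub>\<Lambda>\<^esub> snd g \<otimes>\<^bsub>\<Lambda>\<^esub> (snd g \<otimes>\<^bsub>\<Lambda>\<^esub> z)"
      using c by (simp add: supp_def flip: \<Lambda>.m_assoc)
    moreover have "snd g \<otimes>\<^bsub>\<Lambda>\<^esub> z \<in> supp (fst g)"
      using z c by (auto simp: supp_def h_def configs_apply)
    ultimately show "z \<in> (\<lambda>z. inv\<^bsub>\<Lambda>\<^esub> snd g \<otimes>\<^bsub>\<Lambda>\<^esub> z) ` supp (fst g)" by blast
  qed
  then have "finite (supp (fst h))"
    by (rule finite_subset) (use finite_supp[OF g] in simp)
  moreover have h: "fst h \<in> configs L \<Lambda>" "snd h = inv\<^bsub>\<Lambda>\<^esub> snd g"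
    using c by (auto simp: h_def configs_def)
  ultimately have "h \<in> carrier G"
    using c by (cases h) (simp add: carrier_G)
  moreover have "act h (fst g) = config_one L \<Lambda>"
  proof (rule configs_eqI)
    show "act h (fst g) \<in> configs L \<Lambda>" using c h by (intro act_configs) auto
    fix z assume "z \<in> carrier \<Lambda>"
    then show "act h (fst g) z = config_one L \<Lambda> z"
      using c by (simp add: act_apply h_def config_one_def configs_apply)
  qed (auto simp: config_one_def configs_def)
  then have "h \<otimes>\<^bsub>G\<^esub> g = \<one>\<^bsub>G\<^esub>"
    using c h by (simp add: mult_eq_act one_G)
  ultimately show "\<exists>h\<in>carrier G. h \<otimes>\<^bsub>G\<^esub> g = \<one>\<^bsub>G\<^esub>" by blast
qed

sublocale G: group G by (rule group_G)

text \<open>A finitely supported configuration is encoded by its graph over the support, a finite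
  subset of a countable set.\<close>

lemma countable_G: "countable (carrier G)"
proof -
  let ?F = "{A. finite A \<and> A \<subseteq> carrier \<Lambda> \<times> carrier L}"
  let ?f = "\<lambda>(\<Phi>, x). ((\<lambda>z. (z, \<Phi> z)) ` supp \<Phi>, x)"
  have "?f ` carrier G \<subseteq> ?F \<times> carrier \<Lambda>"
    by (auto simp: carrier_G supp_def configs_apply)
  moreover have "countable (?F \<times> carrier \<Lambda>)"
    using countable_L countable_\<Lambda> by (intro countable_SIGMA countable_Collect_finite_subset) auto
  ultimately have "countable (?f ` carrier G)"
    by (rule countable_subset)
  moreover have "inj_on ?f (carrier G)"
  proof (rule inj_onI)
    fix g h assume g: "g \<in> carrier G" and h: "h \<in> carrier G" and eq: "?f g = ?f h"
    obtain \<Phi> x \<Psi> y where gh: "g = (\<Phi>, x)" "h = (\<Psi>, y)" by (metis surj_pair)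
    have "\<Phi> = \<Psi>"
    proof (rule configs_eqI)
      show "\<Phi> \<in> configs L \<Lambda>" "\<Psi> \<in> configs L \<Lambda>" using g h gh by (auto simp: carrier_G)
      fix z assume z: "z \<in> carrier \<Lambda>"
      have "(z, l) \<in> (\<lambda>z. (z, \<Phi> z)) ` supp \<Phi> \<longleftrightarrow> (z, l) \<in> (\<lambda>z. (z, \<Psi> z)) ` supp \<Psi>" for l
        using eq gh by simp
      then have "(\<Phi> z \<noteq> \<one>\<^bsub>L\<^esub> \<and> l = \<Phi> z) \<longleftrightarrow> (\<Psi> z \<noteq> \<one>\<^bsub>L\<^esub> \<and> l = \<Psi> z)" for l
        using z by (auto simp: supp_def)
      then show "\<Phi> z = \<Psi> z" by metis
    qed
    then show "g = h" using eq gh by simp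
  qed
  ultimately show ?thesis by (rule countable_image_inj_on)
qed

section \<open>The action on configurations and the product \<sigma>-field\<close>

lemma config_action_eq: "config_action L \<Lambda> g = (\<lambda>\<phi>\<in>configs L \<Lambda>. act g \<phi>)"
  by (auto simp: config_action_def act_def split: prod.split)

lemma group_action_configs: "group_action G (configs L \<Lambda>) (config_action L \<Lambda>)"
proof -
  have act: "act g \<phi> \<in> configs L \<Lambda>" if "g \<in> carrier G" "\<phi> \<in> configs L \<Lambda>" for g \<phi>
    using that by (intro act_configs snd_carrier fst_configs)
  have inv: "act (inv\<^bsub>G\<^esub> g) (act g \<phi>) = \<phi>" "act g (act (inv\<^bsub>G\<^esub> g) \<phi>) = \<phi>"
    if "g \<in> carrier G" "\<phi> \<in> configs L \<Lambda>" for g \<phi>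
    using that by (simp_all add: act_one flip: act_mult)
  have Bij: "config_action L \<Lambda> g \<in> Bij (configs L \<Lambda>)" if g: "g \<in> carrier G" for g
  proof -
    have "bij_betw (act g) (configs L \<Lambda>) (configs L \<Lambda>)"
      using act[OF g] act[OF G.inv_closed[OF g]] inv[OF g]
      by (intro bij_betw_byWitness[where f'="act (inv\<^bsub>G\<^esub> g)"]) blast+
    then show ?thesis by (auto simp: Bij_def config_action_eq cong: bij_betw_cong)
  qed
  have "config_action L \<Lambda> (g \<otimes>\<^bsub>G\<^esub> h) = compose (configs L \<Lambda>) (config_action L \<Lambda> g) (config_action L \<Lambda> h)"
    if "g \<in> carrier G" "h \<in> carrier G" for g h
    using that act[OF that(2)] by (auto simp: compose_def config_action_eq act_mult intro!: restrict_ext)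
  then have "config_action L \<Lambda> \<in> hom G (BijGroup (configs L \<Lambda>))"
    using Bij by (auto simp: hom_def BijGroup_def)
  then show ?thesis
    by (intro group_action.intro group_hom.intro group_hom_axioms.intro group_G group_BijGroup)
qed

lemma space_config_algebra: "space (config_algebra L \<Lambda>) = configs L \<Lambda>"
  by (simp add: config_algebra_def configs_def space_PiM)

lemma config_coordinate_sets:
  assumes "z \<in> carrier \<Lambda>"
  shows "{\<phi> \<in> configs L \<Lambda>. \<phi> z \<in> Y} \<in> sets (config_algebra L \<Lambda>)"
proof -
  have "(\<lambda>\<phi>. \<phi> z) -` (Y \<inter> carrier L) \<inter> space (config_algebra L \<Lambda>) \<in> sets (config_algebra L \<Lambda>)"
    unfolding config_algebra_def
    by (rule measurable_sets[OF measurable_component_singleton[OF assms]]) auto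
  also have "(\<lambda>\<phi>. \<phi> z) -` (Y \<inter> carrier L) \<inter> space (config_algebra L \<Lambda>) = {\<phi> \<in> configs L \<Lambda>. \<phi> z \<in> Y}"
    using assms by (auto simp: space_config_algebra configs_apply)
  finally show ?thesis .
qed

lemma countably_generated_config_algebra: "countably_generated (config_algebra L \<Lambda>)"
proof -
  let ?\<Omega> = "configs L \<Lambda>"
  let ?A = "{{f \<in> ?\<Omega>. f i \<in> Y} | i Y. i \<in> carrier \<Lambda> \<and> Y \<in> sets (count_space (carrier L))}"
  let ?C = "(\<lambda>(i, l). {f \<in> ?\<Omega>. f i = l}) ` (carrier \<Lambda> \<times> carrier L)"
  have "sigma_sets ?\<Omega> ?A = sigma_sets ?\<Omega> ?C"
  proof (rule sigma_sets_eqI)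
    fix X assume "X \<in> ?A"
    then obtain i Y where i: "i \<in> carrier \<Lambda>" "Y \<subseteq> carrier L" "X = {f \<in> ?\<Omega>. f i \<in> Y}" by auto
    have "(\<Union>l\<in>Y. {f \<in> ?\<Omega>. f i = l}) \<in> sigma_sets ?\<Omega> ?C"
      using i countable_subset[OF i(2) countable_L]
      by (intro sigma_sets_UNION) (auto intro!: sigma_sets.Basic)
    also have "(\<Union>l\<in>Y. {f \<in> ?\<Omega>. f i = l}) = X" using i by auto
    finally show "X \<in> sigma_sets ?\<Omega> ?C" .
  next
    fix X assume "X \<in> ?C"
    then obtain i l where i: "i \<in> carrier \<Lambda>" "l \<in> carrier L" "X = {f \<in> ?\<Omega>. f i = l}" by auto
    then have "X \<in> ?A"
      by (intro CollectI exI[of _ i] exI[of _ "{l}"]) simp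
    then show "X \<in> sigma_sets ?\<Omega> ?A" by (rule sigma_sets.Basic)
  qed
  moreover have "sets (config_algebra L \<Lambda>) = sigma_sets ?\<Omega> ?A"
    using sets_PiM_single[of "carrier \<Lambda>" "\<lambda>_. count_space (carrier L)"]
    by (simp add: config_algebra_def configs_def)
  moreover have "countable ?C"
    using countable_L countable_\<Lambda> by auto
  ultimately show ?thesis
    unfolding countably_generated_def space_config_algebra
    by (intro exI[of _ ?C]) auto
qed

lemma separates_points_config_algebra: "separates_points (config_algebra L \<Lambda>)"
  unfolding separates_points_def space_config_algebra
proof (intro ballI impI)
  fix \<phi> \<psi> assume \<phi>: "\<phi> \<in> configs L \<Lambda>" and \<psi>: "\<psi> \<in> configs L \<Lambda>" and "\<phi> \<noteq> \<psi>"
  then obtain z where z: "z \<in> carrier \<Lambda>" "\<phi> z \<noteq> \<psi> z" using configs_eqI by blast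
  show "\<exists>A\<in>sets (config_algebra L \<Lambda>). \<phi> \<in> A \<and> \<psi> \<notin> A"
    by (rule bexI[OF _ config_coordinate_sets[OF z(1), of "{\<phi> z}"]]) (use \<phi> z in auto)
qed

lemma config_action_measurable:
  assumes g: "g \<in> carrier G"
  shows "config_action L \<Lambda> g \<in> measurable (config_algebra L \<Lambda>) (config_algebra L \<Lambda>)"
proof -
  note c = snd_carrier[OF g] fst_configs[OF g]
  have "(\<lambda>\<phi>. \<lambda>z\<in>carrier \<Lambda>. fst g z \<otimes>\<^bsub>L\<^esub> \<phi> (inv\<^bsub>\<Lambda>\<^esub> snd g \<otimes>\<^bsub>\<Lambda>\<^esub> z)) \<in>
      measurable (config_algebra L \<Lambda>) (config_algebra L \<Lambda>)"
    unfolding config_algebra_def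
  proof (rule measurable_restrict)
    fix z assume z: "z \<in> carrier \<Lambda>"
    let ?y = "inv\<^bsub>\<Lambda>\<^esub> snd g \<otimes>\<^bsub>\<Lambda>\<^esub> z"
    have "(\<lambda>\<phi>. \<phi> ?y) \<in> measurable (PiM (carrier \<Lambda>) (\<lambda>_. count_space (carrier L))) (count_space (carrier L))"
      using c z by (intro measurable_component_singleton) auto
    then show "(\<lambda>\<phi>. fst g z \<otimes>\<^bsub>L\<^esub> \<phi> ?y) \<in>
        measurable (PiM (carrier \<Lambda>) (\<lambda>_. count_space (carrier L))) (count_space (carrier L))"
      by (rule measurable_compose) (use c z configs_apply in auto)
  qed
  then show ?thesis
    by (rule measurable_cong[THEN iffD1, rotated])
       (auto simp: space_config_algebra config_action_eq act_def config_mult_def config_translate_def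
         intro!: restrict_ext)
qed

section \<open>The limit configuration as a measurable, invariant and equivariant map\<close>

lemma trajectory_coordinate_sets:
  "{\<omega> \<in> space (trajectories G). Q (\<omega> n)} \<in> sets (trajectories G)"
proof -
  have "(\<lambda>\<omega>. \<omega> n) -` {g \<in> carrier G. Q g} \<inter> space (trajectories G) \<in> sets (trajectories G)"
    unfolding trajectories_def by (rule measurable_sets[OF measurable_component_singleton]) auto
  also have "(\<lambda>\<omega>. \<omega> n) -` {g \<in> carrier G. Q g} \<inter> space (trajectories G) =
      {\<omega> \<in> space (trajectories G). Q (\<omega> n)}"
    by (auto simp: space_trajectories)
  finally show ?thesis .
qed

lemma eventually_lamp_sets:
  "{\<omega> \<in> space (trajectories G). \<forall>\<^sub>F n in sequentially. fst (\<omega> n) z = l} \<in> sets (trajectories G)"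
  unfolding eventually_sequentially
  by (intro sets.sets_Collect_countable_Ex sets.sets_Collect_countable_All sets.sets_Collect_imp
    sets.sets_Collect_const trajectory_coordinate_sets)

text \<open>\<open>lamps_stabilize\<close> quantifies over the whole type of lamp states. Knowing
  that the limit lies in the countable carrier turns this into a countable union.\<close>

lemma eventually_lamp_carrier:
  assumes "\<omega> \<in> space (trajectories G)" "z \<in> carrier \<Lambda>" "\<forall>\<^sub>F n in sequentially. fst (\<omega> n) z = l"
  shows "l \<in> carrier L"
proof -
  have "\<forall>\<^sub>F n in sequentially. l \<in> carrier L"
    using assms(3)
  proof eventually_elim
    case (elim n)
    have "\<omega> n \<in> carrier G" using assms(1) by (auto simp: space_trajectories)
    then show ?case using elim assms(2) by (auto dest!: fst_configs simp: configs_apply)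
  qed
  then show ?thesis by simp
qed

lemma lamps_stabilize_sets:
  "{\<omega> \<in> space (trajectories G). lamps_stabilize \<Lambda> \<omega>} \<in> sets (trajectories G)"
proof -
  have "{\<omega> \<in> space (trajectories G). lamps_stabilize \<Lambda> \<omega>} = {\<omega> \<in> space (trajectories G).
      \<forall>z\<in>carrier \<Lambda>. \<exists>l\<in>carrier L. \<forall>\<^sub>F n in sequentially. fst (\<omega> n) z = l}"
    using eventually_lamp_carrier unfolding lamps_stabilize_def by blast
  also have "\<dots> \<in> sets (trajectories G)"
    by (intro sets.sets_Collect_countable_All' sets.sets_Collect_countable_Ex' eventually_lamp_sets
      countable_L countable_\<Lambda>)
  finally show ?thesis .
qed

lemma limit_config_configs:
  assumes "\<omega> \<in> space (trajectories G)"
  shows "limit_config L \<Lambda> \<omega> \<in> configs L \<Lambda>"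
proof (cases "lamps_stabilize \<Lambda> \<omega>")
  case True
  have "limit_config L \<Lambda> \<omega> z \<in> carrier L" if "z \<in> carrier \<Lambda>" for z
    using eventually_limit_config[OF True that] by (rule eventually_lamp_carrier[OF assms that])
  moreover have "limit_config L \<Lambda> \<omega> \<in> extensional (carrier \<Lambda>)"
    using True by (simp add: limit_config_def)
  ultimately show ?thesis by (auto simp: configs_def PiE_def)
qed (auto simp: limit_config_def config_one_def configs_def)

lemma limit_config_measurable:
  "limit_config L \<Lambda> \<in> measurable (trajectories G) (config_algebra L \<Lambda>)"
proof -
  have "(\<lambda>\<omega>. limit_config L \<Lambda> \<omega> z) \<in> measurable (trajectories G) (count_space (carrier L))"
    if z: "z \<in> carrier \<Lambda>" for z
    unfolding measurable_count_space_eq_countable[OF countable_L]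
  proof (intro conjI ballI)
    show "(\<lambda>\<omega>. limit_config L \<Lambda> \<omega> z) \<in> space (trajectories G) \<rightarrow> carrier L"
      using limit_config_configs z by (auto simp: configs_apply)
    fix l assume "l \<in> carrier L"
    let ?S = "{\<omega> \<in> space (trajectories G). lamps_stabilize \<Lambda> \<omega>}"
    let ?T = "{\<omega> \<in> space (trajectories G). \<forall>\<^sub>F n in sequentially. fst (\<omega> n) z = l}"
    \<comment> \<open>Trajectories that do not stabilize get the default
      \<open>config_one L \<Lambda>\<close>, which adds a second piece to the level set of the
      identity.\<close>
    have *: "limit_config L \<Lambda> \<omega> z = l \<longleftrightarrow>
        (if lamps_stabilize \<Lambda> \<omega> then \<forall>\<^sub>F n in sequentially. fst (\<omega> n) z = l else l = \<one>\<^bsub>L\<^esub>)" for \<omega>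
    proof (cases "lamps_stabilize \<Lambda> \<omega>")
      case True
      then show ?thesis
        using eventually_limit_config[OF True z, of L] limit_config_eqI[OF True z, of l L] by metis
    qed (use z in \<open>auto simp: limit_config_def config_one_def\<close>)
    have "(\<lambda>\<omega>. limit_config L \<Lambda> \<omega> z) -` {l} \<inter> space (trajectories G) =
        (?S \<inter> ?T) \<union> (if l = \<one>\<^bsub>L\<^esub> then space (trajectories G) - ?S else {})"
      unfolding vimage_def Int_def using * by (simp split: if_splits) blast
    then show "(\<lambda>\<omega>. limit_config L \<Lambda> \<omega> z) -` {l} \<inter> space (trajectories G) \<in> sets (trajectories G)"
      using lamps_stabilize_sets eventually_lamp_sets by auto
  qed
  then show ?thesis
    unfolding config_algebra_def
    by (intro measurable_PiM_single') (use limit_config_configs in \<open>auto simp: configs_def\<close>)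
qed

text \<open>Stabilization matters here: without it both limits are the default configuration, which
  \<open>g\<close> need not fix. Equivariance of the boundary map is thus an almost sure
  statement.\<close>

lemma limit_config_translate:
  assumes \<omega>: "\<omega> \<in> space (trajectories G)" and g: "g \<in> carrier G" and stab: "lamps_stabilize \<Lambda> \<omega>"
  shows "lamps_stabilize \<Lambda> (\<lambda>n. g \<otimes>\<^bsub>G\<^esub> \<omega> n)"
    and "limit_config L \<Lambda> (\<lambda>n. g \<otimes>\<^bsub>G\<^esub> \<omega> n) = act g (limit_config L \<Lambda> \<omega>)"
proof -
  have ev: "\<forall>\<^sub>F n in sequentially. fst (g \<otimes>\<^bsub>G\<^esub> \<omega> n) z = act g (limit_config L \<Lambda> \<omega>) z"
    if z: "z \<in> carrier \<Lambda>" for z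
  proof -
    have "inv\<^bsub>\<Lambda>\<^esub> snd g \<otimes>\<^bsub>\<Lambda>\<^esub> z \<in> carrier \<Lambda>" using snd_carrier[OF g] z by simp
    from eventually_limit_config[OF stab this, of L] show ?thesis
      by eventually_elim (simp add: fst_mult act_apply z)
  qed
  then show *: "lamps_stabilize \<Lambda> (\<lambda>n. g \<otimes>\<^bsub>G\<^esub> \<omega> n)"
    unfolding lamps_stabilize_def by (intro ballI exI) (rule ev)
  show "limit_config L \<Lambda> (\<lambda>n. g \<otimes>\<^bsub>G\<^esub> \<omega> n) = act g (limit_config L \<Lambda> \<omega>)"
  proof (rule configs_eqI)
    show "limit_config L \<Lambda> (\<lambda>n. g \<otimes>\<^bsub>G\<^esub> \<omega> n) \<in> configs L \<Lambda>"
      using \<omega> g by (intro limit_config_configs) (auto simp: space_trajectories)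
    show "act g (limit_config L \<Lambda> \<omega>) \<in> configs L \<Lambda>"
      using \<omega> g by (intro act_configs limit_config_configs snd_carrier fst_configs)
    fix z assume "z \<in> carrier \<Lambda>"
    from limit_config_eqI[OF * this ev[OF this]]
    show "limit_config L \<Lambda> (\<lambda>n. g \<otimes>\<^bsub>G\<^esub> \<omega> n) z = act g (limit_config L \<Lambda> \<omega>) z" .
  qed
qed

lemma limit_config_invariant_measurable:
  "limit_config L \<Lambda> \<in> measurable (invariant_algebra G) (config_algebra L \<Lambda>)"
proof (rule measurableI)
  have space: "space (invariant_algebra G) = space (trajectories G)"
    by (simp add: invariant_algebra_def space_measure_of_conv)
  show "limit_config L \<Lambda> \<omega> \<in> space (config_algebra L \<Lambda>)" if "\<omega> \<in> space (invariant_algebra G)" for \<omega>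
    using that limit_config_configs by (simp add: space space_config_algebra)
  fix B assume "B \<in> sets (config_algebra L \<Lambda>)"
  then have "limit_config L \<Lambda> -` B \<inter> space (trajectories G) \<in> sets (trajectories G)"
    by (rule measurable_sets[OF limit_config_measurable])
  moreover have "(\<lambda>n. \<omega> (Suc n)) \<in> space (trajectories G)" if "\<omega> \<in> space (trajectories G)" for \<omega>
    using that by (simp add: space_trajectories)
  ultimately show "limit_config L \<Lambda> -` B \<inter> space (invariant_algebra G) \<in> sets (invariant_algebra G)"
    unfolding space by (auto simp: invariant_algebra_def limit_config_Suc intro!: sigma_sets.Basic)
qed

end

section \<open>Cosets of the group of units\<close>

locale lamplighter = wreath_groups L \<Lambda>
  for L :: "('a, 'c) monoid_scheme" and \<Lambda> :: "('b, 'd) monoid_scheme" +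
  fixes \<mu> :: "(('b \<Rightarrow> 'a) \<times> 'b) pmf"
  assumes nontrivial: "carrier L \<noteq> {\<one>\<^bsub>L\<^esub>}"
    and generates: "generate G (set_pmf \<mu>) = carrier G"
    and moves: "set_pmf \<mu> \<subseteq> {(config_delta L \<Lambda> s, \<one>\<^bsub>\<Lambda>\<^esub>) | s. s \<in> carrier L} \<union>
      {(config_one L \<Lambda>, x) | x. x \<in> carrier \<Lambda>}"
    and not_semigroup: "semigroup_generate \<Lambda> (snd ` set_pmf \<mu>) \<noteq> carrier \<Lambda>"
begin

sublocale group_walk G \<mu>
proof unfold_locales
  show "countable (carrier G)" by (rule countable_G)
  show "set_pmf \<mu> \<subseteq> carrier G"
    unfolding generates[symmetric] by (auto intro: generate.incl)
qed

text \<open>\<open>fwd\<close>, \<open>unit_fwd\<close> and \<open>strict_fwd\<close> are S, U and T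
  of the overview.\<close>

definition fwd :: "'b set" where
  "fwd = semigroup_generate \<Lambda> (snd ` set_pmf \<mu>)"

definition unit_fwd :: "'b set" where
  "unit_fwd = {x \<in> fwd. inv\<^bsub>\<Lambda>\<^esub> x \<in> fwd}"

definition strict_fwd :: "'b set" where
  "strict_fwd = {x \<in> fwd. inv\<^bsub>\<Lambda>\<^esub> x \<notin> fwd}"

lemma fwd_carrier: "x \<in> fwd \<Longrightarrow> x \<in> carrier \<Lambda>"
  unfolding fwd_def by (induction rule: semigroup_generate.induct) (use support snd_carrier in auto)

lemma unit_fwd_carrier: "x \<in> unit_fwd \<Longrightarrow> x \<in> carrier \<Lambda>"
  and strict_fwd_carrier: "x \<in> strict_fwd \<Longrightarrow> x \<in> carrier \<Lambda>"
  by (auto simp: unit_fwd_def strict_fwd_def fwd_carrier)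

lemma fwd_cases: "x \<in> fwd \<Longrightarrow> x \<notin> strict_fwd \<Longrightarrow> x \<in> unit_fwd"
  by (auto simp: unit_fwd_def strict_fwd_def)

lemma fwd_mult: "x \<in> fwd \<Longrightarrow> y \<in> fwd \<Longrightarrow> x \<otimes>\<^bsub>\<Lambda>\<^esub> y \<in> fwd"
  unfolding fwd_def by (rule semigroup_generate.mult)

lemma snd_step_fwd: "s \<in> set_pmf \<mu> \<Longrightarrow> snd s \<in> fwd"
  unfolding fwd_def by (intro semigroup_generate.incl) simp

text \<open>Otherwise all steps have trivial lamp part; this property passes to the generated group,
  which would then miss every nontrivial lamp at the origin.\<close>

lemma ex_lamp_move: "\<exists>s\<in>carrier L. s \<noteq> \<one>\<^bsub>L\<^esub> \<and> (config_delta L \<Lambda> s, \<one>\<^bsub>\<Lambda>\<^esub>) \<in> set_pmf \<mu>"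
proof (rule ccontr)
  assume none: "\<not> ?thesis"
  have delta_one: "config_delta L \<Lambda> \<one>\<^bsub>L\<^esub> = config_one L \<Lambda>"
    by (auto simp: config_delta_def config_one_def)
  have step: "fst g = config_one L \<Lambda>" if "g \<in> set_pmf \<mu>" for g
    using that moves none delta_one by fastforce
  have "\<forall>z\<in>carrier \<Lambda>. fst g z = \<one>\<^bsub>L\<^esub>" if "g \<in> generate G (set_pmf \<mu>)" for g
    using that
  proof (induction rule: generate.induct)
    case one
    then show ?case by (simp add: one_G config_one_def)
  next
    case (incl h)
    then show ?case by (simp add: step config_one_def)
  next
    case (inv h)
    then have h: "h \<in> carrier G" using support by auto
    show ?case
    proof
      fix z assume z: "z \<in> carrier \<Lambda>"
      show "fst (inv\<^bsub>G\<^esub> h) z = \<one>\<^bsub>L\<^esub>"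
        using fst_mult[OF z, of "inv\<^bsub>G\<^esub> h" h, unfolded G.l_inv[OF h]] z h inv snd_carrier[of "inv\<^bsub>G\<^esub> h"] fst_configs[of "inv\<^bsub>G\<^esub> h"]
        by (simp add: step one_G config_one_def configs_apply)
    qed
  next
    case (eng g h)
    then have "g \<in> carrier G" by (simp add: generates)
    then show ?case using eng snd_carrier by (simp add: fst_mult)
  qed
  moreover obtain s where "s \<in> carrier L" "s \<noteq> \<one>\<^bsub>L\<^esub>" using nontrivial by auto
  moreover from this have "(config_delta L \<Lambda> s, \<one>\<^bsub>\<Lambda>\<^esub>) \<in> carrier G"
    by (auto simp: carrier_G config_delta_def configs_def supp_def intro: finite_subset[of _ "{\<one>\<^bsub>\<Lambda>\<^esub>}"])
  ultimately have "\<forall>z\<in>carrier \<Lambda>. config_delta L \<Lambda> s z = \<one>\<^bsub>L\<^esub>" and "s \<noteq> \<one>\<^bsub>L\<^esub>"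
    unfolding generates by force+
  then show False
    by (auto simp: config_delta_def dest!: bspec[of _ _ "\<one>\<^bsub>\<Lambda>\<^esub>"])
qed

text \<open>A generated semigroup need not contain the identity; here it does because a lamp move
  projects to it.\<close>

lemma one_fwd: "\<one>\<^bsub>\<Lambda>\<^esub> \<in> fwd"
  using ex_lamp_move snd_step_fwd by force

lemma one_unit_fwd: "\<one>\<^bsub>\<Lambda>\<^esub> \<in> unit_fwd"
  using one_fwd by (simp add: unit_fwd_def)

lemma unit_fwd_inv: "x \<in> unit_fwd \<Longrightarrow> inv\<^bsub>\<Lambda>\<^esub> x \<in> unit_fwd"
  by (auto simp: unit_fwd_def fwd_carrier)

lemma unit_fwd_mult: "x \<in> unit_fwd \<Longrightarrow> y \<in> unit_fwd \<Longrightarrow> x \<otimes>\<^bsub>\<Lambda>\<^esub> y \<in> unit_fwd"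
  by (auto simp: unit_fwd_def fwd_carrier fwd_mult \<Lambda>.inv_mult_group)

text \<open>T is an ideal of S: if x y has its inverse in S, then so has y, as the inverse of y is
  the inverse of x y times x.\<close>

lemma strict_fwd_mult_left:
  assumes "x \<in> fwd" "y \<in> strict_fwd"
  shows "x \<otimes>\<^bsub>\<Lambda>\<^esub> y \<in> strict_fwd"
proof -
  note c = fwd_carrier[OF assms(1)] strict_fwd_carrier[OF assms(2)]
  have "inv\<^bsub>\<Lambda>\<^esub> y \<in> fwd" if "inv\<^bsub>\<Lambda>\<^esub> (x \<otimes>\<^bsub>\<Lambda>\<^esub> y) \<in> fwd"
    using fwd_mult[OF that assms(1)] c by (simp add: \<Lambda>.inv_mult_group \<Lambda>.m_assoc)
  then show ?thesis using assms by (auto simp: strict_fwd_def fwd_mult)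
qed

lemma strict_fwd_mult_right:
  assumes "x \<in> strict_fwd" "y \<in> fwd"
  shows "x \<otimes>\<^bsub>\<Lambda>\<^esub> y \<in> strict_fwd"
proof -
  note c = fwd_carrier[OF assms(2)] strict_fwd_carrier[OF assms(1)]
  have "inv\<^bsub>\<Lambda>\<^esub> x \<in> fwd" if "inv\<^bsub>\<Lambda>\<^esub> (x \<otimes>\<^bsub>\<Lambda>\<^esub> y) \<in> fwd"
    using fwd_mult[OF assms(2) that] c by (simp add: \<Lambda>.inv_mult_group flip: \<Lambda>.m_assoc)
  then show ?thesis using assms by (auto simp: strict_fwd_def fwd_mult)
qed

lemma unit_fwd_not_strict: "x \<in> unit_fwd \<Longrightarrow> x \<notin> strict_fwd"
  by (auto simp: unit_fwd_def strict_fwd_def)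

lemma unit_fwd_fwd: "x \<in> unit_fwd \<Longrightarrow> x \<in> fwd"
  by (simp add: unit_fwd_def)

text \<open>The copy of \<Lambda> in the wreath product. Multiplication by it from the right moves
  the walker and leaves all lamps alone.\<close>

definition base :: "'b \<Rightarrow> ('b \<Rightarrow> 'a) \<times> 'b" where
  "base x = (config_one L \<Lambda>, x)"

lemma base_carrier: "x \<in> carrier \<Lambda> \<Longrightarrow> base x \<in> carrier G"
  by (auto simp: base_def carrier_G config_one_def configs_def supp_def)

lemma fst_mult_base:
  assumes "g \<in> carrier G" "x \<in> carrier \<Lambda>"
  shows "fst (g \<otimes>\<^bsub>G\<^esub> base x) = fst g"
proof (rule configs_eqI)
  show "fst (g \<otimes>\<^bsub>G\<^esub> base x) \<in> configs L \<Lambda>" "fst g \<in> configs L \<Lambda>"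
    using assms base_carrier by (auto intro!: fst_configs)
  fix z assume "z \<in> carrier \<Lambda>"
  then show "fst (g \<otimes>\<^bsub>G\<^esub> base x) z = fst g z"
    using assms snd_carrier fst_configs
    by (simp add: fst_mult base_def config_one_def configs_apply)
qed

lemma snd_mult_base: "snd (g \<otimes>\<^bsub>G\<^esub> base x) = snd g \<otimes>\<^bsub>\<Lambda>\<^esub> x"
  by (simp add: snd_mult base_def)

lemma base_mult: "x \<in> carrier \<Lambda> \<Longrightarrow> y \<in> carrier \<Lambda> \<Longrightarrow> base x \<otimes>\<^bsub>G\<^esub> base y = base (x \<otimes>\<^bsub>\<Lambda>\<^esub> y)"
  by (rule prod_eqI) (simp_all add: fst_mult_base base_carrier snd_mult_base, simp_all add: base_def)

lemma base_one: "base \<one>\<^bsub>\<Lambda>\<^esub> = \<one>\<^bsub>G\<^esub>"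
  by (simp add: base_def one_G)

lemma step_cases:
  assumes "g \<in> set_pmf \<mu>"
  obtains s where "s \<in> carrier L" "g = (config_delta L \<Lambda> s, \<one>\<^bsub>\<Lambda>\<^esub>)" | "snd g \<in> carrier \<Lambda>" "g = base (snd g)"
  using assms moves by (auto simp: base_def)

text \<open>If all steps projected into the group U, then so would the group they generate. This
  would make U, and with it S, all of \<Lambda>.\<close>

lemma ex_strict_move: "\<exists>x\<in>strict_fwd. base x \<in> set_pmf \<mu>"
proof (rule ccontr)
  assume none: "\<not> ?thesis"
  have step: "snd g \<in> unit_fwd" if g: "g \<in> set_pmf \<mu>" for g
    using g
  proof (cases rule: step_cases)
    case 2
    then show ?thesis using none g snd_step_fwd[OF g] fwd_cases by metis
  qed (simp add: one_unit_fwd)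
  have "snd g \<in> unit_fwd" if "g \<in> generate G (set_pmf \<mu>)" for g
    using that
  proof (induction rule: generate.induct)
    case (inv h)
    then have h: "h \<in> carrier G" using support by auto
    have "snd (inv\<^bsub>G\<^esub> h \<otimes>\<^bsub>G\<^esub> h) = snd \<one>\<^bsub>G\<^esub>" using h by simp
    then have "snd (inv\<^bsub>G\<^esub> h) \<otimes>\<^bsub>\<Lambda>\<^esub> snd h = \<one>\<^bsub>\<Lambda>\<^esub>" by (simp add: snd_mult one_G)
    then have "snd (inv\<^bsub>G\<^esub> h) = inv\<^bsub>\<Lambda>\<^esub> snd h"
      using h by (metis \<Lambda>.inv_equality G.inv_closed snd_carrier)
    then show ?case using step[OF inv] by (simp add: unit_fwd_inv)
  qed (simp_all add: one_G one_unit_fwd step snd_mult unit_fwd_mult)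
  then have "x \<in> fwd" if "x \<in> carrier \<Lambda>" for x
    using base_carrier[OF that] unit_fwd_fwd by (force simp: generates base_def)
  then have "fwd = carrier \<Lambda>" using fwd_carrier by blast
  then show False using not_semigroup by (simp add: fwd_def)
qed

text \<open>A strict order between left cosets of U: a walk that has reached \<open>z\<close> can
  never come back to \<open>y\<close>.\<close>

definition precedes :: "'b \<Rightarrow> 'b \<Rightarrow> bool" where
  "precedes y z \<longleftrightarrow> inv\<^bsub>\<Lambda>\<^esub> y \<otimes>\<^bsub>\<Lambda>\<^esub> z \<in> strict_fwd"

lemma precedes_irrefl: "z \<in> carrier \<Lambda> \<Longrightarrow> \<not> precedes z z"
  by (simp add: precedes_def strict_fwd_def one_fwd)

lemma diff_mult_diff:
  "x \<in> carrier \<Lambda> \<Longrightarrow> y \<in> carrier \<Lambda> \<Longrightarrow> z \<in> carrier \<Lambda> \<Longrightarrow>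
    (inv\<^bsub>\<Lambda>\<^esub> x \<otimes>\<^bsub>\<Lambda>\<^esub> y) \<otimes>\<^bsub>\<Lambda>\<^esub> (inv\<^bsub>\<Lambda>\<^esub> y \<otimes>\<^bsub>\<Lambda>\<^esub> z) = inv\<^bsub>\<Lambda>\<^esub> x \<otimes>\<^bsub>\<Lambda>\<^esub> z"
  by (simp add: \<Lambda>.m_assoc) (simp flip: \<Lambda>.m_assoc)

lemma precedes_fwd:
  assumes "precedes x y" "inv\<^bsub>\<Lambda>\<^esub> y \<otimes>\<^bsub>\<Lambda>\<^esub> z \<in> fwd" "x \<in> carrier \<Lambda>" "y \<in> carrier \<Lambda>" "z \<in> carrier \<Lambda>"
  shows "precedes x z"
  using strict_fwd_mult_right[OF assms(1)[unfolded precedes_def] assms(2)] assms(3-)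
  by (simp add: diff_mult_diff precedes_def)

lemma fwd_precedes:
  assumes "inv\<^bsub>\<Lambda>\<^esub> x \<otimes>\<^bsub>\<Lambda>\<^esub> y \<in> fwd" "precedes y z" "x \<in> carrier \<Lambda>" "y \<in> carrier \<Lambda>" "z \<in> carrier \<Lambda>"
  shows "precedes x z"
  using strict_fwd_mult_left[OF assms(1) assms(2)[unfolded precedes_def]] assms(3-)
  by (simp add: diff_mult_diff precedes_def)

definition cut :: "('b \<Rightarrow> 'a) \<Rightarrow> 'b \<Rightarrow> 'b \<Rightarrow> 'a" where
  "cut \<phi> z = (\<lambda>y\<in>carrier \<Lambda>. if precedes y z then \<phi> y else \<one>\<^bsub>L\<^esub>)"

text \<open>Each of \<open>z\<close> and \<open>z\<close> times \<open>u\<close> can be reached from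
  the other by an element of S, so the same sites precede them.\<close>

lemma cut_mult_unit:
  assumes "z \<in> carrier \<Lambda>" "u \<in> unit_fwd"
  shows "cut \<phi> (z \<otimes>\<^bsub>\<Lambda>\<^esub> u) = cut \<phi> z"
proof -
  note u = unit_fwd_carrier[OF assms(2)]
  have "inv\<^bsub>\<Lambda>\<^esub> z \<otimes>\<^bsub>\<Lambda>\<^esub> (z \<otimes>\<^bsub>\<Lambda>\<^esub> u) = u" "inv\<^bsub>\<Lambda>\<^esub> (z \<otimes>\<^bsub>\<Lambda>\<^esub> u) \<otimes>\<^bsub>\<Lambda>\<^esub> z = inv\<^bsub>\<Lambda>\<^esub> u"
    using assms(1) u by (simp_all add: \<Lambda>.inv_mult_group \<Lambda>.m_assoc) (simp flip: \<Lambda>.m_assoc)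
  then have "precedes y (z \<otimes>\<^bsub>\<Lambda>\<^esub> u) \<longleftrightarrow> precedes y z" if "y \<in> carrier \<Lambda>" for y
    using that assms u precedes_fwd[of y z "z \<otimes>\<^bsub>\<Lambda>\<^esub> u"] precedes_fwd[of y "z \<otimes>\<^bsub>\<Lambda>\<^esub> u" z]
    by (auto simp: unit_fwd_def)
  then show ?thesis
    unfolding cut_def by (intro restrict_ext) simp
qed

section \<open>Deterministic properties of trajectories with infinitely many steps in T\<close>

abbreviation pos :: "(nat \<Rightarrow> ('b \<Rightarrow> 'a) \<times> 'b) \<Rightarrow> nat \<Rightarrow> 'b" where
  "pos \<xi> n \<equiv> snd (walk \<xi> n)"

abbreviation lamp :: "(nat \<Rightarrow> ('b \<Rightarrow> 'a) \<times> 'b) \<Rightarrow> nat \<Rightarrow> 'b \<Rightarrow> 'a" where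
  "lamp \<xi> n \<equiv> fst (walk \<xi> n)"

abbreviation final :: "(nat \<Rightarrow> ('b \<Rightarrow> 'a) \<times> 'b) \<Rightarrow> 'b \<Rightarrow> 'a" where
  "final \<xi> \<equiv> limit_config L \<Lambda> (walk \<xi>)"

definition regular :: "(nat \<Rightarrow> ('b \<Rightarrow> 'a) \<times> 'b) \<Rightarrow> bool" where
  "regular \<xi> \<longleftrightarrow> (\<forall>n. \<xi> n \<in> set_pmf \<mu>) \<and> (\<forall>N. \<exists>m\<ge>N. snd (\<xi> m) \<in> strict_fwd)"

text \<open>The increment \<open>\<xi> (m - 1)\<close> leads from time \<open>m - 1\<close> to time
  \<open>m\<close>, so whether \<open>m\<close> is an entry is decided by the first \<open>m\<close>
  increments. Time 0 opens the first excursion.\<close>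

definition entry :: "(nat \<Rightarrow> ('b \<Rightarrow> 'a) \<times> 'b) \<Rightarrow> nat \<Rightarrow> bool" where
  "entry \<xi> m \<longleftrightarrow> m = 0 \<or> snd (\<xi> (m - 1)) \<in> strict_fwd"

text \<open>Only the initial coset is looked at. For an entry \<open>m\<close>,
  \<open>lit (shift_seq m \<xi>)\<close> lists the lit sites of the coset entered, relative to the
  point of entry, and depends on the later increments only.\<close>

definition lit :: "(nat \<Rightarrow> ('b \<Rightarrow> 'a) \<times> 'b) \<Rightarrow> 'b set" where
  "lit \<xi> = {u \<in> unit_fwd. final \<xi> u \<noteq> \<one>\<^bsub>L\<^esub>}"

text \<open>The substitute for time that is visible in a group element.\<close>

definition weight :: "('b \<Rightarrow> 'a) \<times> 'b \<Rightarrow> nat" where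
  "weight g = card (supp (fst g))"

text \<open>
  The candidates of \<open>\<Phi>\<^sub>\<infinity>\<close> are the elements \<open>(\<Phi>\<^sub>m, X\<^sub>m u)\<close> with \<open>X\<^sub>m u\<close> lit in \<open>\<Phi>\<^sub>\<infinity>\<close>. Those selected for \<open>k\<close>
  belong to the first lit coset before which at least \<open>k\<close> sites are lit. For \<open>m\<close> to be the time of
  entry into this coset, \<open>first_entry k \<xi> m\<close> is necessary, which depends on the past only.
\<close>

definition candidate :: "('b \<Rightarrow> 'a) \<Rightarrow> ('b \<Rightarrow> 'a) \<times> 'b \<Rightarrow> bool" where
  "candidate \<phi> g \<longleftrightarrow> \<phi> (snd g) \<noteq> \<one>\<^bsub>L\<^esub> \<and> fst g = cut \<phi> (snd g)"

definition selected :: "nat \<Rightarrow> ('b \<Rightarrow> 'a) \<Rightarrow> ('b \<Rightarrow> 'a) \<times> 'b \<Rightarrow> bool" where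
  "selected k \<phi> g \<longleftrightarrow> candidate \<phi> g \<and> k \<le> weight g \<and>
    (\<forall>g'\<in>carrier G. candidate \<phi> g' \<longrightarrow> k \<le> weight g' \<longrightarrow> weight g \<le> weight g')"

definition first_entry :: "nat \<Rightarrow> (nat \<Rightarrow> ('b \<Rightarrow> 'a) \<times> 'b) \<Rightarrow> nat \<Rightarrow> bool" where
  "first_entry k \<xi> m \<longleftrightarrow> entry \<xi> m \<and> k \<le> weight (walk \<xi> m) \<and>
    (\<forall>m'<m. entry \<xi> m' \<longrightarrow> k \<le> weight (walk \<xi> m') \<longrightarrow> weight (walk \<xi> m) \<le> weight (walk \<xi> m'))"

lemma regular_space: "regular \<xi> \<Longrightarrow> \<xi> \<in> space increments"
  using support by (auto simp: regular_def space_increments)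

lemma regular_shift: "regular \<xi> \<Longrightarrow> regular (shift_seq n \<xi>)"
  unfolding regular_def
proof (elim conjE, intro conjI allI)
  fix N assume "\<forall>N. \<exists>m\<ge>N. snd (\<xi> m) \<in> strict_fwd"
  then obtain m where "m \<ge> N + n" "snd (\<xi> m) \<in> strict_fwd" by blast
  then show "\<exists>m\<ge>N. snd (shift_seq n \<xi> m) \<in> strict_fwd"
    by (intro exI[of _ "m - n"]) auto
qed simp

context
  fixes \<xi> assumes reg: "regular \<xi>"
begin

lemma pos_carrier [simp]: "pos \<xi> n \<in> carrier \<Lambda>"
  by (intro snd_carrier walk_closed regular_space reg)

lemma walk_carrier [simp]: "walk \<xi> n \<in> carrier G"
  by (intro walk_closed regular_space reg)

lemma step_support: "\<xi> n \<in> set_pmf \<mu>"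
  using reg by (simp add: regular_def)

lemma pos_fwd: "n \<le> m \<Longrightarrow> inv\<^bsub>\<Lambda>\<^esub> pos \<xi> n \<otimes>\<^bsub>\<Lambda>\<^esub> pos \<xi> m \<in> fwd"
proof (induction m rule: dec_induct)
  case (step m)
  then show ?case
    using fwd_mult[OF step.IH snd_step_fwd[OF step_support[of m]]] fwd_carrier[OF snd_step_fwd[OF step_support[of m]]]
    by (simp add: snd_mult \<Lambda>.m_assoc)
qed (simp add: one_fwd)

text \<open>The displacement from time \<open>i\<close> to \<open>j\<close> contains the step in T
  that leads into \<open>m\<close>, and T is an ideal of S.\<close>

lemma entry_precedes:
  assumes "entry \<xi> m" "i < m" "m \<le> j"
  shows "precedes (pos \<xi> i) (pos \<xi> j)"
proof -
  obtain m' where m: "m = Suc m'" using assms(2) by (cases m) auto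
  have s: "snd (\<xi> m') \<in> strict_fwd" using assms(1) m by (simp add: entry_def)
  have "inv\<^bsub>\<Lambda>\<^esub> pos \<xi> m' \<otimes>\<^bsub>\<Lambda>\<^esub> pos \<xi> m = snd (\<xi> m')"
    using strict_fwd_carrier[OF s] by (simp add: m snd_mult flip: \<Lambda>.m_assoc)
  then have "precedes (pos \<xi> m') (pos \<xi> m)"
    using s by (simp add: precedes_def)
  moreover have "i \<le> m'" using assms(2) m by simp
  ultimately have "precedes (pos \<xi> i) (pos \<xi> m)"
    using pos_fwd fwd_precedes pos_carrier by blast
  then show ?thesis
    using pos_fwd[OF assms(3)] precedes_fwd pos_carrier by blast
qed

lemma not_visited_after:
  assumes "precedes y (pos \<xi> m)" "m \<le> j" "y \<in> carrier \<Lambda>"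
  shows "pos \<xi> j \<noteq> y"
  using precedes_fwd[OF assms(1) pos_fwd[OF assms(2)]] precedes_irrefl assms(3) by auto

text \<open>A step of the walk can change only the lamp at the current position, by the shape of the
  support.\<close>

lemma lamp_Suc_eq:
  assumes z: "z \<in> carrier \<Lambda>" and "pos \<xi> n \<noteq> z"
  shows "lamp \<xi> (Suc n) z = lamp \<xi> n z"
proof -
  have "inv\<^bsub>\<Lambda>\<^esub> pos \<xi> n \<otimes>\<^bsub>\<Lambda>\<^esub> z \<noteq> \<one>\<^bsub>\<Lambda>\<^esub>"
    using assms by (metis \<Lambda>.inv_equality \<Lambda>.inv_inv \<Lambda>.inv_closed pos_carrier)
  moreover have "inv\<^bsub>\<Lambda>\<^esub> pos \<xi> n \<otimes>\<^bsub>\<Lambda>\<^esub> z \<in> carrier \<Lambda>" using z by simp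
  ultimately have "fst g (inv\<^bsub>\<Lambda>\<^esub> pos \<xi> n \<otimes>\<^bsub>\<Lambda>\<^esub> z) = \<one>\<^bsub>L\<^esub>" if "g \<in> set_pmf \<mu>" for g
    using that moves by (auto simp: config_delta_def config_one_def)
  from this[OF step_support[of n]]
  show ?thesis
    using z fst_configs[OF walk_carrier] by (simp add: fst_mult configs_apply)
qed

lemma lamp_stays:
  assumes "z \<in> carrier \<Lambda>" "m \<le> n" "\<And>j. m \<le> j \<Longrightarrow> j < n \<Longrightarrow> pos \<xi> j \<noteq> z"
  shows "lamp \<xi> n z = lamp \<xi> m z"
  using assms(2,3) by (induction n rule: dec_induct) (simp_all add: lamp_Suc_eq[OF assms(1)] del: walk_position.simps)

lemma lamp_visited:
  assumes "z \<in> carrier \<Lambda>" "lamp \<xi> n z \<noteq> \<one>\<^bsub>L\<^esub>"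
  obtains i where "i < n" "pos \<xi> i = z"
proof -
  have "lamp \<xi> 0 z = \<one>\<^bsub>L\<^esub>" using assms(1) by (simp add: one_G config_one_def)
  have "lamp \<xi> n z = lamp \<xi> 0 z" if "\<forall>i<n. pos \<xi> i \<noteq> z"
    by (rule lamp_stays[OF assms(1)]) (use that in auto)
  with \<open>lamp \<xi> 0 z = \<one>\<^bsub>L\<^esub>\<close> assms(2) have "\<not> (\<forall>i<n. pos \<xi> i \<noteq> z)" by metis
  then show ?thesis using that by blast
qed

text \<open>A site is either never visited, or abandoned for good at the first step in T after a
  visit.\<close>

lemma lamps_stabilize_walk: "lamps_stabilize \<Lambda> (walk \<xi>)"
  unfolding lamps_stabilize_def
proof
  fix z assume z: "z \<in> carrier \<Lambda>"
  have "\<exists>m. \<forall>j\<ge>m. pos \<xi> j \<noteq> z"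
  proof (cases "\<exists>i. pos \<xi> i = z")
    case True
    then obtain i where i: "pos \<xi> i = z" ..
    obtain m where m: "m \<ge> i" "snd (\<xi> m) \<in> strict_fwd" using reg by (auto simp: regular_def)
    then have "entry \<xi> (Suc m)" by (simp add: entry_def)
    then have "precedes z (pos \<xi> (Suc m))"
      unfolding i[symmetric] by (rule entry_precedes) (use m(1) in simp_all)
    then have "\<forall>j\<ge>Suc m. pos \<xi> j \<noteq> z"
      by (intro allI impI not_visited_after[OF _ _ z])
    then show ?thesis ..
  qed blast
  then obtain m where "\<forall>j\<ge>m. pos \<xi> j \<noteq> z" ..
  then have "\<forall>n\<ge>m. lamp \<xi> n z = lamp \<xi> m z"
    by (intro allI impI lamp_stays[OF z]) blast+
  then show "\<exists>l. \<forall>\<^sub>F n in sequentially. lamp \<xi> n z = l"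
    unfolding eventually_sequentially by blast
qed

lemma final_eq_lamp:
  assumes "z \<in> carrier \<Lambda>" "\<And>j. m \<le> j \<Longrightarrow> pos \<xi> j \<noteq> z"
  shows "final \<xi> z = lamp \<xi> m z"
  using lamps_stabilize_walk assms(1)
proof (rule limit_config_eqI)
  show "\<forall>\<^sub>F n in sequentially. lamp \<xi> n z = lamp \<xi> m z"
    unfolding eventually_sequentially
    by (intro exI[of _ m] allI impI lamp_stays[OF assms(1)] assms(2))
qed

lemma final_eq_lamp_past:
  "z \<in> carrier \<Lambda> \<Longrightarrow> precedes z (pos \<xi> m) \<Longrightarrow> final \<xi> z = lamp \<xi> m z"
  by (rule final_eq_lamp) (auto dest: not_visited_after)

lemma final_visited:
  assumes "z \<in> carrier \<Lambda>" "final \<xi> z \<noteq> \<one>\<^bsub>L\<^esub>"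
  obtains j where "pos \<xi> j = z"
  using assms final_eq_lamp[of z 0] by (fastforce simp: one_G config_one_def)

lemma lamp_entry_one:
  assumes "entry \<xi> m" "z \<in> carrier \<Lambda>" "\<not> precedes z (pos \<xi> m)"
  shows "lamp \<xi> m z = \<one>\<^bsub>L\<^esub>"
proof (rule ccontr)
  assume "lamp \<xi> m z \<noteq> \<one>\<^bsub>L\<^esub>"
  then obtain i where "i < m" "pos \<xi> i = z" using lamp_visited[OF assms(2)] by blast
  with entry_precedes[OF assms(1) _ order_refl] assms(3) show False by blast
qed

text \<open>All sites visited before an entry precede the point of entry, so the others are still
  dark; those that precede it are never visited again, so their lamps are already final.\<close>

lemma lamp_entry:
  assumes "entry \<xi> m"
  shows "lamp \<xi> m = cut (final \<xi>) (pos \<xi> m)"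
proof
  fix z
  show "lamp \<xi> m z = cut (final \<xi>) (pos \<xi> m) z"
  proof (cases "z \<in> carrier \<Lambda>")
    case True
    then show ?thesis
      using final_eq_lamp_past[OF True, of m] lamp_entry_one[OF assms True] by (simp add: cut_def)
  next
    case False
    have "lamp \<xi> m \<in> configs L \<Lambda>" by (intro fst_configs walk_carrier)
    then have "lamp \<xi> m z = undefined"
      using False unfolding configs_def by (rule PiE_arb)
    with False show ?thesis by (simp add: cut_def)
  qed
qed

lemma last_entry:
  obtains m u where "m \<le> j" "entry \<xi> m" "u \<in> unit_fwd" "pos \<xi> j = pos \<xi> m \<otimes>\<^bsub>\<Lambda>\<^esub> u"
proof -
  have "\<exists>m u. m \<le> j \<and> entry \<xi> m \<and> u \<in> unit_fwd \<and> pos \<xi> j = pos \<xi> m \<otimes>\<^bsub>\<Lambda>\<^esub> u"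
  proof (induction j)
    case 0
    have "entry \<xi> 0" by (simp add: entry_def)
    moreover have "pos \<xi> 0 = pos \<xi> 0 \<otimes>\<^bsub>\<Lambda>\<^esub> \<one>\<^bsub>\<Lambda>\<^esub>" by (simp add: one_G)
    ultimately show ?case using one_unit_fwd by blast
  next
    case (Suc j)
    show ?case
    proof (cases "snd (\<xi> j) \<in> strict_fwd")
      case True
      then have "entry \<xi> (Suc j)" by (simp add: entry_def)
      moreover have "pos \<xi> (Suc j) = pos \<xi> (Suc j) \<otimes>\<^bsub>\<Lambda>\<^esub> \<one>\<^bsub>\<Lambda>\<^esub>"
        by (rule \<Lambda>.r_one[OF pos_carrier, symmetric])
      ultimately show ?thesis using one_unit_fwd by blast
    next
      case False
      then have s: "snd (\<xi> j) \<in> unit_fwd"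
        by (intro fwd_cases snd_step_fwd step_support)
      obtain m u where m: "m \<le> j" "entry \<xi> m" and u: "u \<in> unit_fwd" "pos \<xi> j = pos \<xi> m \<otimes>\<^bsub>\<Lambda>\<^esub> u"
        using Suc by blast
      have "pos \<xi> (Suc j) = pos \<xi> j \<otimes>\<^bsub>\<Lambda>\<^esub> snd (\<xi> j)" by (simp add: snd_mult)
      also have "\<dots> = pos \<xi> m \<otimes>\<^bsub>\<Lambda>\<^esub> (u \<otimes>\<^bsub>\<Lambda>\<^esub> snd (\<xi> j))"
        unfolding u(2) by (intro \<Lambda>.m_assoc pos_carrier unit_fwd_carrier u s)
      finally show ?thesis
        using m unit_fwd_mult[OF u(1) s] by (metis le_SucI)
    qed
  qed
  then show ?thesis using that by blast
qed

lemma not_precedes_unit: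
  assumes "u \<in> unit_fwd"
  shows "\<not> precedes (pos \<xi> m \<otimes>\<^bsub>\<Lambda>\<^esub> u) (pos \<xi> m)"
proof -
  have "inv\<^bsub>\<Lambda>\<^esub> (pos \<xi> m \<otimes>\<^bsub>\<Lambda>\<^esub> u) \<otimes>\<^bsub>\<Lambda>\<^esub> pos \<xi> m = inv\<^bsub>\<Lambda>\<^esub> u"
    using unit_fwd_carrier[OF assms] by (simp add: \<Lambda>.inv_mult_group \<Lambda>.m_assoc)
  then show ?thesis
    using unit_fwd_not_strict[OF unit_fwd_inv[OF assms]] by (simp add: precedes_def)
qed

lemma precedes_unit_later_entry:
  assumes "u \<in> unit_fwd" "entry \<xi> n" "m < n"
  shows "precedes (pos \<xi> m \<otimes>\<^bsub>\<Lambda>\<^esub> u) (pos \<xi> n)"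
proof (rule fwd_precedes[of _ "pos \<xi> m"])
  have "inv\<^bsub>\<Lambda>\<^esub> (pos \<xi> m \<otimes>\<^bsub>\<Lambda>\<^esub> u) \<otimes>\<^bsub>\<Lambda>\<^esub> pos \<xi> m = inv\<^bsub>\<Lambda>\<^esub> u"
    using unit_fwd_carrier[OF assms(1)] by (simp add: \<Lambda>.inv_mult_group \<Lambda>.m_assoc)
  then show "inv\<^bsub>\<Lambda>\<^esub> (pos \<xi> m \<otimes>\<^bsub>\<Lambda>\<^esub> u) \<otimes>\<^bsub>\<Lambda>\<^esub> pos \<xi> m \<in> fwd"
    using unit_fwd_inv[OF assms(1)] by (simp add: unit_fwd_fwd)
  show "precedes (pos \<xi> m) (pos \<xi> n)"
    using assms(2,3) by (rule entry_precedes) simp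
qed (use unit_fwd_carrier[OF assms(1)] in simp_all)

end

lemma final_shift:
  assumes "regular \<xi>"
  shows "final \<xi> = act (walk \<xi> m) (final (shift_seq m \<xi>))"
proof -
  have "final \<xi> = limit_config L \<Lambda> (\<lambda>n. walk \<xi> (n + m))"
  proof (induction m)
    case (Suc m)
    then show ?case
      using limit_config_Suc[of L \<Lambda> "\<lambda>n. walk \<xi> (n + m)"] by (simp del: walk_position.simps)
  qed simp
  also have "(\<lambda>n. walk \<xi> (n + m)) = (\<lambda>n. walk \<xi> m \<otimes>\<^bsub>G\<^esub> walk (shift_seq m \<xi>) n)"
    by (rule ext) (rule walk_add[OF regular_space[OF assms]])
  also have "limit_config L \<Lambda> \<dots> = act (walk \<xi> m) (final (shift_seq m \<xi>))"
    using assms regular_shift[OF assms]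
    by (intro limit_config_translate walk_trajectory walk_carrier regular_space lamps_stabilize_walk)
  finally show ?thesis .
qed

text \<open>No site of the coset entered precedes the point of entry, so its lamps are all off then,
  and only the shifted walk acts on them.\<close>

lemma final_entry_unit:
  assumes "regular \<xi>" "entry \<xi> m" "u \<in> unit_fwd"
  shows "final \<xi> (pos \<xi> m \<otimes>\<^bsub>\<Lambda>\<^esub> u) = final (shift_seq m \<xi>) u"
proof -
  let ?z = "pos \<xi> m \<otimes>\<^bsub>\<Lambda>\<^esub> u"
  have c: "pos \<xi> m \<in> carrier \<Lambda>" "u \<in> carrier \<Lambda>"
    using assms by (auto intro: pos_carrier unit_fwd_carrier)
  have z: "?z \<in> carrier \<Lambda>" using c by simp
  have "inv\<^bsub>\<Lambda>\<^esub> pos \<xi> m \<otimes>\<^bsub>\<Lambda>\<^esub> ?z = u" using c by (simp flip: \<Lambda>.m_assoc)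
  moreover have "lamp \<xi> m ?z = \<one>\<^bsub>L\<^esub>"
    using assms z by (intro lamp_entry_one not_precedes_unit)
  moreover have "final (shift_seq m \<xi>) \<in> configs L \<Lambda>"
    using assms by (intro limit_config_configs walk_trajectory regular_space regular_shift)
  ultimately show ?thesis
    using z c by (subst final_shift[OF assms(1), of m]) (simp add: act_apply configs_apply)
qed

section \<open>Candidates and their selection\<close>

lemma candidate_entry:
  assumes "regular \<xi>" "entry \<xi> m" "u \<in> lit (shift_seq m \<xi>)"
  shows "candidate (final \<xi>) (walk \<xi> m \<otimes>\<^bsub>G\<^esub> base u)"
proof -
  have u: "u \<in> unit_fwd" "final (shift_seq m \<xi>) u \<noteq> \<one>\<^bsub>L\<^esub>"
    using assms(3) by (auto simp: lit_def)
  then show ?thesis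
    using assms final_entry_unit[OF assms(1,2) u(1)] lamp_entry[OF assms(1,2)]
    by (simp add: candidate_def snd_mult_base fst_mult_base walk_carrier unit_fwd_carrier pos_carrier
      cut_mult_unit)
qed

lemma lit_site_entry:
  assumes "regular \<xi>" "z \<in> carrier \<Lambda>" "final \<xi> z \<noteq> \<one>\<^bsub>L\<^esub>"
  obtains j m u where "pos \<xi> j = z" "m \<le> j" "entry \<xi> m" "u \<in> lit (shift_seq m \<xi>)"
    "z = pos \<xi> m \<otimes>\<^bsub>\<Lambda>\<^esub> u"
proof -
  obtain j where j: "pos \<xi> j = z" using final_visited[OF assms] .
  obtain m u where m: "m \<le> j" "entry \<xi> m" "u \<in> unit_fwd" "pos \<xi> j = pos \<xi> m \<otimes>\<^bsub>\<Lambda>\<^esub> u"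
    using last_entry[OF assms(1)] .
  have "u \<in> lit (shift_seq m \<xi>)"
    using m j final_entry_unit[OF assms(1) m(2,3)] assms(3) by (simp add: lit_def)
  with j m that show ?thesis by metis
qed

text \<open>A lit site was visited, hence lies in a coset entered by the walk. Since the position of
  a candidate determines its lamps, the candidate must be the one attached to that entry.\<close>

lemma candidate_final:
  assumes "regular \<xi>" "g \<in> carrier G" "candidate (final \<xi>) g"
  obtains m u where "entry \<xi> m" "u \<in> lit (shift_seq m \<xi>)" "g = walk \<xi> m \<otimes>\<^bsub>G\<^esub> base u"
proof -
  obtain m u where m: "entry \<xi> m" "u \<in> lit (shift_seq m \<xi>)" "snd g = pos \<xi> m \<otimes>\<^bsub>\<Lambda>\<^esub> u"
    using lit_site_entry[OF assms(1) snd_carrier[OF assms(2)]] assms(3)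
    unfolding candidate_def by metis
  have "candidate (final \<xi>) (walk \<xi> m \<otimes>\<^bsub>G\<^esub> base u)"
    using assms(1) m(1,2) by (rule candidate_entry)
  then have "g = walk \<xi> m \<otimes>\<^bsub>G\<^esub> base u"
    using assms(3) m(3) by (intro prod_eqI) (simp_all add: candidate_def snd_mult_base)
  with m that show ?thesis by blast
qed

lemma weight_mult_base: "g \<in> carrier G \<Longrightarrow> x \<in> carrier \<Lambda> \<Longrightarrow> weight (g \<otimes>\<^bsub>G\<^esub> base x) = weight g"
  by (simp add: weight_def fst_mult_base)

lemma supp_entry:
  assumes "regular \<xi>" "entry \<xi> m"
  shows "supp (lamp \<xi> m) = {z \<in> carrier \<Lambda>. precedes z (pos \<xi> m) \<and> final \<xi> z \<noteq> \<one>\<^bsub>L\<^esub>}"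
  unfolding supp_def lamp_entry[OF assms] cut_def by auto

lemma finite_supp_walk: "regular \<xi> \<Longrightarrow> finite (supp (lamp \<xi> m))"
  by (intro finite_supp walk_carrier)

lemma weight_mono:
  assumes "regular \<xi>" "entry \<xi> m" "entry \<xi> n" "m \<le> n"
  shows "weight (walk \<xi> m) \<le> weight (walk \<xi> n)"
  unfolding weight_def
proof (rule card_mono[OF finite_supp_walk[OF assms(1)]])
  show "supp (lamp \<xi> m) \<subseteq> supp (lamp \<xi> n)"
    unfolding supp_entry[OF assms(1,2)] supp_entry[OF assms(1,3)]
    using precedes_fwd[OF _ pos_fwd[OF assms(1,4)]] pos_carrier[OF assms(1)] by auto
qed

text \<open>A lit site of the coset entered at \<open>m\<close> precedes the later entry but not the
  entry \<open>m\<close> itself.\<close>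

lemma weight_strict_mono:
  assumes "regular \<xi>" "entry \<xi> m" "entry \<xi> n" "m < n" "lit (shift_seq m \<xi>) \<noteq> {}"
  shows "weight (walk \<xi> m) < weight (walk \<xi> n)"
  unfolding weight_def
proof (rule psubset_card_mono[OF finite_supp_walk[OF assms(1)]])
  obtain u where u: "u \<in> lit (shift_seq m \<xi>)" using assms(5) by auto
  let ?z = "pos \<xi> m \<otimes>\<^bsub>\<Lambda>\<^esub> u"
  have u': "u \<in> unit_fwd" "final \<xi> ?z \<noteq> \<one>\<^bsub>L\<^esub>"
    using u final_entry_unit[OF assms(1,2), of u] by (auto simp: lit_def)
  have "?z \<in> supp (lamp \<xi> n)" "?z \<notin> supp (lamp \<xi> m)"
    unfolding supp_entry[OF assms(1,2)] supp_entry[OF assms(1,3)]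
    using u' precedes_unit_later_entry[OF assms(1) u'(1) assms(3,4)] not_precedes_unit[OF assms(1) u'(1)]
      pos_carrier[OF assms(1)] unit_fwd_carrier by auto
  moreover have "supp (lamp \<xi> m) \<subseteq> supp (lamp \<xi> n)"
    unfolding supp_entry[OF assms(1,2)] supp_entry[OF assms(1,3)]
    using precedes_fwd[OF _ pos_fwd[OF assms(1), of m n]] assms(4) pos_carrier[OF assms(1)] by auto
  ultimately show "supp (lamp \<xi> m) \<subset> supp (lamp \<xi> n)" by blast
qed

text \<open>This forces an entry of weight at least \<open>k\<close> to occur at time
  \<open>k\<close> or later.\<close>

lemma weight_le_time:
  assumes "regular \<xi>"
  shows "weight (walk \<xi> m) \<le> m"
proof -
  have "supp (lamp \<xi> m) \<subseteq> pos \<xi> ` {..<m}"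
  proof
    fix z assume "z \<in> supp (lamp \<xi> m)"
    then have "z \<in> carrier \<Lambda>" "lamp \<xi> m z \<noteq> \<one>\<^bsub>L\<^esub>" by (simp_all add: supp_def)
    then obtain i where "i < m" "pos \<xi> i = z" using lamp_visited[OF assms] by blast
    then show "z \<in> pos \<xi> ` {..<m}" by blast
  qed
  then have "card (supp (lamp \<xi> m)) \<le> card (pos \<xi> ` {..<m})"
    by (intro card_mono) simp_all
  also have "\<dots> \<le> m"
    using card_image_le[of "{..<m}" "pos \<xi>"] by simp
  finally show ?thesis by (simp add: weight_def)
qed

text \<open>Minimality among candidates says nothing directly about entries whose coset stays dark.
  It has to be shown that those cannot have smaller admissible weight either.\<close>

lemma selected_first_entry:
  assumes reg: "regular \<xi>" and g: "g \<in> carrier G" and sel: "selected k (final \<xi>) g"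
  obtains m u where "first_entry k \<xi> m" "u \<in> lit (shift_seq m \<xi>)" "g = walk \<xi> m \<otimes>\<^bsub>G\<^esub> base u"
proof -
  obtain m u where m: "entry \<xi> m" and u: "u \<in> lit (shift_seq m \<xi>)" and gm: "g = walk \<xi> m \<otimes>\<^bsub>G\<^esub> base u"
    using candidate_final[OF reg g] sel unfolding selected_def by metis
  have base: "base v \<in> carrier G" "v \<in> carrier \<Lambda>" if "v \<in> lit \<eta>" for v \<eta>
    using that unit_fwd_carrier base_carrier by (auto simp: lit_def)
  have w: "weight g = weight (walk \<xi> m)"
    unfolding gm by (intro weight_mult_base walk_carrier reg base[OF u])
  have "weight (walk \<xi> m) \<le> weight (walk \<xi> m')"
    if m': "m' < m" "entry \<xi> m'" "k \<le> weight (walk \<xi> m')" for m'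
  proof (rule ccontr)
    assume less: "\<not> weight (walk \<xi> m) \<le> weight (walk \<xi> m')"
    \<comment> \<open>The coset entered at \<open>m'\<close> may be dark, so it yields no candidate.
      But a lit site \<open>y\<close> gained between \<open>m'\<close> and \<open>m\<close> lies in
      a lit coset entered at some \<open>n\<close> in between, and this coset contradicts
      minimality.\<close>
    have "\<not> supp (lamp \<xi> m) \<subseteq> supp (lamp \<xi> m')"
      using less card_mono[OF finite_supp_walk[OF reg]] by (auto simp: weight_def)
    then obtain y where y: "y \<in> carrier \<Lambda>" "precedes y (pos \<xi> m)" "final \<xi> y \<noteq> \<one>\<^bsub>L\<^esub>"
        "\<not> precedes y (pos \<xi> m')"
      unfolding supp_entry[OF reg m] supp_entry[OF reg m'(2)] by auto
    obtain j n v where n: "pos \<xi> j = y" "n \<le> j" "entry \<xi> n" and v: "v \<in> lit (shift_seq n \<xi>)"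
        and yv: "y = pos \<xi> n \<otimes>\<^bsub>\<Lambda>\<^esub> v"
      using lit_site_entry[OF reg y(1,3)] .
    \<comment> \<open>For \<open>n < m'\<close> the whole coset of \<open>y\<close> would precede
      the position at time \<open>m'\<close>.\<close>
    have "m' \<le> n"
      using precedes_unit_later_entry[OF reg _ m'(2), of v n] v y(4) yv by (force simp: lit_def)
    then have "k \<le> weight (walk \<xi> n)"
      using weight_mono[OF reg m'(2) n(3)] m'(3) by simp
    moreover have "weight (walk \<xi> n \<otimes>\<^bsub>G\<^esub> base v) = weight (walk \<xi> n)"
      by (intro weight_mult_base walk_carrier reg base[OF v])
    moreover have "walk \<xi> n \<otimes>\<^bsub>G\<^esub> base v \<in> carrier G"
      by (intro G.m_closed walk_carrier reg base[OF v])
    ultimately have "weight g \<le> weight (walk \<xi> n)"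
      using sel candidate_entry[OF reg n(3) v] unfolding selected_def by metis
    moreover have "n < m"
      using not_visited_after[OF reg y(2), of j] y(1) n by fastforce
    then have "weight (walk \<xi> n) < weight (walk \<xi> m)"
      using weight_strict_mono[OF reg n(3) m] v by blast
    ultimately show False using w by simp
  qed
  then have "first_entry k \<xi> m"
    using m sel w by (auto simp: first_entry_def selected_def)
  with u gm that show ?thesis by blast
qed

text \<open>The weight at the later entry must not exceed that at the earlier one, yet an excursion
  that lights a lamp raises the weight of all later entries.\<close>

lemma first_entry_unique:
  assumes "regular \<xi>" "first_entry k \<xi> m" "first_entry k \<xi> n"
    and "lit (shift_seq m \<xi>) \<noteq> {}" "lit (shift_seq n \<xi>) \<noteq> {}"
  shows "m = n"
proof -
  have False if "m < n" "first_entry k \<xi> m" "first_entry k \<xi> n" "lit (shift_seq m \<xi>) \<noteq> {}" for m n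
    using weight_strict_mono[OF assms(1) _ _ that(1,4)] that(1-3) unfolding first_entry_def
    by (metis not_le)
  then show ?thesis
    using assms by (metis nat_neq_iff)
qed

text \<open>Infinitely many lit cosets make the weights of candidates unbounded, and the natural
  numbers are well-ordered.\<close>

lemma ex_selected:
  assumes reg: "regular \<xi>" and inf: "\<And>N. \<exists>m\<ge>N. entry \<xi> m \<and> lit (shift_seq m \<xi>) \<noteq> {}"
  shows "\<exists>g\<in>carrier G. selected k (final \<xi>) g"
proof -
  have "\<exists>m. entry \<xi> m \<and> lit (shift_seq m \<xi>) \<noteq> {} \<and> k \<le> weight (walk \<xi> m)" for k
  proof (induction k)
    case 0
    then show ?case using inf[of 0] by blast
  next
    case (Suc k)
    then obtain m where m: "entry \<xi> m" "lit (shift_seq m \<xi>) \<noteq> {}" "k \<le> weight (walk \<xi> m)" by blast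
    obtain n where n: "n \<ge> Suc m" "entry \<xi> n" "lit (shift_seq n \<xi>) \<noteq> {}" using inf by blast
    have "weight (walk \<xi> m) < weight (walk \<xi> n)"
      using weight_strict_mono[OF reg m(1) n(2)] n(1) m(2) by simp
    with m(3) have "Suc k \<le> weight (walk \<xi> n)" by simp
    then show ?case using n by blast
  qed
  then obtain m u where m: "entry \<xi> m" "u \<in> lit (shift_seq m \<xi>)" "k \<le> weight (walk \<xi> m)"
    by (metis ex_in_conv)
  have u: "base u \<in> carrier G" "u \<in> carrier \<Lambda>"
    using m(2) unit_fwd_carrier base_carrier by (auto simp: lit_def)
  let ?P = "\<lambda>g. g \<in> carrier G \<and> candidate (final \<xi>) g \<and> k \<le> weight g"
  have "?P (walk \<xi> m \<otimes>\<^bsub>G\<^esub> base u)"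
    using candidate_entry[OF reg m(1,2)] m(3) u walk_carrier[OF reg] by (simp add: weight_mult_base)
  then obtain g where "?P g" "\<And>g'. ?P g' \<Longrightarrow> weight g \<le> weight g'"
    using ex_has_least_nat[of ?P _ weight] by blast
  then show ?thesis unfolding selected_def by blast
qed

section \<open>Invariant events and the limit configuration\<close>

lemma AE_regular: "AE \<xi> in increments. regular \<xi>"
proof -
  obtain x where x: "x \<in> strict_fwd" "base x \<in> set_pmf \<mu>" using ex_strict_move by blast
  have "AE \<xi> in increments. \<forall>N. \<exists>m\<ge>N. \<forall>i<(1::nat). \<xi> (i + m) = base x"
    using x(2) by (intro AE_word_frequently)
  with AE_in_support show ?thesis
  proof eventually_elim
    case (elim \<xi>)
    have "\<exists>m\<ge>N. snd (\<xi> m) \<in> strict_fwd" for N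
    proof -
      obtain m where "m \<ge> N" "\<xi> m = base x" using elim(2) by fastforce
      then show ?thesis using x(1) by (auto simp: base_def)
    qed
    then show ?case using elim(1) by (simp add: regular_def)
  qed
qed

text \<open>The walk lights the lamp at its starting point and leaves the coset at once, which
  freezes this lamp.\<close>

lemma one_mem_lit:
  assumes reg: "regular \<xi>" and "\<xi> 0 = (config_delta L \<Lambda> s, \<one>\<^bsub>\<Lambda>\<^esub>)" "\<xi> 1 = base x"
    and "s \<in> carrier L" "s \<noteq> \<one>\<^bsub>L\<^esub>" "x \<in> strict_fwd"
  shows "\<one>\<^bsub>\<Lambda>\<^esub> \<in> lit \<xi>"
proof -
  have x: "x \<in> carrier \<Lambda>" using assms(6) by (rule strict_fwd_carrier)
  have c: "\<xi> 0 \<in> carrier G" using step_support[OF reg] support by blast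
  have "walk \<xi> (Suc (Suc 0)) = \<xi> 0 \<otimes>\<^bsub>G\<^esub> base x" using c assms(3) by simp
  then have "lamp \<xi> (Suc (Suc 0)) = config_delta L \<Lambda> s" "pos \<xi> (Suc (Suc 0)) = x"
    using fst_mult_base[OF c x] snd_mult_base[of "\<xi> 0" x] assms(2) x by simp_all
  then have "final \<xi> \<one>\<^bsub>\<Lambda>\<^esub> = s"
    using final_eq_lamp_past[OF reg, of "\<one>\<^bsub>\<Lambda>\<^esub>" "Suc (Suc 0)"] x assms(6)
    by (simp add: precedes_def config_delta_def del: walk_position.simps)
  then show ?thesis using assms(5) one_unit_fwd by (simp add: lit_def)
qed

lemma AE_lit_frequently:
  "AE \<xi> in increments. \<forall>N. \<exists>m\<ge>N. entry \<xi> m \<and> lit (shift_seq m \<xi>) \<noteq> {}"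
proof -
  obtain x where x: "x \<in> strict_fwd" "base x \<in> set_pmf \<mu>" using ex_strict_move by blast
  obtain s where s: "s \<in> carrier L" "s \<noteq> \<one>\<^bsub>L\<^esub>" "(config_delta L \<Lambda> s, \<one>\<^bsub>\<Lambda>\<^esub>) \<in> set_pmf \<mu>"
    using ex_lamp_move by blast
  \<comment> \<open>The first base move makes the next time an entry, the lamp move lights its site,
    and the last base move leaves before the lamp can change.\<close>
  let ?w = "\<lambda>i. if i = Suc 0 then (config_delta L \<Lambda> s, \<one>\<^bsub>\<Lambda>\<^esub>) else base x"
  have "AE \<xi> in increments. \<forall>N. \<exists>m\<ge>N. \<forall>i<3. \<xi> (i + m) = ?w i"
    using x(2) s(3) by (intro AE_word_frequently) simp
  with AE_regular show ?thesis
  proof eventually_elim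
    case (elim \<xi>)
    show ?case
    proof
      fix N
      obtain m where m: "m \<ge> N" "\<forall>i<3. \<xi> (i + m) = ?w i" using elim(2) by blast
      have "\<xi> m = base x" "\<xi> (Suc m) = (config_delta L \<Lambda> s, \<one>\<^bsub>\<Lambda>\<^esub>)" "\<xi> (Suc (Suc m)) = base x"
        using m(2)[rule_format, of 0] m(2)[rule_format, of 1] m(2)[rule_format, of 2] by simp_all
      then have "entry \<xi> (Suc m)" "\<one>\<^bsub>\<Lambda>\<^esub> \<in> lit (shift_seq (Suc m) \<xi>)"
        using x(1) s by (auto simp: entry_def base_def intro!: one_mem_lit regular_shift[OF elim(1)])
      then show "\<exists>m\<ge>N. entry \<xi> m \<and> lit (shift_seq m \<xi>) \<noteq> {}"
        using m(1) le_SucI by blast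
    qed
  qed
qed

section \<open>Measurability and tightness of the lit sites of an excursion\<close>

lemma final_measurable: "final \<in> measurable increments (config_algebra L \<Lambda>)"
  by (rule measurable_compose[OF walk_measurable limit_config_measurable])

lemma countable_unit_fwd: "countable unit_fwd"
  by (rule countable_subset[OF _ countable_\<Lambda>]) (auto intro: unit_fwd_carrier)

lemma lit_subset_sets: "{\<xi> \<in> space increments. lit \<xi> \<subseteq> F} \<in> sets increments"
proof -
  have "{\<xi> \<in> space increments. final \<xi> u = \<one>\<^bsub>L\<^esub>} \<in> sets increments" if "u \<in> unit_fwd" for u
  proof -
    have "final -` {\<phi> \<in> configs L \<Lambda>. \<phi> u \<in> {\<one>\<^bsub>L\<^esub>}} \<inter> space increments \<in> sets increments"
      by (rule measurable_sets[OF final_measurable config_coordinate_sets[OF unit_fwd_carrier[OF that]]])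
    also have "final -` {\<phi> \<in> configs L \<Lambda>. \<phi> u \<in> {\<one>\<^bsub>L\<^esub>}} \<inter> space increments =
        {\<xi> \<in> space increments. final \<xi> u = \<one>\<^bsub>L\<^esub>}"
      using limit_config_configs[OF walk_trajectory] by auto
    finally show ?thesis .
  qed
  then have "{\<xi> \<in> space increments. \<forall>u\<in>unit_fwd - F. final \<xi> u = \<one>\<^bsub>L\<^esub>} \<in> sets increments"
    by (intro sets.sets_Collect_countable_All') (auto simp: countable_unit_fwd)
  also have "{\<xi> \<in> space increments. \<forall>u\<in>unit_fwd - F. final \<xi> u = \<one>\<^bsub>L\<^esub>} =
      {\<xi> \<in> space increments. lit \<xi> \<subseteq> F}"
    by (auto simp: lit_def)
  finally show ?thesis .
qed

lemma lit_not_subset_sets: "{\<xi> \<in> space increments. \<not> lit \<xi> \<subseteq> F} \<in> sets increments"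
  using lit_subset_sets by (rule sets.sets_Collect_neg)

text \<open>Nonemptiness is written as the case \<open>F = {}\<close> of the events used for
  tightness. The word of \<open>one_mem_lit\<close> has positive probability.\<close>

lemma prob_lit_pos: "prob {\<xi> \<in> space increments. \<not> lit \<xi> \<subseteq> {}} > 0"
proof -
  obtain x where x: "x \<in> strict_fwd" "base x \<in> set_pmf \<mu>" using ex_strict_move by blast
  obtain s where s: "s \<in> carrier L" "s \<noteq> \<one>\<^bsub>L\<^esub>" "(config_delta L \<Lambda> s, \<one>\<^bsub>\<Lambda>\<^esub>) \<in> set_pmf \<mu>"
    using ex_lamp_move by blast
  let ?w = "\<lambda>i. if i = 0 then (config_delta L \<Lambda> s, \<one>\<^bsub>\<Lambda>\<^esub>) else base x"
  let ?W = "{\<xi> \<in> space increments. \<forall>i<2. \<xi> i = ?w i}"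
  have "0 < prob ?W"
    using x(2) s(3) by (intro prob_word_pos) simp
  also have "prob ?W \<le> prob {\<xi> \<in> space increments. \<not> lit \<xi> \<subseteq> {}}"
  proof (rule seq.P.finite_measure_mono_AE[OF _ lit_not_subset_sets])
    show "AE \<xi> in increments. \<xi> \<in> ?W \<longrightarrow> \<xi> \<in> {\<xi> \<in> space increments. \<not> lit \<xi> \<subseteq> {}}"
      using AE_regular
    proof (eventually_elim, intro impI)
      fix \<xi> assume reg: "regular \<xi>" and W: "\<xi> \<in> ?W"
      have "\<xi> 0 = (config_delta L \<Lambda> s, \<one>\<^bsub>\<Lambda>\<^esub>)" "\<xi> 1 = base x" using W by auto
      then have "\<one>\<^bsub>\<Lambda>\<^esub> \<in> lit \<xi>" using reg s x by (intro one_mem_lit)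
      then show "\<xi> \<in> {\<xi> \<in> space increments. \<not> lit \<xi> \<subseteq> {}}" using W by auto
    qed
  qed
  finally show ?thesis .
qed

text \<open>After the first step in T the initial coset is never visited again, and the
  configuration at that time has finite support.\<close>

lemma finite_lit:
  assumes "regular \<xi>"
  shows "finite (lit \<xi>)"
proof -
  obtain m where "snd (\<xi> m) \<in> strict_fwd" using assms by (auto simp: regular_def)
  then have m: "entry \<xi> (Suc m)" by (simp add: entry_def)
  have "lit \<xi> \<subseteq> supp (lamp \<xi> (Suc m))"
  proof
    fix u assume "u \<in> lit \<xi>"
    then have u: "u \<in> unit_fwd" "final \<xi> u \<noteq> \<one>\<^bsub>L\<^esub>" by (auto simp: lit_def)
    note uc = unit_fwd_carrier[OF u(1)]
    have "precedes (pos \<xi> 0 \<otimes>\<^bsub>\<Lambda>\<^esub> u) (pos \<xi> (Suc m))"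
      by (rule precedes_unit_later_entry[OF assms u(1) m]) simp
    then have "precedes u (pos \<xi> (Suc m))"
      using uc by (simp add: one_G del: walk_position.simps(2))
    then show "u \<in> supp (lamp \<xi> (Suc m))"
      unfolding supp_entry[OF assms m] using u uc by blast
  qed
  then show ?thesis using finite_supp_walk[OF assms] finite_subset by blast
qed

text \<open>An almost surely finite random subset of a countable set lies, up to small probability,
  in a large finite piece of an enumeration.\<close>

lemma lit_tight:
  assumes "0 < \<epsilon>"
  obtains F where "finite F" "F \<subseteq> unit_fwd" "prob {\<xi> \<in> space increments. \<not> lit \<xi> \<subseteq> F} < \<epsilon>"
proof -
  let ?F = "\<lambda>n. from_nat_into unit_fwd ` {..<n}"
  let ?A = "\<lambda>n. {\<xi> \<in> space increments. lit \<xi> \<subseteq> ?F n}"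
  have ne: "unit_fwd \<noteq> {}" using one_unit_fwd by blast
  have "incseq ?A"
    by (rule incseq_SucI) (auto simp: lessThan_Suc)
  then have "(\<lambda>n. prob (?A n)) \<longlonglongrightarrow> prob (\<Union>n. ?A n)"
    using lit_subset_sets by (intro seq.P.finite_Lim_measure_incseq) auto
  moreover have "prob (\<Union>n. ?A n) = 1"
  proof (rule seq.P.prob_eq_1[THEN iffD2])
    show "(\<Union>n. ?A n) \<in> sets increments" using lit_subset_sets by (intro sets.countable_UN) auto
    show "AE \<xi> in increments. \<xi> \<in> (\<Union>n. ?A n)"
      using AE_regular AE_space
    proof eventually_elim
      case (elim \<xi>)
      have "\<exists>n. S \<subseteq> ?F n" if "finite S" "S \<subseteq> unit_fwd" for S
        using that
      proof (induction rule: finite_induct)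
        case (insert u S)
        then obtain n where "S \<subseteq> ?F n" by blast
        moreover obtain k where "u = from_nat_into unit_fwd k"
          using insert.prems from_nat_into_surj[OF countable_unit_fwd] by (metis insert_subset)
        ultimately have "insert u S \<subseteq> ?F (n + Suc k)" by force
        then show ?case by blast
      qed simp
      then show ?case
        using finite_lit[OF elim(1)] elim(2) by (auto simp: lit_def)
    qed
  qed
  ultimately have "(\<lambda>n. prob (?A n)) \<longlonglongrightarrow> 1" by simp
  then have "eventually (\<lambda>n. prob (?A n) > 1 - \<epsilon>) sequentially"
    using assms by (auto intro: order_tendstoD)
  then obtain n where n: "prob (?A n) > 1 - \<epsilon>" by (auto simp: eventually_sequentially)
  have "prob {\<xi> \<in> space increments. \<not> lit \<xi> \<subseteq> ?F n} = 1 - prob (?A n)"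
    using seq.P.prob_compl[OF lit_subset_sets[of "?F n"]]
    by (simp add: set_diff_eq Collect_conj_eq cong: conj_cong)
  with n have "prob {\<xi> \<in> space increments. \<not> lit \<xi> \<subseteq> ?F n} < \<epsilon>" by simp
  moreover have "?F n \<subseteq> unit_fwd" using from_nat_into[OF ne] by blast
  ultimately show ?thesis using that[of "?F n"] by simp
qed

lemma determined_first_entry: "determined m {\<xi> \<in> space increments. first_entry k \<xi> m}"
proof (rule determinedI)
  fix \<xi> \<eta> assume \<xi>: "\<xi> \<in> {\<xi> \<in> space increments. first_entry k \<xi> m}"
    and \<eta>: "\<eta> \<in> space increments" and eq: "\<And>i. i < m \<Longrightarrow> \<xi> i = \<eta> i"
  have "walk \<xi> n = walk \<eta> n" if "n \<le> m" for n
    by (rule walk_position_cong) (use eq that in auto)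
  moreover have "entry \<xi> n \<longleftrightarrow> entry \<eta> n" if "n \<le> m" for n
    using eq[of "n - 1"] that by (cases n) (auto simp: entry_def)
  ultimately have "first_entry k \<xi> m \<longleftrightarrow> first_entry k \<eta> m"
    unfolding first_entry_def by (metis order_refl less_imp_le)
  then show "\<eta> \<in> {\<xi> \<in> space increments. first_entry k \<xi> m}"
    using \<xi> \<eta> by simp
qed auto

text \<open>The bad event ranges over every first entry and not just the one of the selected coset,
  because singling out the latter needs knowledge of the future.\<close>

definition untight :: "nat \<Rightarrow> 'b set \<Rightarrow> (nat \<Rightarrow> ('b \<Rightarrow> 'a) \<times> 'b) set" where
  "untight k F = {\<xi> \<in> space increments. \<exists>m. first_entry k \<xi> m \<and> \<not> lit (shift_seq m \<xi>) \<subseteq> F}"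

text \<open>
  The events that \<open>m\<close> is a first entry and that the coset entered gets lit are disjoint for different
  \<open>m\<close>, and the excursion is independent of the past. So the probabilities of the first entries sum up
  to at most the inverse of the probability that an excursion lights a lamp.
\<close>

lemma untight_sets: "untight k F \<in> sets increments"
  and prob_untight: "prob (untight k F) * prob {\<xi> \<in> space increments. \<not> lit \<xi> \<subseteq> {}} \<le>
    prob {\<xi> \<in> space increments. \<not> lit \<xi> \<subseteq> F}"
proof -
  let ?V = "\<lambda>F. {\<xi> \<in> space increments. \<not> lit \<xi> \<subseteq> F}"
  let ?A = "\<lambda>m. {\<xi> \<in> space increments. first_entry k \<xi> m}"
  let ?C = "\<lambda>F m. ?A m \<inter> {\<xi> \<in> space increments. shift_seq m \<xi> \<in> ?V F}"
  note As = determined_sets[OF determined_first_entry]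
  have C: "?C F m \<in> sets increments" for F m
    by (intro sets.Int As shift_sets lit_not_subset_sets)
  have pC: "prob (?C F m) = prob (?A m) * prob (?V F)" for F m
    by (intro prob_past_future determined_first_entry lit_not_subset_sets)
  have untight: "untight k F = (\<Union>m. ?C F m)"
    unfolding untight_def using shift_space by blast
  show "untight k F \<in> sets increments"
    unfolding untight using C by (intro sets.countable_UN) auto
  \<comment> \<open>Uniqueness of the lit first entry is known for regular sequences only, so the
    events become disjoint after removal of a null set.\<close>
  obtain N where N: "{\<xi> \<in> space increments. \<not> regular \<xi>} \<subseteq> N" "N \<in> null_sets increments"
    using AE_regular by (auto elim!: AE_E simp: null_sets_def)
  let ?B = "\<lambda>m. ?C {} m - N"
  have B: "?B m \<in> sets increments" for m
    by (rule sets.Diff[OF C null_setsD2[OF N(2)]])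
  have "disjoint_family ?B"
    unfolding disjoint_family_on_def
  proof (intro ballI impI)
    fix m n :: nat assume "m \<noteq> n"
    have False if "\<xi> \<in> ?B m" "\<xi> \<in> ?B n" for \<xi>
    proof -
      have "regular \<xi>" using that N(1) by blast
      moreover have "first_entry k \<xi> m" "first_entry k \<xi> n"
        "lit (shift_seq m \<xi>) \<noteq> {}" "lit (shift_seq n \<xi>) \<noteq> {}"
        using that by blast+
      ultimately show False using first_entry_unique \<open>m \<noteq> n\<close> by blast
    qed
    then show "?B m \<inter> ?B n = {}" by blast
  qed
  then have "(\<lambda>m. prob (?B m)) sums prob (\<Union>m. ?B m)"
    using B by (intro seq.P.finite_measure_UNION) auto
  moreover have "prob (?B m) = prob (?A m) * prob (?V {})" for m
    unfolding pC[symmetric] by (rule measure_Diff_null_set[OF C N(2)])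
  ultimately have sums: "(\<lambda>m. prob (?A m) * prob (?V {})) sums prob (\<Union>m. ?B m)" by simp
  \<comment> \<open>The expected number of first entries.\<close>
  define a where "a = (\<Sum>m. prob (?A m))"
  have summable: "summable (\<lambda>m. prob (?A m))"
    using sums_summable[OF sums] prob_lit_pos
      summable_cmult_iff[of "prob (?V {})" "\<lambda>m. prob (?A m)"]
    by (simp add: mult.commute)
  have "a * prob (?V {}) = prob (\<Union>m. ?B m)"
    unfolding a_def using sums_unique2[OF sums_mult2[OF summable_sums[OF summable]] sums] .
  then have a: "a * prob (?V {}) \<le> 1" by simp
  have "prob (untight k F) \<le> (\<Sum>m. prob (?C F m))"
    unfolding untight using C summable_mult2[OF summable]
    by (intro seq.P.finite_measure_subadditive_countably) (auto simp only: pC)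
  also have "\<dots> = a * prob (?V F)"
    unfolding pC a_def using suminf_mult2[OF summable] by simp
  finally have "prob (untight k F) * prob (?V {}) \<le> (a * prob (?V {})) * prob (?V F)"
    using prob_lit_pos by (simp add: mult.assoc mult.commute mult_left_mono)
  also have "\<dots> \<le> 1 * prob (?V F)"
    using a by (intro mult_right_mono) auto
  finally show "prob (untight k F) * prob (?V {}) \<le> prob (?V F)" by simp
qed

text \<open>The Harnack inequality iterated along a word for \<open>u\<close>. A lamp move in the
  word projects to the identity and is dropped, so no lamp is touched. The constant depends on
  \<open>u\<close> alone and thus serves at every point of the trajectory.\<close>

lemma hit_base_dist:
  assumes "u \<in> fwd"
  shows "\<exists>c>0. \<forall>E\<in>invariant_sets G. \<forall>g\<in>carrier G. \<forall>b\<in>{0, 1}.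
    c * \<bar>hit E (g \<otimes>\<^bsub>G\<^esub> base u) - b\<bar> \<le> \<bar>hit E g - b\<bar>"
  using assms unfolding fwd_def
proof (induction rule: semigroup_generate.induct)
  case (incl u)
  then obtain s where s: "s \<in> set_pmf \<mu>" "u = snd s" by blast
  show ?case
    using s(1)
  proof (cases rule: step_cases)
    case (1 l)
    then show ?thesis using s(2) by (intro exI[of _ 1]) (simp add: base_one)
  next
    case 2
    then show ?thesis
      using s hit_step_dist[OF _ _ s(1)] by (intro exI[of _ "pmf \<mu> s"]) (auto simp: pmf_positive)
  qed
next
  case (mult u v)
  then obtain c d where c: "c > 0" and c': "\<And>E g b. E \<in> invariant_sets G \<Longrightarrow> g \<in> carrier G \<Longrightarrow> b \<in> {0, 1} \<Longrightarrow>
      c * \<bar>hit E (g \<otimes>\<^bsub>G\<^esub> base u) - b\<bar> \<le> \<bar>hit E g - b\<bar>"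
    and d: "d > 0" and d': "\<And>E g b. E \<in> invariant_sets G \<Longrightarrow> g \<in> carrier G \<Longrightarrow> b \<in> {0, 1} \<Longrightarrow>
      d * \<bar>hit E (g \<otimes>\<^bsub>G\<^esub> base v) - b\<bar> \<le> \<bar>hit E g - b\<bar>"
    by metis
  have uv: "u \<in> carrier \<Lambda>" "v \<in> carrier \<Lambda>"
    using mult.hyps fwd_carrier by (auto simp: fwd_def)
  show ?case
  proof (intro exI[of _ "c * d"] conjI ballI)
    fix E g and b :: real
    assume E: "E \<in> invariant_sets G" and g: "g \<in> carrier G" and b: "b \<in> {0, 1}"
    have "g \<otimes>\<^bsub>G\<^esub> base (u \<otimes>\<^bsub>\<Lambda>\<^esub> v) = (g \<otimes>\<^bsub>G\<^esub> base u) \<otimes>\<^bsub>G\<^esub> base v"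
      using g uv by (simp add: G.m_assoc base_carrier flip: base_mult)
    then have "d * \<bar>hit E (g \<otimes>\<^bsub>G\<^esub> base (u \<otimes>\<^bsub>\<Lambda>\<^esub> v)) - b\<bar> \<le> \<bar>hit E (g \<otimes>\<^bsub>G\<^esub> base u) - b\<bar>"
      using d'[OF E _ b, of "g \<otimes>\<^bsub>G\<^esub> base u"] g uv by (simp add: base_carrier)
    then have "c * (d * \<bar>hit E (g \<otimes>\<^bsub>G\<^esub> base (u \<otimes>\<^bsub>\<Lambda>\<^esub> v)) - b\<bar>) \<le> c * \<bar>hit E (g \<otimes>\<^bsub>G\<^esub> base u) - b\<bar>"
      using c by (intro mult_left_mono) auto
    then show "c * d * \<bar>hit E (g \<otimes>\<^bsub>G\<^esub> base (u \<otimes>\<^bsub>\<Lambda>\<^esub> v)) - b\<bar> \<le> \<bar>hit E g - b\<bar>"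
      using c'[OF E g b] by (simp add: mult.assoc)
  qed (use c d in simp)
qed

lemma hit_base_dist_finite:
  assumes "finite F" "F \<subseteq> fwd"
  obtains c where "c > 0" "\<And>u E g b. u \<in> F \<Longrightarrow> E \<in> invariant_sets G \<Longrightarrow> g \<in> carrier G \<Longrightarrow> b \<in> {0, 1} \<Longrightarrow>
    c * \<bar>hit E (g \<otimes>\<^bsub>G\<^esub> base u) - b\<bar> \<le> \<bar>hit E g - b\<bar>"
proof -
  let ?P = "\<lambda>c u. \<forall>E\<in>invariant_sets G. \<forall>g\<in>carrier G. \<forall>b\<in>{0, 1}.
    c * \<bar>hit E (g \<otimes>\<^bsub>G\<^esub> base u) - b\<bar> \<le> \<bar>hit E g - b\<bar>"
  have anti: "?P c u" if "?P d u" "c \<le> d" for c d u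
    using that by (meson abs_ge_zero mult_right_mono order_trans)
  have "\<exists>c>0. \<forall>u\<in>F. ?P c u"
    using assms
  proof (induction rule: finite_induct)
    case empty
    show ?case by (intro exI[of _ 1]) simp
  next
    case (insert u F)
    then obtain c where c: "c > 0" "\<forall>u\<in>F. ?P c u" by blast
    obtain d where d: "d > 0" "?P d u" using hit_base_dist insert.prems by blast
    have "\<forall>v\<in>insert u F. ?P (min c d) v"
    proof
      fix v assume "v \<in> insert u F"
      then consider "v = u" | "v \<in> F" by blast
      then show "?P (min c d) v"
      proof cases
        case 1
        show ?thesis unfolding 1 by (rule anti[OF d(2)]) simp
      next
        case 2
        show ?thesis by (rule anti[OF bspec[OF c(2) 2]]) simp
      qed
    qed
    then show ?case using c(1) d(1) by (intro exI[of _ "min c d"]) simp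
  qed
  then show ?thesis using that by metis
qed

lemma candidate_sets:
  assumes g: "g \<in> carrier G"
  shows "{\<phi> \<in> configs L \<Lambda>. candidate \<phi> g} \<in> sets (config_algebra L \<Lambda>)"
proof -
  \<comment> \<open>For fixed \<open>g\<close> this is a countable conjunction of conditions on
    single lamps. Where \<open>y\<close> does not precede, the set is everything or empty, a
    condition on \<open>g\<close> only.\<close>
  have "candidate \<phi> g \<longleftrightarrow> \<phi> (snd g) \<in> - {\<one>\<^bsub>L\<^esub>} \<and>
      (\<forall>y\<in>carrier \<Lambda>. \<phi> y \<in> (if precedes y (snd g) then {fst g y} else {l. fst g y = \<one>\<^bsub>L\<^esub>}))" for \<phi>
  proof -
    have "fst g \<in> extensional (carrier \<Lambda>)" "cut \<phi> (snd g) \<in> extensional (carrier \<Lambda>)"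
      using fst_configs[OF g] by (auto simp: configs_def cut_def PiE_iff)
    then have "fst g = cut \<phi> (snd g) \<longleftrightarrow> (\<forall>y\<in>carrier \<Lambda>. fst g y = cut \<phi> (snd g) y)"
      by (auto intro: extensionalityI)
    moreover have "fst g y = cut \<phi> (snd g) y \<longleftrightarrow>
        \<phi> y \<in> (if precedes y (snd g) then {fst g y} else {l. fst g y = \<one>\<^bsub>L\<^esub>})"
      if "y \<in> carrier \<Lambda>" for y
      using that by (auto simp: cut_def)
    ultimately show ?thesis
      unfolding candidate_def by (simp only: Compl_iff singleton_iff cong: ball_cong)
  qed
  moreover have "{\<phi> \<in> configs L \<Lambda>. \<phi> (snd g) \<in> - {\<one>\<^bsub>L\<^esub>} \<and>
      (\<forall>y\<in>carrier \<Lambda>. \<phi> y \<in> (if precedes y (snd g) then {fst g y} else {l. fst g y = \<one>\<^bsub>L\<^esub>}))}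
      \<in> sets (config_algebra L \<Lambda>)"
    using config_coordinate_sets snd_carrier[OF g] countable_\<Lambda>
    unfolding space_config_algebra[symmetric]
    by (intro sets.sets_Collect_conj sets.sets_Collect_countable_All')
  ultimately show ?thesis by simp
qed

lemma selected_sets:
  assumes g: "g \<in> carrier G"
  shows "{\<phi> \<in> configs L \<Lambda>. selected k \<phi> g} \<in> sets (config_algebra L \<Lambda>)"
  using candidate_sets countable_G g
  unfolding selected_def space_config_algebra[symmetric]
  by (intro sets.sets_Collect_conj sets.sets_Collect_countable_All' sets.sets_Collect_imp
      sets.sets_Collect_const)

text \<open>
  The approximating set asks whether the harmonic function \<^term>\<open>hit E\<close> exceeds \<open>1 / 2\<close> at the
  selected group elements. These are functions of the limit configuration, and they lie within a
  bounded number of steps of the trajectory, where \<^term>\<open>hit E\<close> is close to the indicator of \<open>E\<close>.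
\<close>

lemma approx_by_final:
  assumes E: "E \<in> invariant_sets G" and "0 < \<epsilon>"
  shows "\<exists>B\<in>sets (config_algebra L \<Lambda>).
    prob {\<xi> \<in> space increments. \<not> (walk \<xi> \<in> E \<longleftrightarrow> final \<xi> \<in> B)} < \<epsilon>"
proof -
  let ?V = "\<lambda>F. {\<xi> \<in> space increments. \<not> lit \<xi> \<subseteq> F}"
  have pV: "prob (?V {}) > 0" by (rule prob_lit_pos)
  \<comment> \<open>The factor \<open>prob (?V {})\<close> is cancelled by
    \<open>prob_untight\<close>, which leaves \<open>\<epsilon> / 4\<close> for the event
    \<open>?U\<close>.\<close>
  obtain F where F: "finite F" "F \<subseteq> unit_fwd" "prob (?V F) < \<epsilon> / 4 * prob (?V {})"
    by (rule lit_tight[of "\<epsilon> / 4 * prob (?V {})"]) (use \<open>0 < \<epsilon>\<close> pV in auto)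
  have "F \<subseteq> fwd" using F(2) unit_fwd_fwd by blast
  with F(1) obtain c where c: "c > 0" and near: "\<And>u E g b. u \<in> F \<Longrightarrow> E \<in> invariant_sets G \<Longrightarrow>
      g \<in> carrier G \<Longrightarrow> b \<in> {0, 1} \<Longrightarrow> c * \<bar>hit E (g \<otimes>\<^bsub>G\<^esub> base u) - b\<bar> \<le> \<bar>hit E g - b\<bar>"
    by (rule hit_base_dist_finite) blast
  \<comment> \<open>Distance below \<open>c / 2\<close> on the trajectory becomes distance below
    \<open>1 / 2\<close> at the selected element, which decides between 0 and 1.\<close>
  define \<delta> where "\<delta> = c / 2"
  have \<delta>: "\<delta> > 0" using c by (simp add: \<delta>_def)
  let ?H = "hit_event E \<one>\<^bsub>G\<^esub>"
  have H: "?H \<in> sets increments"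
    using E by (intro hit_event_sets) (auto simp: invariant_sets_def)
  \<comment> \<open>The first bound is for the approximation error itself; the second is divided by
    \<delta> in the maximal inequality.\<close>
  have "0 < min (\<epsilon> / 4) (\<delta> * (\<epsilon> / 4))" using \<open>0 < \<epsilon>\<close> \<delta> by simp
  from approx_determined[OF H this] obtain N A where A: "determined N A"
    and D: "prob ((?H - A) \<union> (A - ?H)) < min (\<epsilon> / 4) (\<delta> * (\<epsilon> / 4))"
    by blast
  let ?D = "(?H - A) \<union> (A - ?H)"
  let ?far = "\<lambda>\<xi> n. \<delta> \<le> \<bar>hit E (walk \<xi> n) - indicator A \<xi>\<bar>"
  let ?T = "{\<xi> \<in> space increments. \<exists>n\<ge>N. ?far \<xi> n}"
  \<comment> \<open>The number of increments deciding \<open>A\<close> is also the weight threshold,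
    so that a selected entry occurs at time \<open>N\<close> or later, where the maximal inequality
    applies.\<close>
  let ?U = "untight N F"
  have "\<delta> * prob ?T \<le> prob ?D" by (rule hit_maximal[OF E A \<delta>])
  with D have "\<delta> * prob ?T < \<delta> * (\<epsilon> / 4)" by simp
  then have T: "prob ?T < \<epsilon> / 4" using \<delta> by simp
  have "prob ?U * prob (?V {}) < \<epsilon> / 4 * prob (?V {})"
    using prob_untight[of N F] F(3) by linarith
  then have U: "prob ?U < \<epsilon> / 4" using pV by simp
  define B where "B = {\<phi> \<in> configs L \<Lambda>. \<exists>g\<in>carrier G. selected N \<phi> g \<and> 1 / 2 < hit E g}"
  have B: "B \<in> sets (config_algebra L \<Lambda>)"
    using selected_sets countable_G unfolding B_def space_config_algebra[symmetric]
    by (intro sets.sets_Collect_countable_Ex' sets.sets_Collect_conj sets.sets_Collect_const)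
  have As: "A \<in> sets increments" using A by (rule determined_sets)
  have Ts: "?T \<in> sets increments"
  proof -
    have "{\<xi> \<in> space increments. N \<le> n \<and> ?far \<xi> n} \<in> sets increments" for n
    proof (cases "N \<le> n")
      case True
      have "determined n {\<xi> \<in> space increments. N \<le> n \<and> ?far \<xi> n}"
      proof (rule determinedI)
        fix \<xi> \<eta> assume \<xi>: "\<xi> \<in> {\<xi> \<in> space increments. N \<le> n \<and> ?far \<xi> n}"
          and \<eta>: "\<eta> \<in> space increments" and eq: "\<And>i. i < n \<Longrightarrow> \<xi> i = \<eta> i"
        have "walk \<xi> n = walk \<eta> n" by (rule walk_position_cong) (rule eq)
        moreover have "indicator A \<xi> = (indicator A \<eta> :: real)"
          using determinedD[OF determined_mono[OF A True], of \<xi> \<eta>] \<xi> \<eta> eq by (auto simp: indicator_def)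
        ultimately show "\<eta> \<in> {\<xi> \<in> space increments. N \<le> n \<and> ?far \<xi> n}"
          using \<xi> \<eta> by simp
      qed auto
      then show ?thesis by (rule determined_sets)
    qed simp
    then show ?thesis by (rule sets.sets_Collect_countable_Ex)
  qed
  let ?S = "{\<xi> \<in> space increments. \<not> (walk \<xi> \<in> E \<longleftrightarrow> final \<xi> \<in> B)}"
  have ae: "AE \<xi> in increments. \<xi> \<in> ?S \<longrightarrow> \<xi> \<in> ?D \<union> (?T \<union> ?U)"
    using AE_regular AE_lit_frequently
  proof eventually_elim
    case (elim \<xi>)
    note reg = elim(1) and freq = elim(2)
    show ?case
    proof (intro impI, rule ccontr)
      assume S: "\<xi> \<in> ?S" and not: "\<xi> \<notin> ?D \<union> (?T \<union> ?U)"
      have \<xi>: "\<xi> \<in> space increments" using S by blast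
      have close: "\<bar>hit E g - indicator A \<xi>\<bar> < 1 / 2" if g: "g \<in> carrier G" and sel: "selected N (final \<xi>) g" for g
      proof -
        obtain m u where m: "first_entry N \<xi> m" and u: "u \<in> lit (shift_seq m \<xi>)" and gm: "g = walk \<xi> m \<otimes>\<^bsub>G\<^esub> base u"
          using selected_first_entry[OF reg g sel] .
        have "N \<le> m" using m weight_le_time[OF reg, of m] by (simp add: first_entry_def)
        then have "\<bar>hit E (walk \<xi> m) - indicator A \<xi>\<bar> < \<delta>" using not \<xi> by force
        moreover have "u \<in> F" using not \<xi> m u unfolding untight_def by blast
        then have "c * \<bar>hit E g - indicator A \<xi>\<bar> \<le> \<bar>hit E (walk \<xi> m) - indicator A \<xi>\<bar>"
          unfolding gm using E walk_carrier[OF reg] by (intro near) (auto simp: indicator_def)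
        ultimately have "c * \<bar>hit E g - indicator A \<xi>\<bar> < c * (1 / 2)" by (simp add: \<delta>_def)
        then show ?thesis using c by (simp only: mult_less_cancel_left_pos)
      qed
      \<comment> \<open>Existence is needed to conclude membership in \<open>B\<close> from
        \<open>A\<close>. Several elements may be selected, but \<open>close\<close> holds for all
        of them.\<close>
      obtain g where g: "g \<in> carrier G" "selected N (final \<xi>) g"
        using ex_selected[OF reg, of N] freq by blast
      have fin: "final \<xi> \<in> configs L \<Lambda>"
        by (intro limit_config_configs walk_trajectory \<xi>)
      have "final \<xi> \<in> B \<longleftrightarrow> \<xi> \<in> A"
      proof
        assume "\<xi> \<in> A"
        then have "\<bar>hit E g - 1\<bar> < 1 / 2" using close[OF g] by (simp only: indicator_simps)
        then have "1 / 2 < hit E g" by linarith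
        then show "final \<xi> \<in> B" using g fin unfolding B_def by blast
      next
        assume "final \<xi> \<in> B"
        then obtain g' where g': "g' \<in> carrier G" "selected N (final \<xi>) g'" "1 / 2 < hit E g'"
          unfolding B_def by blast
        show "\<xi> \<in> A"
        proof (rule ccontr)
          assume "\<xi> \<notin> A"
          then have "\<bar>hit E g' - 0\<bar> < 1 / 2" using close[OF g'(1,2)] by (simp only: indicator_simps simp_thms)
          with g'(3) show False by linarith
        qed
      qed
      moreover have "\<xi> \<in> A \<longleftrightarrow> walk \<xi> \<in> E"
        using not \<xi> unfolding hit_event_one by blast
      ultimately show False using S by blast
    qed
  qed
  have Ds: "?D \<in> sets increments"
    by (intro sets.Un sets.Diff H As)
  have TU: "?T \<union> ?U \<in> sets increments"
    by (intro sets.Un Ts untight_sets)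
  have "prob ?S \<le> prob (?D \<union> (?T \<union> ?U))"
    by (rule seq.P.finite_measure_mono_AE[OF ae sets.Un[OF Ds TU]])
  moreover have "prob (?D \<union> (?T \<union> ?U)) \<le> prob ?D + prob (?T \<union> ?U)"
    by (rule measure_Un_le[OF Ds TU])
  moreover have "prob (?T \<union> ?U) \<le> prob ?T + prob ?U"
    by (rule measure_Un_le[OF Ts untight_sets])
  ultimately have "prob ?S < \<epsilon>" using D T U \<open>0 < \<epsilon>\<close> by linarith
  with B show ?thesis by blast
qed

section \<open>From approximation to equality modulo null sets\<close>

lemma walk_final_sets:
  assumes "E \<in> sets (trajectories G)" "B \<in> sets (config_algebra L \<Lambda>)"
  shows "{\<omega> \<in> space (trajectories G). \<not> (\<omega> \<in> E \<longleftrightarrow> limit_config L \<Lambda> \<omega> \<in> B)} \<in> sets (trajectories G)"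
proof -
  have "limit_config L \<Lambda> -` B \<inter> space (trajectories G) \<in> sets (trajectories G)"
    by (rule measurable_sets[OF limit_config_measurable assms(2)])
  then have "(E - (limit_config L \<Lambda> -` B \<inter> space (trajectories G))) \<union>
      ((limit_config L \<Lambda> -` B \<inter> space (trajectories G)) - E) \<in> sets (trajectories G)"
    using assms(1) by auto
  also have "(E - (limit_config L \<Lambda> -` B \<inter> space (trajectories G))) \<union>
      ((limit_config L \<Lambda> -` B \<inter> space (trajectories G)) - E) =
      {\<omega> \<in> space (trajectories G). \<not> (\<omega> \<in> E \<longleftrightarrow> limit_config L \<Lambda> \<omega> \<in> B)}"
    using sets.sets_into_space[OF assms(1)] by blast
  finally show ?thesis .
qed

text \<open>Approximations with summable errors: by Borel-Cantelli almost every trajectory is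
  misjudged finitely often only, so the limit superior of the approximating sets is exact up to a
  null set.\<close>

lemma invariant_eq_limit_config:
  assumes E: "E \<in> invariant_sets G"
  shows "\<exists>B\<in>sets (config_algebra L \<Lambda>). AE \<omega> in walk_law G \<mu>. \<omega> \<in> E \<longleftrightarrow> limit_config L \<Lambda> \<omega> \<in> B"
proof -
  have Es: "E \<in> sets (trajectories G)" using E by (auto simp: invariant_sets_def)
  let ?S = "\<lambda>B. {\<xi> \<in> space increments. \<not> (walk \<xi> \<in> E \<longleftrightarrow> final \<xi> \<in> B)}"
  have *: "\<forall>n. \<exists>B. B \<in> sets (config_algebra L \<Lambda>) \<and> prob (?S B) < (1 / 2) ^ n"
  proof
    fix n
    have "0 < (1 / 2 :: real) ^ n" by simp
    from approx_by_final[OF E this]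
    show "\<exists>B. B \<in> sets (config_algebra L \<Lambda>) \<and> prob (?S B) < (1 / 2) ^ n" by blast
  qed
  obtain B where **: "\<forall>n. B n \<in> sets (config_algebra L \<Lambda>) \<and> prob (?S (B n)) < (1 / 2) ^ n"
    using choice[OF *] by (rule exE)
  then have B: "B n \<in> sets (config_algebra L \<Lambda>)" and S: "prob (?S (B n)) < (1 / 2) ^ n" for n
    by simp_all
  have Ss: "?S (B n) \<in> sets increments" for n
  proof -
    have "walk -` {\<omega> \<in> space (trajectories G). \<not> (\<omega> \<in> E \<longleftrightarrow> limit_config L \<Lambda> \<omega> \<in> B n)} \<inter> space increments
        \<in> sets increments"
      by (rule measurable_sets[OF walk_measurable walk_final_sets[OF Es B]])
    also have "walk -` {\<omega> \<in> space (trajectories G). \<not> (\<omega> \<in> E \<longleftrightarrow> limit_config L \<Lambda> \<omega> \<in> B n)} \<inter> space increments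
        = ?S (B n)"
      using walk_trajectory by blast
    finally show ?thesis .
  qed
  have "summable (\<lambda>n. prob (?S (B n)))"
    by (rule summable_comparison_test'[OF summable_geometric[of "1 / 2"], of 0])
       (use S in \<open>auto simp: less_imp_le\<close>)
  then have "AE \<xi> in increments. eventually (\<lambda>n. \<xi> \<in> space increments - ?S (B n)) sequentially"
    using Ss by (intro borel_cantelli_AE1) (auto simp: seq.P.emeasure_eq_measure)
  then have ae: "AE \<xi> in increments. walk \<xi> \<in> E \<longleftrightarrow> final \<xi> \<in> (\<Inter>N. \<Union>n\<in>{N..}. B n)"
  proof eventually_elim
    case (elim \<xi>)
    then obtain M where M: "\<And>n. n \<ge> M \<Longrightarrow> walk \<xi> \<in> E \<longleftrightarrow> final \<xi> \<in> B n"
      unfolding eventually_sequentially by blast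
    show ?case
    proof
      assume "walk \<xi> \<in> E"
      have "final \<xi> \<in> (\<Union>n\<in>{N..}. B n)" for N
        by (rule UN_I[of "max M N"]) (use M[of "max M N"] \<open>walk \<xi> \<in> E\<close> in simp_all)
      then show "final \<xi> \<in> (\<Inter>N. \<Union>n\<in>{N..}. B n)" by (rule INT_I)
    next
      assume "final \<xi> \<in> (\<Inter>N. \<Union>n\<in>{N..}. B n)"
      then have "final \<xi> \<in> (\<Union>n\<in>{M..}. B n)" by (rule INT_D) simp
      then obtain n where "n \<ge> M" "final \<xi> \<in> B n" by auto
      then show "walk \<xi> \<in> E" using M by simp
    qed
  qed
  have Bs: "(\<Inter>N. \<Union>n\<in>{N..}. B n) \<in> sets (config_algebra L \<Lambda>)"
    using B by (intro sets.countable_INT sets.countable_UN') auto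
  have "{\<omega> \<in> space (trajectories G). \<omega> \<in> E \<longleftrightarrow> limit_config L \<Lambda> \<omega> \<in> (\<Inter>N. \<Union>n\<in>{N..}. B n)}
      \<in> sets (trajectories G)"
    using sets.sets_Collect_neg[OF walk_final_sets[OF Es Bs]] by simp
  then have "AE \<omega> in walk_law G \<mu>. \<omega> \<in> E \<longleftrightarrow> limit_config L \<Lambda> \<omega> \<in> (\<Inter>N. \<Union>n\<in>{N..}. B n)"
    unfolding walk_law_def using ae by (rule AE_distr_iff[OF walk_measurable, THEN iffD2])
  then show ?thesis using Bs by (rule bexI)
qed

lemma AE_lamps_stabilize: "AE \<omega> in walk_law G \<mu>. lamps_stabilize \<Lambda> \<omega>"
  unfolding walk_law_def AE_distr_iff[OF walk_measurable lamps_stabilize_sets]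
  using AE_regular by eventually_elim (rule lamps_stabilize_walk)

text \<open>One inclusion holds because the limit configuration ignores the shift. For the other, an
  invariant event differs from a preimage by two null sets, which the completion contains.\<close>

lemma eq_mod_limit_config:
  "eq_mod (walk_law G \<mu>) (sets (vimage_algebra (space (trajectories G)) (limit_config L \<Lambda>) (config_algebra L \<Lambda>)))
    (sets (invariant_algebra G))"
proof -
  let ?P = "walk_law G \<mu>" and ?\<Omega> = "space (trajectories G)"
  let ?V = "sets (vimage_algebra ?\<Omega> (limit_config L \<Lambda>) (config_algebra L \<Lambda>))"
  let ?I = "sets (invariant_algebra G)" and ?N = "null_sets (completion ?P)"
  have space_I: "space (invariant_algebra G) = ?\<Omega>"
    by (simp add: invariant_algebra_def space_measure_of_conv)
  have inv_sub: "invariant_sets G \<subseteq> Pow ?\<Omega>"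
    using sets.sets_into_space by (fastforce simp: invariant_sets_def)
  have I: "?I = sigma_sets ?\<Omega> (invariant_sets G)"
    using inv_sub unfolding invariant_algebra_def invariant_sets_def[symmetric] by (rule sets_measure_of)
  have V: "?V = {limit_config L \<Lambda> -` B \<inter> ?\<Omega> |B. B \<in> sets (config_algebra L \<Lambda>)}"
    using limit_config_configs by (intro sets_vimage_algebra2) (auto simp: space_config_algebra)
  have N_sub: "?N \<subseteq> Pow ?\<Omega>"
    using sets.sets_into_space[of _ "completion ?P"] by (fastforce simp: null_sets_def)
  have V_I: "?V \<subseteq> ?I"
    unfolding V using measurable_sets[OF limit_config_invariant_measurable] by (auto simp: space_I)
  have I_sub: "?I \<subseteq> Pow ?\<Omega>"
    using sets.space_closed[of "invariant_algebra G"] by (simp add: space_I)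
  then interpret C: sigma_algebra ?\<Omega> "sigma_sets ?\<Omega> (?V \<union> ?N)"
    using V_I N_sub by (intro sigma_algebra_sigma_sets) blast
  have "E \<in> sigma_sets ?\<Omega> (?V \<union> ?N)" if E: "E \<in> invariant_sets G" for E
  proof -
    obtain B where B: "B \<in> sets (config_algebra L \<Lambda>)"
      and ae: "AE \<omega> in ?P. \<omega> \<in> E \<longleftrightarrow> limit_config L \<Lambda> \<omega> \<in> B"
      using invariant_eq_limit_config[OF E] by blast
    let ?X = "limit_config L \<Lambda> -` B \<inter> ?\<Omega>"
    have Es: "E \<in> sets (trajectories G)" using E by (auto simp: invariant_sets_def)
    have Xs: "?X \<in> sets (trajectories G)"
      by (rule measurable_sets[OF limit_config_measurable B])
    have "E - ?X \<in> null_sets ?P" "?X - E \<in> null_sets ?P"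
    proof -
      have "AE \<omega> in ?P. \<omega> \<notin> E - ?X" using ae AE_space by eventually_elim simp
      moreover have "AE \<omega> in ?P. \<omega> \<notin> ?X - E" using ae AE_space by eventually_elim simp
      ultimately show "E - ?X \<in> null_sets ?P" "?X - E \<in> null_sets ?P"
        using Es Xs by (simp_all add: AE_iff_null_sets sets.Diff)
    qed
    then have "E - ?X \<in> sigma_sets ?\<Omega> (?V \<union> ?N)" "?X - E \<in> sigma_sets ?\<Omega> (?V \<union> ?N)"
      by (auto intro: null_sets_completionI)
    moreover have "?X \<in> sigma_sets ?\<Omega> (?V \<union> ?N)"
      unfolding V using B by blast
    moreover have "E = (?X - (?X - E)) \<union> (E - ?X)" by blast
    ultimately show ?thesis by (metis C.Diff C.Un)
  qed
  then have "?I \<subseteq> sigma_sets ?\<Omega> (?V \<union> ?N)"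
    unfolding I by (intro C.sigma_sets_subset) blast
  then have "sigma_sets ?\<Omega> (?I \<union> ?N) \<subseteq> sigma_sets ?\<Omega> (?V \<union> ?N)"
    by (intro C.sigma_sets_subset) auto
  moreover have "sigma_sets ?\<Omega> (?V \<union> ?N) \<subseteq> sigma_sets ?\<Omega> (?I \<union> ?N)"
    using V_I by (intro sigma_sets_mono') blast
  ultimately show ?thesis
    by (simp add: eq_mod_def completion_in_def)
qed

lemma poisson_boundary_limit_config:
  "poisson_boundary G \<mu> (limit_law L \<Lambda> \<mu>) (config_action L \<Lambda>) (limit_config L \<Lambda>)"
proof -
  have sets: "sets (limit_law L \<Lambda> \<mu>) = sets (config_algebra L \<Lambda>)"
    and space: "space (limit_law L \<Lambda> \<mu>) = configs L \<Lambda>"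
    by (simp_all add: limit_law_def space_config_algebra)
  have b: "limit_config L \<Lambda> \<in> measurable (walk_law G \<mu>) (config_algebra L \<Lambda>)"
    using limit_config_measurable by (simp add: measurable_cong_sets[OF sets_walk_law refl])
  have "prob_space (limit_law L \<Lambda> \<mu>)"
    unfolding limit_law_def
    by (rule prob_space.prob_space_distr[OF prob_space_walk_law[OF group_G countable_G support] b])
  moreover have "countably_generated (limit_law L \<Lambda> \<mu>)" "separates_points (limit_law L \<Lambda> \<mu>)"
    using countably_generated_config_algebra separates_points_config_algebra
    by (simp_all add: countably_generated_def separates_points_def sets space space_config_algebra)
  moreover have "group_action G (space (limit_law L \<Lambda> \<mu>)) (config_action L \<Lambda>)"
    unfolding space by (rule group_action_configs)
  moreover have "config_action L \<Lambda> g \<in> measurable (limit_law L \<Lambda> \<mu>) (limit_law L \<Lambda> \<mu>)"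
    if "g \<in> carrier G" for g
    using config_action_measurable[OF that] by (simp add: measurable_cong_sets[OF sets sets])
  moreover have "limit_config L \<Lambda> \<in> measurable (invariant_algebra G) (limit_law L \<Lambda> \<mu>)"
    using limit_config_invariant_measurable by (simp add: measurable_cong_sets[OF refl sets])
  moreover have "AE \<omega> in walk_law G \<mu>.
      limit_config L \<Lambda> (\<lambda>n. g \<otimes>\<^bsub>G\<^esub> \<omega> n) = config_action L \<Lambda> g (limit_config L \<Lambda> \<omega>)"
    if g: "g \<in> carrier G" for g
    using AE_lamps_stabilize AE_space
  proof eventually_elim
    case (elim \<omega>)
    then have \<omega>: "\<omega> \<in> space (trajectories G)" by simp
    show ?case
      using limit_config_translate(2)[OF \<omega> g elim(1)] limit_config_configs[OF \<omega>]
      by (simp add: config_action_eq)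
  qed
  moreover have "distr (walk_law G \<mu>) (limit_law L \<Lambda> \<mu>) (limit_config L \<Lambda>) = limit_law L \<Lambda> \<mu>"
    unfolding limit_law_def by (intro distr_cong) simp_all
  moreover have "eq_mod (walk_law G \<mu>)
      (sets (vimage_algebra (space (trajectories G)) (limit_config L \<Lambda>) (limit_law L \<Lambda> \<mu>)))
      (sets (invariant_algebra G))"
    using eq_mod_limit_config by (simp add: sets_vimage_algebra_cong[OF sets])
  ultimately show ?thesis
    unfolding poisson_boundary_def by blast
qed

end

theorem theorem3p3:
  fixes L :: "('a, 'c) monoid_scheme" and \<Lambda> :: "('b, 'd) monoid_scheme"
    and \<mu> :: "(('b \<Rightarrow> 'a) \<times> 'b) pmf"
  assumes "group L" and "countable (carrier L)" and "carrier L \<noteq> {\<one>\<^bsub>L\<^esub>}"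
    and "group \<Lambda>" and "countable (carrier \<Lambda>)" and "infinite (carrier \<Lambda>)"
    and "pmf_entropy \<mu> < \<infinity>"
    and "generate (wreath L \<Lambda>) (set_pmf \<mu>) = carrier (wreath L \<Lambda>)"
    and "set_pmf \<mu> \<subseteq> {(config_delta L \<Lambda> s, \<one>\<^bsub>\<Lambda>\<^esub>) | s. s \<in> carrier L} \<union>
      {(config_one L \<Lambda>, x) | x. x \<in> carrier \<Lambda>}"
    and "semigroup_generate \<Lambda> (set_pmf (map_pmf snd \<mu>)) \<noteq> carrier \<Lambda>"
  shows "(AE \<omega> in walk_law (wreath L \<Lambda>) \<mu>. lamps_stabilize \<Lambda> \<omega>) \<and>
    poisson_boundary (wreath L \<Lambda>) \<mu> (limit_law L \<Lambda> \<mu>) (config_action L \<Lambda>) (limit_config L \<Lambda>)"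
proof -
  interpret L: group L by fact
  interpret \<Lambda>: group \<Lambda> by fact
  have "semigroup_generate \<Lambda> (snd ` set_pmf \<mu>) \<noteq> carrier \<Lambda>"
    using assms(10) by simp
  interpret lamplighter L \<Lambda> \<mu>
    by unfold_locales fact+
  show ?thesis
    using AE_lamps_stabilize poisson_boundary_limit_config by blast
qed

end
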